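(* Let $n\ge2$ and let $z\in I_\infty$ be an involution with no descents greater than $n$ (i.e. $z(i)<z(i+1)$ for all $i>n$). Let $T=(t_1,\dots,t_k)$ be an $\mathsf{O}$-reduced tableau for $z$ with only one row, let $i_1<i_2<\cdots<i_k$ be the entries $\lceil t_1\rceil,\dots,\lceil t_k\rceil$ listed in increasing order, and set $\alpha^{\mathsf{O}}(T)=k\mathbf{e}_{i_1}+\mathbf{e}_{i_2}+\cdots+\mathbf{e}_{i_k}$. Then $\mathrm{BRF}^{\mathsf{O}}_n(T)\cong\mathrm{BRF}^{\mathsf{O}}_n(\alpha^{\mathsf{O}}(T))$ as $\mathfrak{q}^+_n$-crystals.
   Context: $\mathbf{e}_j$ is the weak composition with a $1$ in position $j$ and $0$ elsewhere. All notation for involutions, primed words, $\mathcal{R}^{\mathsf{O}}(z)$, $\mathrm{RF}^{\mathsf{O}}_n(z)$, its $\mathfrak{q}^+_n$-crystal operators, boundedness, $\mathrm{BRF}^{\mathsf{O}}_n(z)$, and $\mathrm{BRF}^{\mathsf{O}}_n(\alpha)$ is as follows. $S_\mathbb{Z}$ is the group of finitary permutations of $\mathbb{Z}$, generated by $s_i=(i\ i+1)$; $S_\infty,S_n$ the subgroups generated by $s_i$ ($i\ge1$), resp. $s_1,\dots,s_{n-1}$; $w_0$ longest in $S_n$; $\mathcal{R}(w)$ reduced words; $\circ$ the Demazure product ($v\circ w=vw$ when lengths add, $s_i\circ s_i=s_i$). $I_\mathbb{Z}$ involutions in $S_\mathbb{Z}$, $I_\infty=I_\mathbb{Z}\cap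 S_\infty$; $\mathcal{A}^{\mathsf{O}}(z)$ the minimal-length $w$ with $z=w^{-1}\circ w$; $\mathrm{Cyc}(z)=\{(a,b):a<b=z(a)\}$. Primed letters: $m'=m-\tfrac12$, order $\cdots<1'<1<2'<2<\cdots$, $\lceil\cdot\rceil$ removes primes. For a primed word $i=i_1\cdots i_\ell$ with $\lceil i\rceil\in\mathcal{R}(w)$, $a_j=s_{\lceil i_\ell\rceil}\cdots s_{\lceil i_{j+1}\rceil}(\lceil i_j\rceil)$, $b_j=s_{\lceil i_\ell\rceil}\cdots s_{\lceil i_{j+1}\rceil}(\lceil i_j\rceil+1)$, $\mathrm{Marked}(i)=\{(a_j,b_j):i_j\text{ primed}\}$; $\mathcal{R}^{\mathsf{O}}(z)$ is the set of such $i$ with $w\in\mathcal{A}^{\mathsf{O}}(z)$ and $\mathrm{Marked}(i)\subseteq\mathrm{Cyc}(z)$. $\mathrm{RF}^{\mathsf{O}}_n(z)$: $n$-tuples of strictly decreasing primed words with concatenation in $\mathcal{R}^{\mathsf{O}}(z)$, weight $(\ell(a^1),\dots,\ell(a^n))$. Its $\mathfrak{q}^+_n$-operators ($e_i,f_i$ for $i\in[n-1]$ via the prime-aware pairing rule with prime swapping; $e_{\bar1},f_{\bar1}$ moving the larger maximal letter between the first two factors with prime swapping; $e_{1'},f_{1'}$ removing/adding the prime on $\max(a^1)$; and $e_{\bar i},e_{\underline i},e_{i'}$ and their $f$-versions obtained by conjugating with $\sigma_i$, $\sigma_{w_0}$) are exactly: pairing of $(u,v)$: letters $c$ of $v$ taken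 right to left are paired with the largest unpaired $b\in u$ with $\lceil b\rceil<\lceil c\rceil$. $e_ia=\mathbf{0}$ if all letters of $a^{i+1}$ are paired; else $x$ = largest unpaired letter of $a^{i+1}$, $q\ge0$ minimal with $\lceil x\rceil+q\notin\lceil a^i\rceil$: remove $x$ from $a^{i+1}$, insert $x+q$ into $a^i$, swap primes on pairs $(b,c)$ with $\lceil x\rceil+q\ge\lceil c\rceil>\lceil x\rceil$. $f_ia=\mathbf{0}$ if all letters of $a^i$ are paired; else $y$ = smallest unpaired letter of $a^i$, $q\ge0$ minimal with $\lceil y\rceil-q\notin\lceil a^{i+1}\rceil$: remove $y$, insert $y-q$ into $a^{i+1}$, swap primes on pairs $(b,c)$ with $\lceil y\rceil>\lceil b\rceil\ge\lceil y\rceil-q$. (Swapping primes on two letters reverses both primes iff exactly one is primed.) $e_{\bar1}a=\mathbf{0}$ if $a^2=\emptyset$ or $\lceil\max a^2\rceil\le\lceil\max a^1\rceil$; else move $\max(a^2)$ to the start of $a^1$ and, if $a^1\ne\emptyset$, swap primes on the first two letters of the new first factor. $f_{\bar1}a=\mathbf{0}$ if $a^1=\emptyset$ or $\lceil\max a^1\rceil\le\lceil\max a^2\rceil$; else move $\max(a^1)$ to the start of $a^2$ giving $b$, and if $b^1\ne\emptyset$ swap primes on $\max(b^1)$ and $\max(b^2)$. $e_{1'}$ (resp. $f_{1'}$) removes (resp. adds) the prime on $\max(a^1)$ if $a^1\ne\emptyset$ and it is primed (resp. unprimed), else gives $\mathbf{0}$. With $\sigma_i(b)=f_i^kb$ for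 $k=\mathrm{wt}(b)_i-\mathrm{wt}(b)_{i+1}\ge0$ and $e_i^{-k}b$ otherwise: $e_{\bar i}=\sigma_{i-1}\sigma_ie_{\overline{i-1}}\sigma_i\sigma_{i-1}$, $e_{\underline i}=\sigma_{w_0}f_{\overline{n-i}}\sigma_{w_0}$, $f_{\underline i}=\sigma_{w_0}e_{\overline{n-i}}\sigma_{w_0}$, $e_{i'}=\sigma_{i-1}\cdots\sigma_1e_{1'}\sigma_1\cdots\sigma_{i-1}$, and similarly for $f$. Subsets carry the restricted structure (operators become $\mathbf{0}$ upon leaving). A $\mathfrak{q}^+_n$-crystal isomorphism is a weight-preserving bijection commuting with all $e_j,f_j$. One-row tableaux: a shifted tableau with one row is a sequence $T=(t_1,\dots,t_k)$ of elements of $\mathbb{Z}\sqcup\mathbb{Z}'$; it is an $\mathsf{O}$-reduced tableau for $z$ if $t_1$ is unprimed, $T$ is strictly increasing or strictly decreasing, and $t_1t_2\cdots t_k\in\mathcal{R}^{\mathsf{O}}(z)$. Orthogonal Coxeter–Knuth equivalence $\overset{\mathsf{O}}{\sim}$ on primed words is the transitive closure of: $\cdots ACB\cdots\sim\cdots CAB\cdots$ and $\cdots BCA\cdots\sim\cdots BAC\cdots$ for primed or unprimed $A,B,C$ with $\lceil A\rceil<\lceil B\rceil<\lceil C\rceil$; $\cdots aba\cdots\sim\cdots bab\cdots$, $\cdots a'b'a'\cdots\sim\cdots b'a'b'\cdots$, $\cdots a'ba\cdots\sim\cdots bab'\cdots$, $\cdots ab'a\cdots\sim\cdots ba'b\cdots$,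 $\cdots a'b'a\cdots\sim\cdots ba'b'\cdots$, $\cdots a'ba'\cdots\sim\cdots b'ab'\cdots$ for integers $|a-b|=1$; and, at the start of a word, $a\cdots\sim a'\cdots$, $ab\cdots\sim ba\cdots$, $ab'\cdots\sim ba'\cdots$, $a'b\cdots\sim b'a\cdots$, $a'b'\cdots\sim b'a'\cdots$ for integers $a,b$ (ellipses denote identical subwords). $\mathrm{RF}^{\mathsf{O}}_n(T)$ is the set of $a\in\mathrm{RF}^{\mathsf{O}}_n(z)$ with $a^1\cdots a^n\overset{\mathsf{O}}{\sim}t_1\cdots t_k$; $a$ is bounded if every letter $m$ of $a^i$ has $i\le\lceil m\rceil$; $\mathrm{BRF}^{\mathsf{O}}_n(z)$ is the set of bounded elements and $\mathrm{BRF}^{\mathsf{O}}_n(T)=\mathrm{RF}^{\mathsf{O}}_n(T)\cap\mathrm{BRF}^{\mathsf{O}}_n(z)$. For a symmetric weak composition $\alpha$ (i.e. $\lambda(\alpha)=\lambda(\alpha)^T$, $\lambda(\alpha)$ its sorted partition), let $u(\alpha)$ be the minimal-length $u\in S_\infty$ with $\alpha=u\lambda(\alpha)$ (acting by permuting positions), $w_\lambda\in S_\infty$ the unique permutation whose Rothe diagram $\{(i,w(j)):i<j,w(i)>w(j)\}$ equals $\{(i,j):j\le\lambda_i\}$, $\mathcal{B}=\mathrm{RF}^{\mathsf{O}}_n(w_{\lambda(\alpha)})$, $\mathfrak{D}_iX=\{b\in\mathcal{B}:e_i^kb\in X,\ k\ge0\}$, and $\mathrm{BRF}^{\mathsf{O}}_n(\alpha)=\mathfrak{D}_{i_1}\cdots\mathfrak{D}_{i_k}\mathrm{BRF}^{\mathsf{O}}_n(w_{\lambda(\alpha)})$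 for a reduced word $i_1\cdots i_k$ of $u(\alpha)$. *)

theory Defs
  imports "HOL-Combinatorics.Permutations" "HOL-Library.Multiset"
begin

subsection \<open>Finitary permutations of the integers\<close>

definition simple :: "int \<Rightarrow> int \<Rightarrow> int" where
  "simple i = transpose i (i + 1)"

definition word_perm :: "int list \<Rightarrow> int \<Rightarrow> int" where
  "word_perm is = foldr (\<lambda>i w. simple i \<circ> w) is id"

definition S_Z :: "(int \<Rightarrow> int) set" where
  "S_Z = {w. permutation w}"

text \<open>The subgroup generated by the \<open>simple i\<close> with \<open>i \<ge> 1\<close>; as the generators are
  involutions, its elements are exactly the products of generators.\<close>

definition S_inf :: "(int \<Rightarrow> int) set" where
  "S_inf = {word_perm is | is. set is \<subseteq> {1..}}"

definition I_inf :: "(int \<Rightarrow> int) set" where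
  "I_inf = {z \<in> S_inf. z \<circ> z = id}"

definition perm_length :: "(int \<Rightarrow> int) \<Rightarrow> nat" where
  "perm_length w = (LEAST l. \<exists>is. word_perm is = w \<and> length is = l)"

definition reduced_words :: "(int \<Rightarrow> int) \<Rightarrow> int list set" where
  "reduced_words w = {is. word_perm is = w \<and> length is = perm_length w}"

text \<open>The Demazure product is the associative product with \<open>v \<circ> w = vw\<close> when lengths add and
  \<open>s\<^sub>i \<circ> s\<^sub>i = s\<^sub>i\<close>. These rules force \<open>v \<circ> s\<^sub>i\<close> to be the longer of \<open>v\<close> and \<open>v s\<^sub>i\<close>, and
  \<open>v \<circ> w = (\<dots>(v \<circ> s\<^bsub>i\<^sub>1\<^esub>) \<circ> \<dots>) \<circ> s\<^bsub>i\<^sub>l\<^esub>\<close> for every reduced word \<open>i\<^sub>1\<dots>i\<^sub>l\<close> of \<open>w\<close>.\<close>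

definition demazure_step :: "(int \<Rightarrow> int) \<Rightarrow> int \<Rightarrow> int \<Rightarrow> int" where
  "demazure_step v i =
     (if perm_length (v \<circ> simple i) = perm_length v + 1 then v \<circ> simple i else v)"

definition demazure :: "(int \<Rightarrow> int) \<Rightarrow> (int \<Rightarrow> int) \<Rightarrow> int \<Rightarrow> int" where
  "demazure v w = foldl demazure_step v (SOME is. is \<in> reduced_words w)"

definition atoms_O :: "(int \<Rightarrow> int) \<Rightarrow> (int \<Rightarrow> int) set" where
  "atoms_O z = {w \<in> S_Z. demazure (inv w) w = z \<and>
     (\<forall>v \<in> S_Z. demazure (inv v) v = z \<longrightarrow> perm_length w \<le> perm_length v)}"

definition Cyc :: "(int \<Rightarrow> int) \<Rightarrow> (int \<times> int) set" where
  "Cyc z = {(a, b). a < b \<and> b = z a}"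


subsection \<open>Primed words\<close>

text \<open>\<open>Letter m False\<close> is the integer \<open>m\<close>, and \<open>Letter m True\<close> is \<open>m' = m - 1/2\<close>.
  The selector \<open>base\<close> is the operation written as a ceiling in the literature.\<close>

datatype letter = Letter (base: int) (primed: bool)

instantiation letter :: linorder
begin

definition less_eq_letter :: "letter \<Rightarrow> letter \<Rightarrow> bool" where
  "x \<le> y \<longleftrightarrow> 2 * base x - of_bool (primed x) \<le> 2 * base y - of_bool (primed y)"

definition less_letter :: "letter \<Rightarrow> letter \<Rightarrow> bool" where
  "x < y \<longleftrightarrow> 2 * base x - of_bool (primed x) < 2 * base y - of_bool (primed y)"

instance
proof
  fix x y :: letter
  assume "x \<le> y" "y \<le> x"
  then have eq: "2 * base x - of_bool (primed x) = 2 * base y - of_bool (primed y)"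
    by (simp add: less_eq_letter_def)
  then have "primed x = primed y"
    by (cases "primed x"; cases "primed y"; simp; presburger)
  with eq show "x = y"
    by (simp add: letter.expand)
qed (auto simp: less_eq_letter_def less_letter_def)

end

definition toggle :: "letter \<Rightarrow> letter" where
  "toggle x = Letter (base x) (\<not> primed x)"

definition marked :: "letter list \<Rightarrow> (int \<times> int) set" where
  "marked u = {(word_perm (rev (map base (drop (Suc j) u))) (base (u ! j)),
                word_perm (rev (map base (drop (Suc j) u))) (base (u ! j) + 1)) | j.
                j < length u \<and> primed (u ! j)}"

definition R_O :: "(int \<Rightarrow> int) \<Rightarrow> letter list set" where
  "R_O z = {u. (\<exists>w \<in> atoms_O z. map base u \<in> reduced_words w) \<and> marked u \<subseteq> Cyc z}"


subsection \<open>Factorizations and their crystal operators\<close>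

text \<open>A factorization \<open>a\<^sup>1, \<dots>, a\<^sup>n\<close> is a list of words with \<open>a\<^sup>i\<close> in list position \<open>i - 1\<close>.
  Partial operators have values in \<open>option\<close>, with \<open>None\<close> in the role of the symbol 0.\<close>

type_synonym factorization = "letter list list"

definition RF_O :: "nat \<Rightarrow> (int \<Rightarrow> int) \<Rightarrow> factorization set" where
  "RF_O n z = {a. length a = n \<and> (\<forall>u \<in> set a. sorted_wrt (>) u) \<and> concat a \<in> R_O z}"

definition weight :: "factorization \<Rightarrow> nat list" where
  "weight a = map length a"

definition decreasing_word :: "letter set \<Rightarrow> letter list" where
  "decreasing_word A = rev (sorted_list_of_set A)"

text \<open>In \<open>pair_letters U cs\<close>, \<open>U\<close> holds the letters of the left word still unpaired, and
  \<open>cs\<close> the letters of the right word not yet processed, in processing order.\<close>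

fun pair_letters :: "letter set \<Rightarrow> letter list \<Rightarrow> (letter \<times> letter) set" where
  "pair_letters U [] = {}"
| "pair_letters U (c # cs) =
     (let B = {b \<in> U. base b < base c} in
      if B = {} then pair_letters U cs
      else insert (Max B, c) (pair_letters (U - {Max B}) cs))"

definition pairing :: "letter list \<Rightarrow> letter list \<Rightarrow> (letter \<times> letter) set" where
  "pairing u v = pair_letters (set u) (rev v)"

definition shift :: "letter \<Rightarrow> int \<Rightarrow> letter" where
  "shift x q = Letter (base x + q) (primed x)"

text \<open>The effect on the left, respectively right, components of swapping primes on all pairs
  in \<open>S\<close>: both primes are reversed iff exactly one of the two letters is primed.\<close>

definition swap_left :: "(letter \<times> letter) set \<Rightarrow> letter \<Rightarrow> letter" where
  "swap_left S b = (if \<exists>(b', c) \<in> S. b' = b \<and> primed b \<noteq> primed c then toggle b else b)"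

definition swap_right :: "(letter \<times> letter) set \<Rightarrow> letter \<Rightarrow> letter" where
  "swap_right S c = (if \<exists>(b, c') \<in> S. c' = c \<and> primed b \<noteq> primed c then toggle c else c)"

definition e_pair :: "letter list \<Rightarrow> letter list \<Rightarrow> (letter list \<times> letter list) option" where
  "e_pair u v =
     (let P = pairing u v; X = set v - snd ` P in
      if X = {} then None
      else
        (let x = Max X;
             q = int (LEAST q. base x + int q \<notin> base ` set u);
             S = {(b, c) \<in> P. base x + q \<ge> base c \<and> base c > base x}
         in Some (decreasing_word (insert (shift x q) (swap_left S ` set u)),
                  decreasing_word (swap_right S ` (set v - {x})))))"

definition f_pair :: "letter list \<Rightarrow> letter list \<Rightarrow> (letter list \<times> letter list) option" where
  "f_pair u v =
     (let P = pairing u v; Y = set u - fst ` P in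
      if Y = {} then None
      else
        (let y = Min Y;
             q = int (LEAST q. base y - int q \<notin> base ` set v);
             S = {(b, c) \<in> P. base y > base b \<and> base b \<ge> base y - q}
         in Some (decreasing_word (swap_left S ` (set u - {y})),
                  decreasing_word (insert (shift y (- q)) (swap_right S ` set v)))))"

definition on_factors ::
  "(letter list \<Rightarrow> letter list \<Rightarrow> (letter list \<times> letter list) option) \<Rightarrow>
   nat \<Rightarrow> factorization \<Rightarrow> factorization option" where
  "on_factors g i a =
     (if 1 \<le> i \<and> i < length a
      then map_option (\<lambda>(u, v). a[i - 1 := u, i := v]) (g (a ! (i - 1)) (a ! i))
      else None)"

definition e_op :: "nat \<Rightarrow> factorization \<Rightarrow> factorization option" where
  "e_op = on_factors e_pair"

definition f_op :: "nat \<Rightarrow> factorization \<Rightarrow> factorization option" where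
  "f_op = on_factors f_pair"

text \<open>The factors are strictly decreasing, so \<open>hd\<close> is the maximal letter of a nonempty factor.
  In the next two definitions, swapping the primes of two letters is written as an exchange of
  their \<open>primed\<close> flags.\<close>

fun e_bar1_pair :: "letter list \<Rightarrow> letter list \<Rightarrow> (letter list \<times> letter list) option" where
  "e_bar1_pair u [] = None"
| "e_bar1_pair [] (x # v) = Some ([x], v)"
| "e_bar1_pair (y # u) (x # v) =
     (if base x \<le> base y then None
      else Some (Letter (base x) (primed y) # Letter (base y) (primed x) # u, v))"

fun f_bar1_pair :: "letter list \<Rightarrow> letter list \<Rightarrow> (letter list \<times> letter list) option" where
  "f_bar1_pair [] v = None"
| "f_bar1_pair (x # u) v =
     (if v \<noteq> [] \<and> base x \<le> base (hd v) then None
      else (case u of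
              [] \<Rightarrow> Some ([], x # v)
            | y # u' \<Rightarrow> Some (Letter (base y) (primed x) # u', Letter (base x) (primed y) # v)))"

definition e_bar1 :: "factorization \<Rightarrow> factorization option" where
  "e_bar1 = on_factors e_bar1_pair 1"

definition f_bar1 :: "factorization \<Rightarrow> factorization option" where
  "f_bar1 = on_factors f_bar1_pair 1"

fun e_prime1 :: "factorization \<Rightarrow> factorization option" where
  "e_prime1 ((x # u) # a) = (if primed x then Some ((toggle x # u) # a) else None)"
| "e_prime1 _ = None"

fun f_prime1 :: "factorization \<Rightarrow> factorization option" where
  "f_prime1 ((x # u) # a) = (if \<not> primed x then Some ((toggle x # u) # a) else None)"
| "f_prime1 _ = None"

definition comp_op :: "('a \<Rightarrow> 'a option) \<Rightarrow> ('a \<Rightarrow> 'a option) \<Rightarrow> 'a \<Rightarrow> 'a option"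
    (infixr "\<odot>" 55) where
  "(g \<odot> h) b = Option.bind (h b) g"

definition iterate_op :: "('a \<Rightarrow> 'a option) \<Rightarrow> nat \<Rightarrow> 'a \<Rightarrow> 'a option" where
  "iterate_op g k = ((\<odot>) g ^^ k) Some"

definition sigma :: "nat \<Rightarrow> factorization \<Rightarrow> factorization option" where
  "sigma i b =
     (let p = weight b ! (i - 1); q = weight b ! i in
      if p \<ge> q then iterate_op (f_op i) (p - q) b else iterate_op (e_op i) (q - p) b)"

text \<open>\<open>\<sigma>\<close> of the longest element of the symmetric group on \<open>n\<close> letters, by its reduced word
  \<open>1 \<cdot> 2 1 \<cdot> 3 2 1 \<cdots> (n-1) \<dots> 1\<close>; the \<open>\<sigma>\<^sub>i\<close> satisfy the braid relations.\<close>

definition sigma_w0 :: "nat \<Rightarrow> factorization \<Rightarrow> factorization option" where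
  "sigma_w0 n = foldr (\<lambda>i g. sigma i \<odot> g) (concat (map (\<lambda>i. rev [1..<Suc i]) [1..<n])) Some"

text \<open>\<open>bar_op\<close> and \<open>prime_op\<close> yield the operators with barred and primed index \<open>i \<ge> 1\<close> from the
  given one with index \<open>1\<close>; the value at index 0 is irrelevant.\<close>

primrec bar_op ::
  "(factorization \<Rightarrow> factorization option) \<Rightarrow> nat \<Rightarrow> factorization \<Rightarrow> factorization option" where
  "bar_op g 0 = (\<lambda>_. None)"
| "bar_op g (Suc i) =
     (if i = 0 then g
      else sigma i \<odot> sigma (Suc i) \<odot> bar_op g i \<odot> sigma (Suc i) \<odot> sigma i)"

primrec prime_op ::
  "(factorization \<Rightarrow> factorization option) \<Rightarrow> nat \<Rightarrow> factorization \<Rightarrow> factorization option" where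
  "prime_op g 0 = (\<lambda>_. None)"
| "prime_op g (Suc i) = (if i = 0 then g else sigma i \<odot> prime_op g i \<odot> sigma i)"

datatype crystal_index = Plain nat | Bar nat | Under nat | Prime nat

definition crystal_indices :: "nat \<Rightarrow> crystal_index set" where
  "crystal_indices n =
     Plain ` {1..<n} \<union> Bar ` {1..<n} \<union> Under ` {1..<n} \<union> Prime ` {1..n}"

primrec crystal_e :: "nat \<Rightarrow> crystal_index \<Rightarrow> factorization \<Rightarrow> factorization option" where
  "crystal_e n (Plain i) = e_op i"
| "crystal_e n (Bar i) = bar_op e_bar1 i"
| "crystal_e n (Under i) = sigma_w0 n \<odot> bar_op f_bar1 (n - i) \<odot> sigma_w0 n"
| "crystal_e n (Prime i) = prime_op e_prime1 i"

primrec crystal_f :: "nat \<Rightarrow> crystal_index \<Rightarrow> factorization \<Rightarrow> factorization option" where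
  "crystal_f n (Plain i) = f_op i"
| "crystal_f n (Bar i) = bar_op f_bar1 i"
| "crystal_f n (Under i) = sigma_w0 n \<odot> bar_op e_bar1 (n - i) \<odot> sigma_w0 n"
| "crystal_f n (Prime i) = prime_op f_prime1 i"

definition restrict_op :: "'a set \<Rightarrow> ('a \<Rightarrow> 'a option) \<Rightarrow> 'a \<Rightarrow> 'a option" where
  "restrict_op X g b = (case g b of None \<Rightarrow> None | Some c \<Rightarrow> if c \<in> X then Some c else None)"

definition crystal_iso ::
  "nat \<Rightarrow> factorization set \<Rightarrow> factorization set \<Rightarrow> (factorization \<Rightarrow> factorization) \<Rightarrow> bool" where
  "crystal_iso n X Y \<phi> \<longleftrightarrow>
     bij_betw \<phi> X Y \<and>
     (\<forall>b \<in> X. weight (\<phi> b) = weight b \<and>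
        (\<forall>j \<in> crystal_indices n.
           restrict_op Y (crystal_e n j) (\<phi> b) = map_option \<phi> (restrict_op X (crystal_e n j) b) \<and>
           restrict_op Y (crystal_f n j) (\<phi> b) = map_option \<phi> (restrict_op X (crystal_f n j) b)))"

definition crystal_isomorphic :: "nat \<Rightarrow> factorization set \<Rightarrow> factorization set \<Rightarrow> bool" where
  "crystal_isomorphic n X Y \<longleftrightarrow> (\<exists>\<phi>. crystal_iso n X Y \<phi>)"

definition bounded_fact :: "factorization \<Rightarrow> bool" where
  "bounded_fact a \<longleftrightarrow> (\<forall>i \<in> {1..length a}. \<forall>m \<in> set (a ! (i - 1)). int i \<le> base m)"

definition BRF_O :: "nat \<Rightarrow> (int \<Rightarrow> int) \<Rightarrow> factorization set" where
  "BRF_O n z = {a \<in> RF_O n z. bounded_fact a}"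


subsection \<open>One-row tableaux\<close>

abbreviation Unp :: "int \<Rightarrow> letter" where "Unp m \<equiv> Letter m False"
abbreviation Prm :: "int \<Rightarrow> letter" where "Prm m \<equiv> Letter m True"

inductive ck_move :: "letter list \<Rightarrow> letter list \<Rightarrow> bool" where
  ACB: "\<lbrakk>base A < base B; base B < base C\<rbrakk> \<Longrightarrow> ck_move (xs @ [A, C, B] @ ys) (xs @ [C, A, B] @ ys)"
| BCA: "\<lbrakk>base A < base B; base B < base C\<rbrakk> \<Longrightarrow> ck_move (xs @ [B, C, A] @ ys) (xs @ [B, A, C] @ ys)"
| braid1: "\<bar>a - b\<bar> = 1 \<Longrightarrow> ck_move (xs @ [Unp a, Unp b, Unp a] @ ys) (xs @ [Unp b, Unp a, Unp b] @ ys)"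
| braid2: "\<bar>a - b\<bar> = 1 \<Longrightarrow> ck_move (xs @ [Prm a, Prm b, Prm a] @ ys) (xs @ [Prm b, Prm a, Prm b] @ ys)"
| braid3: "\<bar>a - b\<bar> = 1 \<Longrightarrow> ck_move (xs @ [Prm a, Unp b, Unp a] @ ys) (xs @ [Unp b, Unp a, Prm b] @ ys)"
| braid4: "\<bar>a - b\<bar> = 1 \<Longrightarrow> ck_move (xs @ [Unp a, Prm b, Unp a] @ ys) (xs @ [Unp b, Prm a, Unp b] @ ys)"
| braid5: "\<bar>a - b\<bar> = 1 \<Longrightarrow> ck_move (xs @ [Prm a, Prm b, Unp a] @ ys) (xs @ [Unp b, Prm a, Prm b] @ ys)"
| braid6: "\<bar>a - b\<bar> = 1 \<Longrightarrow> ck_move (xs @ [Prm a, Unp b, Prm a] @ ys) (xs @ [Prm b, Unp a, Prm b] @ ys)"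
| start1: "ck_move (Unp a # ys) (Prm a # ys)"
| start2: "ck_move (Unp a # Unp b # ys) (Unp b # Unp a # ys)"
| start3: "ck_move (Unp a # Prm b # ys) (Unp b # Prm a # ys)"
| start4: "ck_move (Prm a # Unp b # ys) (Prm b # Unp a # ys)"
| start5: "ck_move (Prm a # Prm b # ys) (Prm b # Prm a # ys)"

definition ck_equiv :: "letter list \<Rightarrow> letter list \<Rightarrow> bool" where
  "ck_equiv = equivclp ck_move"

definition one_row_tableau :: "(int \<Rightarrow> int) \<Rightarrow> letter list \<Rightarrow> bool" where
  "one_row_tableau z T \<longleftrightarrow>
     T \<noteq> [] \<and> \<not> primed (hd T) \<and> (sorted_wrt (<) T \<or> sorted_wrt (>) T) \<and> T \<in> R_O z"

definition RF_O_tab :: "nat \<Rightarrow> (int \<Rightarrow> int) \<Rightarrow> letter list \<Rightarrow> factorization set" where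
  "RF_O_tab n z T = {a \<in> RF_O n z. ck_equiv (concat a) T}"

definition BRF_O_tab :: "nat \<Rightarrow> (int \<Rightarrow> int) \<Rightarrow> letter list \<Rightarrow> factorization set" where
  "BRF_O_tab n z T = RF_O_tab n z T \<inter> BRF_O n z"


subsection \<open>Symmetric weak compositions\<close>

text \<open>A weak composition is a finitely supported function on the positive integers, extended by
  0 to all integers so that permutations of the integers act on positions.\<close>

type_synonym weak_comp = "int \<Rightarrow> nat"

definition unit_comp :: "int \<Rightarrow> weak_comp" where
  "unit_comp j p = (if p = j then 1 else 0)"

text \<open>The left action with \<open>(u \<alpha>)\<^bsub>u(i)\<^esub> = \<alpha>\<^sub>i\<close>, so that \<open>simple i\<close> exchanges the entries in
  positions \<open>i\<close> and \<open>i + 1\<close>.\<close>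

definition act :: "(int \<Rightarrow> int) \<Rightarrow> weak_comp \<Rightarrow> weak_comp" where
  "act u \<alpha> = \<alpha> \<circ> inv u"

definition sorted_partition :: "weak_comp \<Rightarrow> weak_comp" where
  "sorted_partition \<alpha> i =
     (let ps = rev (sorted_list_of_multiset (image_mset \<alpha> (mset_set {j. \<alpha> j \<noteq> 0}))) in
      if 1 \<le> i \<and> i \<le> int (length ps) then ps ! nat (i - 1) else 0)"

definition comp_perm :: "weak_comp \<Rightarrow> int \<Rightarrow> int" where
  "comp_perm \<alpha> =
     (THE u. u \<in> S_inf \<and> \<alpha> = act u (sorted_partition \<alpha>) \<and>
        (\<forall>v \<in> S_inf. \<alpha> = act v (sorted_partition \<alpha>) \<longrightarrow> perm_length u \<le> perm_length v))"

definition rothe :: "(int \<Rightarrow> int) \<Rightarrow> (int \<times> int) set" where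
  "rothe w = {(i, w j) | i j. i < j \<and> w i > w j}"

definition dominant_perm :: "weak_comp \<Rightarrow> int \<Rightarrow> int" where
  "dominant_perm p =
     (THE w. w \<in> S_inf \<and> rothe w = {(i, j). 1 \<le> i \<and> 1 \<le> j \<and> j \<le> int (p i)})"

definition demazure_op ::
  "factorization set \<Rightarrow> nat \<Rightarrow> factorization set \<Rightarrow> factorization set" where
  "demazure_op B i X = {b \<in> B. \<exists>k. \<exists>c \<in> X. iterate_op (e_op i) k b = Some c}"

text \<open>The set attached to \<open>\<alpha>\<close>, computed from the word \<open>is\<close>. It is meant for symmetric \<open>\<alpha>\<close> and
  reduced words \<open>is\<close> of \<open>comp_perm \<alpha>\<close>, all of which give the same set.\<close>

definition BRF_O_comp :: "nat \<Rightarrow> weak_comp \<Rightarrow> int list \<Rightarrow> factorization set" where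
  "BRF_O_comp n \<alpha> is =
     foldr (\<lambda>i. demazure_op (RF_O n (dominant_perm (sorted_partition \<alpha>))) (nat i)) is
       (BRF_O n (dominant_perm (sorted_partition \<alpha>)))"

definition alpha_O :: "letter list \<Rightarrow> weak_comp" where
  "alpha_O T =
     (let is = sort (map base T) in
      (\<lambda>p. length T * unit_comp (hd is) p + (\<Sum>i\<leftarrow>tl is. unit_comp i p)))"

end

(* A word of the class of a one-row tableau starts with some letter and then extends the set of
   letters already written, which is always an interval of the letters sorted by size, upwards or
   downwards; the first letter is primed at will, and the prime of every later letter is dictated by
   the gap that is crossed. Cut into decreasing factors, such a word is given by two numbers per
   factor: whether it steps up (at most once, at its start), and how often it steps down. In these
   coordinates the crystal operators do not depend on the tableau. The dominant permutation of the
   hook (k, 1, ..., 1) is the transposition (1 k+1), whose factorizations are those of the tableau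
   with letters 1, ..., k. So both crystals have the same coordinates before restriction. Boundedness
   is a condition on the coordinates that involves only the set A of letters, and the i-th Demazure
   operator turns the condition for A into the one for A with i replaced by i + 1. A reduced word of
   the permutation u of the composition makes exactly such replacements, as each letter raises the
   sum of the set by at most one and their number is the difference of the sums. *)

theory Submission
  imports Defs
begin

text \<open>The obstacle is that \<open>R_O\<close> speaks of atoms of minimal length, of a Demazure
  product along an unspecified reduced word, and of marks transported by the rest of the word. The
  letters of a one-row tableau are distinct, and then all of this can be read from half-lines: a
  letter \<open>c\<close> that occurs once makes some point cross \<open>{..c}\<close>, while the
  other letters preserve \<open>{..c}\<close>. So every word of the same permutation contains
  \<open>c\<close>, lengths become numbers of letters, and a prime is admissible iff neither
  neighbouring value was written before. This is why primes of later letters need gaps of at least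
  2. The first letter crosses no gap. Reading its prime as the direction of its step makes the words
  with k letters correspond to all 2^k sequences of directions; an operator that changes this prime
  only changes a direction and shifts the starting point. Conjugation by \<open>sigma i\<close> may
  leave a bounded set, so operators are compared on all factorizations of a class, and restriction
  comes last. The condition on the descents of \<open>z\<close> makes the letters at most n, so that
  only Demazure operators with index below n occur.\<close>

section \<open>Adjacent transpositions and products of words\<close>

lemma simple_apply: "simple i p = (if p = i then i + 1 else if p = i + 1 then i else p)"
  by (simp add: simple_def transpose_def)

lemma simple_invol [simp]: "simple i (simple i p) = p"
  by (simp add: simple_apply)

lemma simple_comp_simple [simp]: "simple i \<circ> simple i = id"
  by (simp add: fun_eq_iff)

lemma bij_simple: "bij (simple i)"
  by (simp add: simple_def)

lemma inj_simple: "inj (simple i)"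
  using bij_simple bij_is_inj by blast

lemma permutation_simple: "permutation (simple i)"
  unfolding simple_def by (rule permutation_swap_id)

lemma word_perm_Nil [simp]: "word_perm [] = id"
  by (simp add: word_perm_def)

lemma word_perm_Cons [simp]: "word_perm (i # xs) = simple i \<circ> word_perm xs"
  by (simp add: word_perm_def)

lemma word_perm_append [simp]: "word_perm (xs @ ys) = word_perm xs \<circ> word_perm ys"
  by (induction xs) (auto simp: o_assoc)

lemma permutation_word_perm: "permutation (word_perm xs)"
proof (induction xs)
  case Nil
  show ?case unfolding word_perm_Nil by (rule permutation_id)
next
  case (Cons i xs)
  show ?case unfolding word_perm_Cons by (rule permutation_compose[OF permutation_simple Cons.IH])
qed

lemma bij_word_perm: "bij (word_perm xs)"
  using permutation_word_perm permutation_bijective by blast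

lemma word_perm_rev_comp: "word_perm (rev xs) \<circ> word_perm xs = id"
  by (induction xs) (auto simp: fun_eq_iff)

lemma inv_word_perm: "inv (word_perm xs) = word_perm (rev xs)"
  by (rule inv_unique_comp) (use word_perm_rev_comp[of xs] word_perm_rev_comp[of "rev xs"] in auto)

lemma perm_eq_iff: "permutation w \<Longrightarrow> w p = w q \<longleftrightarrow> p = q"
  by (meson bij_is_inj inj_eq permutation_bijective)


subsection \<open>Length and inversions\<close>

definition inversions :: "(int \<Rightarrow> int) \<Rightarrow> (int \<times> int) set" where
  "inversions w = {(p, q). p < q \<and> w q < w p}"

lemma inversions_id [simp]: "inversions id = {}"
  by (auto simp: inversions_def)

text \<open>Some interval \<open>{a..b}\<close> contains all moved points and is mapped to itself; a
  pair with an entry outside it cannot be inverted.\<close>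

lemma finite_inversions:
  assumes "permutation w"
  shows "finite (inversions w)"
proof -
  have fin: "finite {p. w p \<noteq> p}" and bij: "bij w"
    using assms by (auto simp: permutation)
  have "{p. w p \<noteq> p} \<subseteq> {Min {p. w p \<noteq> p}..Max {p. w p \<noteq> p}}"
    using fin by (auto intro: Min_le Max_ge)
  then obtain a b where ab: "{p. w p \<noteq> p} \<subseteq> {a..b}" by blast
  have fixed: "w p = p" if "p \<notin> {a..b}" for p using ab that by blast
  have stay: "w p \<in> {a..b} \<longleftrightarrow> p \<in> {a..b}" for p
    using fixed bij by (metis bij_pointE)
  have "inversions w \<subseteq> {a..b} \<times> {a..b}"
  proof (clarify)
    fix p q assume pq: "(p, q) \<in> inversions w"
    then have "p < q" "w q < w p" by (auto simp: inversions_def)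
    then show "p \<in> {a..b} \<and> q \<in> {a..b}"
      using fixed[of p] fixed[of q] stay[of p] stay[of q] by (smt (verit) atLeastAtMost_iff)
  qed
  then show ?thesis by (meson finite_SigmaI finite_atLeastAtMost_int finite_subset)
qed

text \<open>\<open>simple i\<close> keeps the order of every pair except \<open>(i, i + 1)\<close>.
  Applying it to both entries therefore matches the inversions of \<open>w\<close> with those of
  \<open>w \<circ> simple i\<close> other than \<open>(i, i + 1)\<close>, which is new.\<close>

lemma card_inversions_up:
  assumes "permutation w" "w i < w (i + 1)"
  shows "card (inversions (w \<circ> simple i)) = card (inversions w) + 1"
proof -
  let ?s = "map_prod (simple i) (simple i)"
  have "inversions (w \<circ> simple i) = insert (i, i + 1) (?s ` inversions w)"
  proof (intro set_eqI iffI)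
    fix x assume x: "x \<in> inversions (w \<circ> simple i)"
    obtain p q where pq: "x = (p, q)" "p < q" "w (simple i q) < w (simple i p)"
      using x by (auto simp: inversions_def)
    show "x \<in> insert (i, i + 1) (?s ` inversions w)"
    proof (cases "p = i \<and> q = i + 1")
      case False
      then have "simple i p < simple i q" using pq(2) by (auto simp: simple_apply)
      then have "(simple i p, simple i q) \<in> inversions w" using pq by (simp add: inversions_def)
      then have "?s (simple i p, simple i q) \<in> ?s ` inversions w" by blast
      then show ?thesis using pq by simp
    qed (use pq in auto)
  next
    fix x assume "x \<in> insert (i, i + 1) (?s ` inversions w)"
    then show "x \<in> inversions (w \<circ> simple i)"
    proof
      assume "x \<in> ?s ` inversions w"
      then obtain p q where pq: "x = (simple i p, simple i q)" "p < q" "w q < w p"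
        by (auto simp: inversions_def)
      then have "\<not> (p = i \<and> q = i + 1)" using assms by auto
      then have "simple i p < simple i q" using pq by (auto simp: simple_apply)
      then show ?thesis using pq by (simp add: inversions_def)
    qed (use assms in \<open>auto simp: inversions_def simple_apply\<close>)
  qed
  moreover have "(i, i + 1) \<notin> ?s ` inversions w"
    using assms by (auto simp: inversions_def simple_apply split: if_splits)
  moreover have "inj ?s" by (intro prod.inj_map inj_simple)
  ultimately show ?thesis
    using finite_inversions[OF assms(1)] by (simp add: card_image inj_on_subset)
qed

lemma card_inversions_down:
  assumes "permutation w" "w (i + 1) < w i"
  shows "card (inversions w) = card (inversions (w \<circ> simple i)) + 1"
proof -
  have "permutation (w \<circ> simple i)" using assms permutation_compose permutation_simple by blast
  from card_inversions_up[OF this, of i] show ?thesis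
    using assms(2) by (simp add: simple_apply comp_assoc)
qed

lemma perm_neq:
  assumes "permutation w" shows "w i < w (i + 1) \<or> w (i + 1) < (w i :: int)"
  using perm_eq_iff[OF assms, of i "i + 1"] by linarith

lemma card_inversions_word_perm: "card (inversions (word_perm xs)) \<le> length xs"
proof (induction xs rule: rev_induct)
  case Nil
  show ?case unfolding word_perm_Nil inversions_id by simp
next
  case (snoc i xs)
  then show ?case
    using card_inversions_up[OF permutation_word_perm, of xs i]
      card_inversions_down[OF permutation_word_perm[of xs], of i]
      perm_neq[OF permutation_word_perm, of xs i]
    by (auto simp: comp_def)
qed

lemma strict_mono_int:
  fixes f :: "int \<Rightarrow> int"
  assumes "\<And>i. f i < f (i + 1)"
  shows "strict_mono f"
proof (rule strict_monoI)
  fix p q :: int assume "p < q"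
  then show "f p < f q"
    by (induction q rule: int_gr_induct) (use assms order_less_trans in blast)+
qed

text \<open>Otherwise there is a largest moved point. Its image cannot lie above it, since points
  there are fixed; if the image lies below, monotonicity puts the preimage above, among the fixed
  points again.\<close>

lemma no_descent_imp_id:
  fixes w :: "int \<Rightarrow> int"
  assumes "permutation w" "\<And>i. w i < w (i + 1)"
  shows "w = id"
proof (rule ccontr)
  assume "w \<noteq> id"
  have mono: "w p < w q" if "p < q" for p q
    by (rule strict_monoD[OF strict_mono_int that]) (rule assms(2))
  have fin: "finite {p. w p \<noteq> p}" using assms by (auto simp: permutation)
  have ne: "{p. w p \<noteq> p} \<noteq> {}" using \<open>w \<noteq> id\<close> by (auto simp: fun_eq_iff)
  define m where "m = Max {p. w p \<noteq> p}"
  have m: "w m \<noteq> m" "\<And>p. p > m \<Longrightarrow> w p = p"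
    using Max_in[OF fin ne] Max_ge[OF fin] unfolding m_def by (auto simp: not_le[symmetric])
  obtain q where q: "w q = m" using assms(1) by (metis bij_pointE permutation_bijective)
  show False
  proof (cases "w m < m")
    case True
    then have "m < q" using mono[of q m] q m(1) by (metis linorder_neqE not_less_iff_gr_or_eq)
    then show False using m q by force
  next
    case False
    then have "w m > m" using m by simp
    then have "w (w m) = w m" using m by simp
    then show False using m assms(1) by (metis bij_pointE permutation_bijective)
  qed
qed

text \<open>Cancelling a descent removes one inversion, so repeating this reaches the identity after
  as many letters as there are inversions. A permutation that fixes all \<open>p \<le> 0\<close> has
  only positive descents, because it maps 1 to a positive number; this keeps the letters
  positive.\<close>

lemma word_exists:
  assumes "permutation w"
  shows "\<exists>xs. word_perm xs = w \<and> length xs = card (inversions w) \<and>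
    ((\<forall>p\<le>0. w p = p) \<longrightarrow> set xs \<subseteq> {1..})"
  using assms
proof (induction "card (inversions w)" arbitrary: w rule: less_induct)
  case less
  show ?case
  proof (cases "w = id")
    case True
    then show ?thesis by (intro exI[of _ "[]"]) simp
  next
    case False
    then obtain i where "\<not> w i < w (i + 1)" using no_descent_imp_id less.prems by blast
    then have i: "w (i + 1) < w i" using perm_neq less.prems by blast
    have p: "permutation (w \<circ> simple i)"
      using less.prems permutation_compose permutation_simple by blast
    obtain xs where xs: "word_perm xs = w \<circ> simple i"
      "length xs = card (inversions (w \<circ> simple i))"
      "(\<forall>p\<le>0. (w \<circ> simple i) p = p) \<Longrightarrow> set xs \<subseteq> {1..}"
      using less.hyps[OF _ p] card_inversions_down[OF less.prems i] by auto
    have "set (xs @ [i]) \<subseteq> {1..}" if fixed: "\<forall>p\<le>0. w p = p"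
    proof -
      have "i \<ge> 1"
      proof (rule ccontr)
        assume "\<not> i \<ge> 1"
        moreover have "w 1 \<ge> 1"
        proof (rule ccontr)
          assume "\<not> w 1 \<ge> 1"
          then have "w (w 1) = w 1" using fixed by simp
          then show False using perm_eq_iff[OF less.prems] \<open>\<not> w 1 \<ge> 1\<close> by simp
        qed
        ultimately show False using i fixed by (cases "i = 0") auto
      qed
      then show ?thesis using xs(3) fixed by (auto simp: simple_apply)
    qed
    then show ?thesis
      using xs card_inversions_down[OF less.prems i]
      by (intro exI[of _ "xs @ [i]"]) (simp add: comp_assoc)
  qed
qed

lemma perm_length_eq:
  assumes "permutation w" shows "perm_length w = card (inversions w)"
  unfolding perm_length_def
proof (rule Least_equality)
  show "\<exists>xs. word_perm xs = w \<and> length xs = card (inversions w)"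
    using word_exists[OF assms] by blast
qed (use card_inversions_word_perm in blast)

lemma perm_length_le: "perm_length (word_perm xs) \<le> length xs"
  unfolding perm_length_def by (rule Least_le) blast

lemma reduced_words_nonempty:
  assumes "permutation w" shows "reduced_words w \<noteq> {}"
  using word_exists[OF assms] perm_length_eq[OF assms] by (auto simp: reduced_words_def)

lemma demazure_step_eq:
  assumes "permutation v"
  shows "demazure_step v i = (if v i < v (i + 1) then v \<circ> simple i else v)"
proof -
  have "permutation (v \<circ> simple i)" using assms permutation_compose permutation_simple by blast
  from perm_length_eq[OF this] perm_length_eq[OF assms] show ?thesis
    using card_inversions_up[OF assms, of i] card_inversions_down[OF assms, of i]
      perm_neq[OF assms, of i]
    by (cases "v i < v (i + 1)") (simp_all add: demazure_step_def)
qed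

lemma S_inf_iff: "w \<in> S_inf \<longleftrightarrow> permutation w \<and> (\<forall>p\<le>0. w p = p)"
proof
  assume "w \<in> S_inf"
  then obtain xs where xs: "w = word_perm xs" "set xs \<subseteq> {1..}" by (auto simp: S_inf_def)
  have "\<forall>p\<le>0. word_perm xs p = p"
    using xs(2) by (induction xs) (auto simp: simple_apply)
  then show "permutation w \<and> (\<forall>p\<le>0. w p = p)" using xs permutation_word_perm by simp
next
  assume w: "permutation w \<and> (\<forall>p\<le>0. w p = p)"
  then obtain xs where "word_perm xs = w" "set xs \<subseteq> {1..}" using word_exists by blast
  then show "w \<in> S_inf" by (auto simp: S_inf_def)
qed


subsection \<open>Words with distinct letters\<close>

text \<open>This holds for products of \<open>simple i\<close> with \<open>i \<in> F\<close>. Conversely, the half-lines \<open>{..c}\<close> that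
  a permutation does not preserve show which letters every word for it must contain.\<close>

definition supported :: "(int \<Rightarrow> int) \<Rightarrow> int set \<Rightarrow> bool" where
  "supported f F \<longleftrightarrow> (\<forall>c. c \<notin> F \<longrightarrow> (\<forall>p. f p \<le> c \<longleftrightarrow> p \<le> c))"

lemma supportedD: "supported f F \<Longrightarrow> c \<notin> F \<Longrightarrow> f p \<le> c \<longleftrightarrow> p \<le> c"
  by (simp add: supported_def)

lemma supported_id: "supported id F"
  by (simp add: supported_def)

lemma supported_simple: "i \<in> F \<Longrightarrow> supported (simple i) F"
  by (auto simp: supported_def simple_apply) (metis order_antisym_conv zle_add1_eq_le not_le)+

lemma supported_comp: "supported f F \<Longrightarrow> supported g F \<Longrightarrow> supported (f \<circ> g) F"
  by (simp add: supported_def)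

lemma supported_mono: "supported f F \<Longrightarrow> F \<subseteq> G \<Longrightarrow> supported f G"
  by (auto simp: supported_def)

lemma supported_word_perm: "set xs \<subseteq> F \<Longrightarrow> supported (word_perm xs) F"
proof (induction xs)
  case Nil
  show ?case unfolding word_perm_Nil by (rule supported_id)
next
  case (Cons i xs)
  then show ?case unfolding word_perm_Cons by (intro supported_comp supported_simple) auto
qed

text \<open>This decides every single step of a Demazure product over distinct letters. If
  \<open>g x < x\<close>, then \<open>g\<close> moves each half-line \<open>{..c}\<close> with
  \<open>g x \<le> c < x\<close>, so these \<open>c\<close> lie in \<open>G\<close>, hence not in
  \<open>F\<close>, and \<open>f\<close> preserves the half-lines; therefore
  \<open>f (g x) \<le> g x < x \<le> f x\<close>. The case of \<open>g (x + 1) > x + 1\<close> is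
  the mirror image.\<close>

lemma supported_descent:
  assumes f: "supported f F" and g: "supported g G" and disj: "F \<inter> G = {}"
    and x: "x \<notin> F" "x \<notin> G"
  shows "f (simple x (g x)) < f (simple x (g (x + 1))) \<longleftrightarrow> \<not> (g x = x \<and> g (x + 1) = x + 1)"
proof -
  have gx: "g x \<le> x" "g (x + 1) \<ge> x + 1"
    using supportedD[OF g x(2), of x] supportedD[OF g x(2), of "x + 1"] by auto
  have fx: "f p \<le> x \<longleftrightarrow> p \<le> x" for p using supportedD[OF f x(1)] .
  consider "g x = x" "g (x + 1) = x + 1" | "g x < x" "g (x + 1) = x + 1"
    | "g x = x" "g (x + 1) > x + 1" | "g x < x" "g (x + 1) > x + 1"
    using gx by linarith
  then show ?thesis
  proof cases
    case 1
    then show ?thesis using fx[of x] fx[of "x + 1"] by (simp add: simple_apply)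
  next
    case 2
    have inG: "c \<in> G" if "g x \<le> c" "c < x" for c
      using supportedD[OF g, of c x] that by force
    have "f (g x) \<le> g x" using supportedD[OF f, of "g x" "g x"] inG[of "g x"] 2 disj by auto
    moreover have "\<not> f x \<le> x - 1" using supportedD[OF f, of "x - 1" x] inG[of "x - 1"] 2 disj by auto
    ultimately show ?thesis using 2 by (simp add: simple_apply)
  next
    case 3
    have inG: "c \<in> G" if "x + 1 \<le> c" "c < g (x + 1)" for c
      using supportedD[OF g, of c "x + 1"] that by force
    have "f (x + 1) \<le> x + 1" using supportedD[OF f, of "x + 1" "x + 1"] inG[of "x + 1"] 3 disj by auto
    moreover have "\<not> f (g (x + 1)) \<le> g (x + 1) - 1"
      using supportedD[OF f, of "g (x + 1) - 1" "g (x + 1)"] inG[of "g (x + 1) - 1"] 3 disj by auto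
    ultimately show ?thesis using 3 by (simp add: simple_apply)
  next
    case 4
    then show ?thesis using fx[of "g x"] fx[of "g (x + 1)"] by (simp add: simple_apply)
  qed
qed

text \<open>The half-line at \<open>x\<close> is preserved, and the half-lines at
  \<open>x - 1\<close> and \<open>x + 1\<close> differ from it by one fixed point each.\<close>

lemma supported_neighbours:
  assumes "inj f" "supported f F" "x \<notin> F" "f x = x" "f (x + 1) = x + 1"
  shows "supported f (F - {x - 1, x + 1})"
  unfolding supported_def
proof (intro allI impI)
  fix c p assume c: "c \<notin> F - {x - 1, x + 1}"
  have fx: "f p \<le> x \<longleftrightarrow> p \<le> x" using supportedD[OF assms(2,3)] .
  have ne: "f p = x \<longleftrightarrow> p = x" "f p = x + 1 \<longleftrightarrow> p = x + 1" using assms by (metis injD)+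
  consider "c \<notin> F" | "c = x - 1" | "c = x + 1" using c by blast
  then show "f p \<le> c \<longleftrightarrow> p \<le> c"
  proof cases
    case 1
    then show ?thesis using supportedD[OF assms(2)] by blast
  qed (use fx ne in linarith)+
qed

text \<open>Write the word as \<open>A @ c # B\<close>. The point that \<open>B\<close> brings to
  \<open>c\<close> starts in \<open>{..c}\<close>, the letter \<open>c\<close> sends it to
  \<open>c + 1\<close>, and \<open>A\<close> cannot bring it back, since \<open>c\<close> does not
  occur in \<open>A\<close>.\<close>

lemma supported_distinct_word_perm:
  assumes "distinct xs" "supported (word_perm xs) F"
  shows "set xs \<subseteq> F"
proof
  fix c assume "c \<in> set xs"
  then obtain A B where xs: "xs = A @ c # B" by (meson split_list)
  show "c \<in> F"
  proof (rule ccontr)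
    assume c: "c \<notin> F"
    define p where "p = word_perm (rev B) c"
    have A: "word_perm A q \<le> c \<longleftrightarrow> q \<le> c" for q
      by (rule supportedD[OF supported_word_perm[of A "set A"]]) (use assms xs in auto)
    have B: "word_perm (rev B) q \<le> c \<longleftrightarrow> q \<le> c" for q
      by (rule supportedD[OF supported_word_perm[of _ "set B"]]) (use assms xs in auto)
    have "word_perm B p = c"
      using word_perm_rev_comp[of "rev B"] by (simp add: p_def fun_eq_iff)
    then have "word_perm xs p = word_perm A (c + 1)" by (simp add: xs simple_apply)
    moreover have "word_perm xs p \<le> c \<longleftrightarrow> p \<le> c" using supportedD[OF assms(2) c] .
    ultimately show False using A[of "c + 1"] B[of c] p_def by simp
  qed
qed

lemma word_perm_eq_set_subset:
  assumes "distinct xs" "word_perm xs = word_perm ys"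
  shows "set xs \<subseteq> set ys"
  using assms supported_distinct_word_perm[of xs "set ys"] supported_word_perm[of ys "set ys"] by simp

text \<open>Every word of the same permutation must contain all the letters of
  \<open>xs\<close>.\<close>

lemma perm_length_distinct:
  assumes "distinct xs"
  shows "perm_length (word_perm xs) = length xs"
  unfolding perm_length_def
proof (rule Least_equality)
  fix l assume "\<exists>ys. word_perm ys = word_perm xs \<and> length ys = l"
  then obtain ys where ys: "word_perm ys = word_perm xs" "length ys = l" by blast
  then have "card (set xs) \<le> card (set ys)"
    using word_perm_eq_set_subset[OF assms, of ys] by (simp add: card_mono)
  then show "length xs \<le> l"
    using ys card_length[of ys] distinct_card[OF assms] by simp
qed blast

lemma reduced_words_distinct:
  assumes "distinct xs" "ys \<in> reduced_words (word_perm xs)"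
  shows "distinct ys" "set ys = set xs" "word_perm ys = word_perm xs" "length ys = length xs"
proof -
  show wp: "word_perm ys = word_perm xs" and len: "length ys = length xs"
    using assms perm_length_distinct[OF assms(1)] by (auto simp: reduced_words_def)
  have sub: "set xs \<subseteq> set ys" using word_perm_eq_set_subset[OF assms(1)] wp by simp
  have "card (set ys) \<le> card (set xs)"
    using len card_length[of ys] distinct_card[OF assms(1)] by simp
  then show set_eq: "set ys = set xs" using sub by (metis List.finite_set card_seteq)
  show "distinct ys" using len set_eq distinct_card[OF assms(1)] card_distinct[of ys] by simp
qed


subsection \<open>Involution words with distinct letters\<close>

text \<open>Demazure conjugation of an involution \<open>z\<close> by \<open>simple i\<close> at an
  ascent \<open>i\<close>. If \<open>simple i\<close> commutes with \<open>z\<close>, then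
  conjugation changes nothing and only one factor survives; at an ascent this happens exactly when
  both points are fixed. A letter that has not been used before is always an ascent.\<close>

definition inv_step :: "(int \<Rightarrow> int) \<Rightarrow> int \<Rightarrow> int \<Rightarrow> int" where
  "inv_step z i =
     (if z i = i \<and> z (i + 1) = i + 1 then simple i \<circ> z else simple i \<circ> z \<circ> simple i)"

text \<open>The involution \<open>w\<inverse> \<circ> w\<close> (Demazure product) for
  \<open>w = word_perm xs\<close>, when the letters are distinct: the first letter is innermost and
  later ones are wrapped around it.\<close>

definition inv_word :: "int list \<Rightarrow> int \<Rightarrow> int" where
  "inv_word xs = foldl inv_step id xs"

lemma inv_word_Nil: "inv_word [] = id"
  by (simp add: inv_word_def)

lemma inv_word_snoc: "inv_word (xs @ [i]) = inv_step (inv_word xs) i"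
  by (simp add: inv_word_def)

lemma supported_inv_word: "set xs \<subseteq> F \<Longrightarrow> supported (inv_word xs) F"
proof (induction xs rule: rev_induct)
  case Nil
  show ?case unfolding inv_word_Nil by (rule supported_id)
next
  case (snoc i xs)
  then have "supported (inv_word xs) F" "supported (simple i) F"
    by (auto intro: supported_simple)
  then show ?case unfolding inv_word_snoc inv_step_def by (auto intro!: supported_comp)
qed

lemma permutation_inv_word: "permutation (inv_word xs)"
proof (induction xs rule: rev_induct)
  case Nil
  show ?case unfolding inv_word_Nil by (rule permutation_id)
next
  case (snoc i xs)
  then show ?case unfolding inv_word_snoc inv_step_def
    using permutation_compose permutation_simple by auto
qed

lemma inv_step_invol:
  assumes "z \<circ> z = id" shows "inv_step z i \<circ> inv_step z i = id"
proof -
  have z: "z (z p) = p" for p using assms by (simp add: fun_eq_iff)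
  have "simple i (z p) = z (simple i p)" if "z i = i" "z (i + 1) = i + 1" for p
    using that z by (auto simp: simple_apply) (metis z)+
  then show ?thesis using z by (auto simp: inv_step_def fun_eq_iff)
qed

lemma inv_word_invol: "inv_word xs \<circ> inv_word xs = id"
proof (induction xs rule: rev_induct)
  case Nil
  show ?case unfolding inv_word_Nil by simp
next
  case (snoc i xs)
  then show ?case unfolding inv_word_snoc by (rule inv_step_invol)
qed

text \<open>The invariant of the product of the inverse with the word: after \<open>xs\<close> has
  been read, the value is the inverse of the unread part times the involution of the read part.
  Reading \<open>i\<close> either conjugates or does nothing, and in the second case the factor
  \<open>simple i\<close> already present in the inverse is the one that \<open>inv_step\<close>
  multiplies.\<close>

lemma foldl_demazure_step_distinct:
  assumes "distinct (xs @ ys)"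
  shows "foldl demazure_step (word_perm (rev ys) \<circ> inv_word xs) ys = inv_word (xs @ ys)"
  using assms
proof (induction ys arbitrary: xs)
  case Nil
  then show ?case by (simp add: fun_eq_iff)
next
  case (Cons i ys)
  let ?f = "word_perm (rev ys)" and ?z = "inv_word xs"
  have v: "word_perm (rev (i # ys)) \<circ> ?z = ?f \<circ> simple i \<circ> ?z" by (simp add: fun_eq_iff)
  have perm: "permutation (?f \<circ> simple i \<circ> ?z)"
    using permutation_compose permutation_simple permutation_word_perm permutation_inv_word by blast
  have "supported ?f (set ys)" "supported ?z (set xs)"
    by (auto intro: supported_word_perm supported_inv_word)
  from supported_descent[OF this, of i]
  have "?f (simple i (?z i)) < ?f (simple i (?z (i + 1))) \<longleftrightarrow> \<not> (?z i = i \<and> ?z (i + 1) = i + 1)"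
    using Cons.prems by auto
  then have "demazure_step (?f \<circ> simple i \<circ> ?z) i = ?f \<circ> inv_word (xs @ [i])"
    using demazure_step_eq[OF perm, of i] unfolding inv_word_snoc inv_step_def
    by (auto simp: comp_assoc)
  then show ?case using Cons.IH[of "xs @ [i]"] Cons.prems v
    by (simp add: comp_def)
qed

lemma foldl_demazure_step_supported:
  assumes "supported v F" "set ys \<subseteq> F"
  shows "supported (foldl demazure_step v ys) F"
  using assms
proof (induction ys arbitrary: v)
  case (Cons i ys)
  then have "supported (demazure_step v i) F"
    unfolding demazure_step_def by (auto intro: supported_comp supported_simple)
  with Cons show ?case by simp
qed simp

lemma simple_commute:
  assumes "\<bar>x - y\<bar> \<ge> 2" shows "simple x (simple y p) = simple y (simple x p)"
  using assms by (auto simp: simple_apply)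

lemma inv_step_commute:
  assumes "\<bar>x - y\<bar> \<ge> 2"
  shows "inv_step (inv_step z x) y = inv_step (inv_step z y) x"
proof -
  have fixed: "simple x y = y" "simple x (y + 1) = y + 1" "simple y x = x" "simple y (x + 1) = x + 1"
    using assms by (auto simp: simple_apply)
  have eq: "simple x q = y \<longleftrightarrow> q = y" "simple x q = y + 1 \<longleftrightarrow> q = y + 1"
    "simple y q = x \<longleftrightarrow> q = x" "simple y q = x + 1 \<longleftrightarrow> q = x + 1" for q
    using assms by (auto simp: simple_apply)
  show ?thesis
    using simple_commute[OF assms] by (auto simp: inv_step_def fun_eq_iff fixed eq)
qed

lemma foldl_inv_step_commute:
  assumes "\<And>y. y \<in> set ys \<Longrightarrow> \<bar>x - y\<bar> \<ge> 2"
  shows "foldl inv_step (inv_step z x) ys = inv_step (foldl inv_step z ys) x"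
  using assms
proof (induction ys arbitrary: z)
  case (Cons y ys)
  then show ?case using inv_step_commute[of x y z] by simp
qed simp

lemma word_perm_commute:
  assumes "\<And>y. y \<in> set ys \<Longrightarrow> \<bar>x - y\<bar> \<ge> 2"
  shows "simple x \<circ> word_perm ys = word_perm ys \<circ> simple x"
  using assms
proof (induction ys)
  case (Cons y ys)
  then show ?case using simple_commute[of x y] by (simp add: fun_eq_iff)
qed simp

text \<open>Only commutations separate two such words. The last letter \<open>x\<close> of one of
  them occurs in the other as \<open>A @ x # B\<close>; being a descent of the product, it forces
  \<open>B\<close> to fix \<open>x\<close> and \<open>x + 1\<close>. Then \<open>B\<close> contains
  no neighbour of \<open>x\<close>, and \<open>x\<close> can be moved to the end.\<close>

lemma inv_word_cong:
  assumes "distinct xs" "distinct ys" "word_perm xs = word_perm ys"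
  shows "inv_word xs = inv_word ys"
  using assms
proof (induction xs arbitrary: ys rule: rev_induct)
  case Nil
  then have "set ys \<subseteq> set []" by (intro word_perm_eq_set_subset Nil.prems(2) Nil.prems(3)[symmetric])
  then show ?case by simp
next
  case (snoc x xs)
  then have "x \<in> set ys" using word_perm_eq_set_subset[OF snoc.prems(1,3)] by auto
  then obtain A B where ys: "ys = A @ x # B" by (meson split_list)
  let ?A = "word_perm A" and ?B = "word_perm B"
  have rA: "supported ?A (set A)" and rB: "supported ?B (set B)"
    by (auto intro: supported_word_perm)
  have w: "word_perm xs (simple x p) = ?A (simple x (?B p))" for p
    using snoc.prems(3) by (simp add: ys fun_eq_iff)
  have "supported (word_perm xs) (set xs)" by (auto intro: supported_word_perm)
  from supportedD[OF this, of x] have "word_perm xs x \<le> x" "\<not> word_perm xs (x + 1) \<le> x"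
    using snoc.prems by auto
  then have "\<not> ?A (simple x (?B x)) < ?A (simple x (?B (x + 1)))"
    using w[of x] w[of "x + 1"] by (simp add: simple_apply)
  with supported_descent[OF rA rB, of x] have fx: "?B x = x" "?B (x + 1) = x + 1"
    using snoc.prems ys by auto
  have "supported ?B (set B - {x - 1, x + 1})"
    by (rule supported_neighbours[OF bij_is_inj[OF bij_word_perm] rB _ fx]) (use snoc.prems ys in auto)
  then have "set B \<subseteq> set B - {x - 1, x + 1}"
    using supported_distinct_word_perm snoc.prems ys by auto
  then have far: "\<bar>x - y\<bar> \<ge> 2" if "y \<in> set B" for y
  proof -
    have "y \<noteq> x" "y \<noteq> x - 1" "y \<noteq> x + 1" using that snoc.prems ys \<open>set B \<subseteq> _\<close> by auto
    then show ?thesis by linarith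
  qed
  have "word_perm xs = word_perm (A @ B)"
  proof
    fix p
    have "word_perm xs p = ?A (simple x (?B (simple x p)))" using w[of "simple x p"] by simp
    also have "\<dots> = ?A (?B p)"
      using word_perm_commute[OF far] by (simp add: fun_eq_iff)
    finally show "word_perm xs p = word_perm (A @ B) p" by simp
  qed
  then have "inv_word xs = inv_word (A @ B)"
    using snoc.IH[of "A @ B"] snoc.prems ys by simp
  then show ?case
    using foldl_inv_step_commute[OF far, where z = "foldl inv_step id A"] by (simp add: ys inv_word_def)
qed

text \<open>The reduced word picked by \<open>SOME\<close> has distinct letters again, and
  \<open>inv_word\<close> does not depend on the choice.\<close>

lemma demazure_word_perm:
  assumes "distinct xs"
  shows "demazure (inv (word_perm xs)) (word_perm xs) = inv_word xs"
proof -
  define ys where "ys = (SOME ys. ys \<in> reduced_words (word_perm xs))"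
  have "ys \<in> reduced_words (word_perm xs)"
    unfolding ys_def using reduced_words_nonempty[OF permutation_word_perm] by (simp add: some_in_eq)
  note ys = reduced_words_distinct[OF assms this]
  have "demazure (inv (word_perm xs)) (word_perm xs) =
      foldl demazure_step (word_perm (rev ys)) ys"
    unfolding demazure_def ys_def[symmetric] by (simp add: ys(3)[symmetric] inv_word_perm)
  also have "\<dots> = inv_word ys"
    using foldl_demazure_step_distinct[of "[]" ys] ys(1) by (simp add: inv_word_Nil)
  also have "\<dots> = inv_word xs" using inv_word_cong ys assms by blast
  finally show ?thesis .
qed

text \<open>For arbitrary \<open>v\<close> this bounds the length of \<open>v\<close> from below by
  the number of half-lines that the resulting involution moves, which is what the minimality of
  atoms needs.\<close>

lemma demazure_support:
  assumes "permutation v"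
  obtains ys where "word_perm ys = v" "length ys = perm_length v"
    "supported (demazure (inv v) v) (set ys)"
proof -
  define ys where "ys = (SOME ys. ys \<in> reduced_words v)"
  have "ys \<in> reduced_words v"
    unfolding ys_def using reduced_words_nonempty[OF assms] by (simp add: some_in_eq)
  then have ys: "word_perm ys = v" "length ys = perm_length v" by (auto simp: reduced_words_def)
  have "demazure (inv v) v = foldl demazure_step (word_perm (rev ys)) ys"
    unfolding demazure_def ys_def[symmetric] by (simp add: ys(1)[symmetric] inv_word_perm)
  then have "supported (demazure (inv v) v) (set ys)"
    using foldl_demazure_step_supported[OF supported_word_perm] by simp
  with ys show ?thesis by (rule that)
qed

lemma supported_inv_step:
  assumes "c \<noteq> i" "supported (inv_step z i) (- {c})"
  shows "supported z (- {c})"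
proof -
  have s: "simple i p \<le> c \<longleftrightarrow> p \<le> c" for p using assms(1) by (auto simp: simple_apply)
  have r: "inv_step z i p \<le> c \<longleftrightarrow> p \<le> c" for p using supportedD[OF assms(2), of c] by simp
  have "z p \<le> c \<longleftrightarrow> p \<le> c" for p
    using r[of p] r[of "simple i p"] s[of p] s[of "z p"] by (auto simp: inv_step_def split: if_splits)
  then show ?thesis by (simp add: supported_def)
qed

text \<open>The step \<open>c\<close> makes \<open>c\<close> or \<open>c + 1\<close> cross the end
  of \<open>{..c}\<close>. Every later step multiplies by some \<open>simple i\<close> with
  \<open>i \<noteq> c\<close>, which preserves this half-line, so the crossing is never
  undone.\<close>

lemma supported_distinct_inv_word:
  assumes "distinct xs" "supported (inv_word xs) F"
  shows "set xs \<subseteq> F"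
proof -
  have "\<not> supported (inv_word xs) (- {c})" if "c \<in> set xs" "distinct xs" for c xs
    using that
  proof (induction xs rule: rev_induct)
    case (snoc i xs)
    show ?case
    proof (cases "c = i")
      case False
      then have "\<not> supported (inv_word xs) (- {c})" using snoc by auto
      then show ?thesis unfolding inv_word_snoc using supported_inv_step[OF False] by blast
    next
      case True
      let ?z = "inv_word xs"
      have "supported ?z (set xs)" by (auto intro: supported_inv_word)
      from supportedD[OF this, of c] have z: "?z c \<le> c" "\<not> ?z (c + 1) \<le> c"
        using snoc.prems True by auto
      have "inv_word (xs @ [i]) c > c \<or> inv_word (xs @ [i]) (c + 1) \<le> c"
        unfolding inv_word_snoc True[symmetric] using z by (auto simp: inv_step_def simple_apply)
      then obtain p where "\<not> (inv_word (xs @ [i]) p \<le> c \<longleftrightarrow> p \<le> c)"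
        by (metis linorder_not_le order_refl zless_add1_eq less_irrefl)
      then show ?thesis using supportedD[of _ "- {c}" c p] by blast
    qed
  qed simp
  moreover have "supported (inv_word xs) (- {c})" if "c \<notin> F" for c
    using that by (intro supported_mono[OF assms(2)]) auto
  ultimately show ?thesis using assms(1) by blast
qed

lemma inv_word_fixed_iff:
  assumes "distinct xs" "x \<notin> set xs"
  shows "inv_word xs x = x \<and> inv_word xs (x + 1) = x + 1 \<longleftrightarrow> x - 1 \<notin> set xs \<and> x + 1 \<notin> set xs"
proof
  assume fx: "inv_word xs x = x \<and> inv_word xs (x + 1) = x + 1"
  have "inj (inv_word xs)"
    using permutation_inv_word permutation_bijective bij_is_inj by blast
  moreover have "supported (inv_word xs) (set xs)" by (auto intro: supported_inv_word)
  ultimately have "supported (inv_word xs) (set xs - {x - 1, x + 1})"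
    using supported_neighbours assms fx by blast
  then show "x - 1 \<notin> set xs \<and> x + 1 \<notin> set xs"
    using supported_distinct_inv_word[OF assms(1)] by blast
next
  assume n: "x - 1 \<notin> set xs \<and> x + 1 \<notin> set xs"
  have "supported (inv_word xs) (set xs)" by (auto intro: supported_inv_word)
  from supportedD[OF this] n assms(2)
  have "inv_word xs p \<le> c \<longleftrightarrow> p \<le> c" if "c \<in> {x - 1, x, x + 1}" for c p
    using that by auto
  from this[of "x - 1" x] this[of x x] this[of x "x + 1"] this[of "x + 1" "x + 1"]
  show "inv_word xs x = x \<and> inv_word xs (x + 1) = x + 1" by auto
qed

text \<open>Obvious if the step conjugates. If it multiplies, it creates the new cycle of the fixed
  points \<open>i\<close> and \<open>i + 1\<close>; requiring \<open>z\<close> to move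
  \<open>p\<close> or \<open>q\<close> excludes exactly this pair, and other cycles are not
  touched.\<close>

lemma inv_step_pair:
  assumes "z \<circ> z = id" "p \<noteq> q" "z p \<noteq> p \<or> z q \<noteq> q"
  shows "inv_step z i (simple i p) = simple i q \<longleftrightarrow> z p = q"
    and "inv_step z i (simple i p) \<noteq> simple i p \<or> inv_step z i (simple i q) \<noteq> simple i q"
proof -
  have z: "z (z r) = r" for r using assms(1) by (simp add: fun_eq_iff)
  have s: "simple i a = simple i b \<longleftrightarrow> a = b" for a b by (metis simple_invol)
  have fixed: "simple i r = r" if "z i = i" "z (i + 1) = i + 1" "z r \<noteq> r" for r
    using that by (auto simp: simple_apply)
  have swap: "z (simple i r) = simple i r" if "z i = i" "z (i + 1) = i + 1" "simple i r \<noteq> r" for r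
    using that by (auto simp: simple_apply split: if_splits)
  show "inv_step z i (simple i p) = simple i q \<longleftrightarrow> z p = q"
    unfolding inv_step_def using assms(2,3) fixed swap s z by (auto) metis+
  show "inv_step z i (simple i p) \<noteq> simple i p \<or> inv_step z i (simple i q) \<noteq> simple i q"
    unfolding inv_step_def using assms(3) fixed s by auto
qed

lemma foldl_inv_step_pair:
  assumes "z \<circ> z = id" "p \<noteq> q" "z p \<noteq> p \<or> z q \<noteq> q"
  shows "foldl inv_step z xs (word_perm (rev xs) p) = word_perm (rev xs) q \<longleftrightarrow> z p = q"
  using assms
proof (induction xs arbitrary: z p q)
  case (Cons i xs)
  have "simple i p \<noteq> simple i q" using Cons.prems(2) by (metis simple_invol)
  from Cons.IH[OF inv_step_invol[OF Cons.prems(1)] this inv_step_pair(2)[OF Cons.prems]]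
  show ?case using inv_step_pair(1)[OF Cons.prems] by simp
qed simp

text \<open>The letters after \<open>x\<close> carry the pair \<open>(x, x + 1)\<close> along with
  the involution, so membership is decided right after the step \<open>x\<close>: the pair is then a
  cycle iff the step multiplied, that is, iff both points were still fixed.\<close>

lemma mark_in_Cyc_iff:
  assumes "distinct (xs @ x # ys)"
  shows "(word_perm (rev ys) x, word_perm (rev ys) (x + 1)) \<in> Cyc (inv_word (xs @ x # ys)) \<longleftrightarrow>
    x - 1 \<notin> set xs \<and> x + 1 \<notin> set xs"
proof -
  let ?R = "word_perm (rev ys)" and ?z = "inv_word xs"
  have "supported ?R (set ys)" by (auto intro: supported_word_perm)
  from supportedD[OF this, of x x] supportedD[OF this, of x "x + 1"]
  have "?R x < ?R (x + 1)" using assms by simp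
  have "supported ?z (set xs)" by (auto intro: supported_inv_word)
  from supportedD[OF this, of x] have z: "?z x \<le> x" "\<not> ?z (x + 1) \<le> x" using assms by auto
  let ?z' = "inv_step ?z x"
  have moved: "?z' x \<noteq> x \<or> ?z' (x + 1) \<noteq> x + 1"
    and eq: "?z' x = x + 1 \<longleftrightarrow> ?z x = x \<and> ?z (x + 1) = x + 1"
    using z by (auto simp: inv_step_def simple_apply)
  have "inv_word (xs @ x # ys) = foldl inv_step ?z' ys" by (simp add: inv_word_def)
  then show ?thesis
    using foldl_inv_step_pair[OF inv_step_invol[OF inv_word_invol] _ moved, of ys] eq
      inv_word_fixed_iff[of xs x] assms \<open>?R x < ?R (x + 1)\<close>
    by (auto simp: Cyc_def)
qed

text \<open>For distinct letters this is the condition \<open>marked u \<subseteq> Cyc z\<close>,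
  expressed without the involution.\<close>

definition marks_ok :: "letter list \<Rightarrow> bool" where
  "marks_ok u \<longleftrightarrow> (\<forall>xs y ys. u = xs @ y # ys \<longrightarrow> primed y \<longrightarrow>
     base y - 1 \<notin> base ` set xs \<and> base y + 1 \<notin> base ` set xs)"

lemma marked_subset_Cyc_iff:
  assumes "distinct (map base u)"
  shows "marked u \<subseteq> Cyc (inv_word (map base u)) \<longleftrightarrow> marks_ok u"
proof -
  have "marked u = {(word_perm (rev (map base ys)) (base y), word_perm (rev (map base ys)) (base y + 1))
    | xs y ys. u = xs @ y # ys \<and> primed y}" (is "_ = ?M")
  proof (intro set_eqI iffI)
    fix m assume "m \<in> marked u"
    then obtain j where j: "j < length u" "primed (u ! j)"
      "m = (word_perm (rev (map base (drop (Suc j) u))) (base (u ! j)),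
            word_perm (rev (map base (drop (Suc j) u))) (base (u ! j) + 1))"
      by (auto simp: marked_def)
    then show "m \<in> ?M" using id_take_nth_drop[OF j(1)] by blast
  next
    fix m assume "m \<in> ?M"
    then obtain xs y ys where y: "u = xs @ y # ys" "primed y"
      "m = (word_perm (rev (map base ys)) (base y), word_perm (rev (map base ys)) (base y + 1))"
      by blast
    then show "m \<in> marked u"
      unfolding marked_def by (intro CollectI exI[of _ "length xs"]) (simp add: nth_append)
  qed
  moreover have "(word_perm (rev (map base ys)) (base y), word_perm (rev (map base ys)) (base y + 1))
      \<in> Cyc (inv_word (map base u)) \<longleftrightarrow> base y - 1 \<notin> base ` set xs \<and> base y + 1 \<notin> base ` set xs"
    if "u = xs @ y # ys" for xs y ys
    using mark_in_Cyc_iff[of "map base xs" "base y" "map base ys"] assms that by simp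
  ultimately show ?thesis by (auto simp: marks_ok_def) blast+
qed

text \<open>Minimality: any competitor has a reduced word whose letters support the involution, and
  these include all the letters of \<open>xs\<close>.\<close>

lemma word_perm_in_atoms_O:
  assumes "distinct xs"
  shows "word_perm xs \<in> atoms_O (inv_word xs)"
  unfolding atoms_O_def
proof (intro CollectI conjI ballI impI)
  show "word_perm xs \<in> S_Z" using permutation_word_perm by (simp add: S_Z_def)
  show "demazure (inv (word_perm xs)) (word_perm xs) = inv_word xs"
    by (rule demazure_word_perm[OF assms])
  fix v assume v: "v \<in> S_Z" "demazure (inv v) v = inv_word xs"
  then obtain ys where "length ys = perm_length v" "supported (inv_word xs) (set ys)"
    using demazure_support[of v] by (auto simp: S_Z_def)
  then have "card (set xs) \<le> perm_length v"
    using supported_distinct_inv_word[OF assms] by (metis List.finite_set card_length card_mono order_trans)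
  then show "perm_length (word_perm xs) \<le> perm_length v"
    using perm_length_distinct[OF assms] distinct_card[OF assms] by simp
qed

text \<open>A reduced word of an atom contains every letter of \<open>xs\<close> and is not longer
  than \<open>xs\<close>, so its letters are distinct too.\<close>

lemma atoms_O_distinctE:
  assumes "distinct xs" "w \<in> atoms_O (inv_word xs)"
  obtains ys where "distinct ys" "word_perm ys = w" "inv_word ys = inv_word xs"
proof -
  have w: "permutation w" "demazure (inv w) w = inv_word xs"
    "perm_length w \<le> perm_length (word_perm xs)"
    using assms word_perm_in_atoms_O[OF assms(1)] by (auto simp: atoms_O_def S_Z_def)
  from demazure_support[OF w(1)] obtain ys where ys: "word_perm ys = w" "length ys = perm_length w"
    "supported (inv_word xs) (set ys)" unfolding w(2) .
  have sub: "set xs \<subseteq> set ys" using supported_distinct_inv_word[OF assms(1) ys(3)] .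
  have "length ys \<le> card (set xs)"
    using w(3) ys(2) perm_length_distinct[OF assms(1)] distinct_card[OF assms(1)] by simp
  then have "length ys \<le> card (set ys)" using card_mono[OF _ sub] by simp
  then have d: "distinct ys" using card_length[of ys] by (intro card_distinct) simp
  moreover have "inv_word ys = inv_word xs"
    using demazure_word_perm[OF d] w(2) ys(1) by simp
  ultimately show ?thesis using ys(1) that by blast
qed

lemma R_O_inv_word:
  assumes "distinct xs"
  shows "u \<in> R_O (inv_word xs) \<longleftrightarrow>
    distinct (map base u) \<and> inv_word (map base u) = inv_word xs \<and> marks_ok u"
proof
  assume u: "u \<in> R_O (inv_word xs)"
  then obtain w where w: "w \<in> atoms_O (inv_word xs)" "map base u \<in> reduced_words w"
    by (auto simp: R_O_def)
  obtain ys where ys: "distinct ys" "word_perm ys = w" "inv_word ys = inv_word xs"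
    using atoms_O_distinctE[OF assms w(1)] .
  have "map base u \<in> reduced_words (word_perm ys)" using w(2) ys(2) by simp
  note r = reduced_words_distinct[OF ys(1) this]
  have "inv_word (map base u) = inv_word xs" using inv_word_cong[OF r(1) ys(1) r(3)] ys(3) by simp
  moreover have "marked u \<subseteq> Cyc (inv_word xs)" using u by (simp add: R_O_def)
  ultimately show "distinct (map base u) \<and> inv_word (map base u) = inv_word xs \<and> marks_ok u"
    using marked_subset_Cyc_iff[OF r(1)] r(1) by simp
next
  assume u: "distinct (map base u) \<and> inv_word (map base u) = inv_word xs \<and> marks_ok u"
  then have "word_perm (map base u) \<in> atoms_O (inv_word xs)"
    using word_perm_in_atoms_O[of "map base u"] by simp
  moreover have "map base u \<in> reduced_words (word_perm (map base u))"
    using u perm_length_distinct[of "map base u"] by (simp add: reduced_words_def)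
  moreover have "marked u \<subseteq> Cyc (inv_word xs)" using u marked_subset_Cyc_iff[of u] by simp
  ultimately show "u \<in> R_O (inv_word xs)" by (auto simp: R_O_def)
qed

lemma R_O_distinct:
  assumes "u \<in> R_O z" "distinct (map base u)"
  shows "z = inv_word (map base u)"
proof -
  obtain w where "w \<in> atoms_O z" "map base u \<in> reduced_words w" using assms by (auto simp: R_O_def)
  then show ?thesis
    using demazure_word_perm[OF assms(2)] by (auto simp: atoms_O_def reduced_words_def)
qed

text \<open>Needed for rows in which \<open>m'\<close> and \<open>m\<close> stand side by side: they
  are different letters with the same base.\<close>

lemma reduced_words_no_square:
  assumes "xs @ [a, a] @ ys \<in> reduced_words w"
  shows False
proof -
  have "word_perm (xs @ [a, a] @ ys) = word_perm (xs @ ys)" by (simp add: fun_eq_iff)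
  then have "perm_length w \<le> length (xs @ ys)"
    using assms perm_length_le[of "xs @ ys"] by (simp add: reduced_words_def)
  then show False using assms by (simp add: reduced_words_def)
qed


subsection \<open>Words growing an interval of letters\<close>

text \<open>The letters come from an increasing sequence \<open>I\<close>, and \<open>g j\<close> is the prime attached to the gap
  between \<open>I j\<close> and \<open>I (j + 1)\<close>. Once the letters \<open>I l, \<dots>, I (r - 1)\<close> have been written, the
  step \<open>True\<close> appends \<open>I r\<close> and the step \<open>False\<close> appends \<open>I (l - 1)\<close>, with the prime of the gap
  that is crossed. No gap is crossed by the very first letter, when \<open>l = r\<close>; there the two kinds of
  steps encode whether the letter is primed. A word of length \<open>k\<close> that starts from
  \<open>l = r = 1 + d\<close>, where \<open>d\<close> is its number of steps \<open>False\<close>, uses exactly \<open>I 1, \<dots>, I k\<close>.\<close>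

fun enc :: "(int \<Rightarrow> int) \<Rightarrow> (int \<Rightarrow> bool) \<Rightarrow> int \<Rightarrow> int \<Rightarrow> bool list \<Rightarrow> letter list" where
  "enc I g l r [] = []"
| "enc I g l r (True # w) = Letter (I r) (l = r \<or> g (r - 1)) # enc I g l (r + 1) w"
| "enc I g l r (False # w) = Letter (I (l - 1)) (l \<noteq> r \<and> g (l - 1)) # enc I g (l - 1) r w"

abbreviation ups :: "bool list \<Rightarrow> int" where "ups w \<equiv> int (count_list w True)"
abbreviation downs :: "bool list \<Rightarrow> int" where "downs w \<equiv> int (count_list w False)"

definition enc0 :: "(int \<Rightarrow> int) \<Rightarrow> (int \<Rightarrow> bool) \<Rightarrow> bool list \<Rightarrow> letter list" where
  "enc0 I g w = enc I g (1 + downs w) (1 + downs w) w"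

lemma enc_append:
  "enc I g l r (v @ w) = enc I g l r v @ enc I g (l - downs v) (r + ups v) w"
  by (induction I g l r v rule: enc.induct) (simp_all add: algebra_simps)

lemma length_enc [simp]: "length (enc I g l r w) = length w"
  by (induction I g l r w rule: enc.induct) auto

lemma length_ups_downs: "int (length w) = ups w + downs w"
  by (induction w) auto

lemma enc_eq_append:
  assumes "enc I g l r w = xs @ ys"
  obtains v w' where "w = v @ w'" "xs = enc I g l r v"
    "ys = enc I g (l - downs v) (r + ups v) w'"
proof -
  let ?v = "take (length xs) w" and ?w = "drop (length xs) w"
  have len: "length xs \<le> length w"
    using arg_cong[OF assms, of length] by simp
  have "enc I g l r ?v @ enc I g (l - downs ?v) (r + ups ?v) ?w = xs @ ys"
    using assms enc_append[of I g l r ?v ?w] by simp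
  then have "xs = enc I g l r ?v" "ys = enc I g (l - downs ?v) (r + ups ?v) ?w"
    using len by (auto simp: append_eq_append_conv)
  then show ?thesis using that[of ?v ?w] by simp
qed

lemma base_enc:
  assumes "l \<le> r"
  shows "base ` set (enc I g l r w) = I ` ({l - downs w..<l} \<union> {r..<r + ups w})"
  using assms
proof (induction I g l r w rule: enc.induct)
  case (2 I g l r w)
  have "{l - downs w..<l} \<union> {r..<r + ups (True # w)} =
      insert r ({l - downs w..<l} \<union> {r + 1..<r + 1 + ups w})" by auto
  then show ?case using 2 by simp
next
  case (3 I g l r w)
  have "{l - downs (False # w)..<l} \<union> {r..<r + ups w} =
      insert (l - 1) ({l - 1 - downs w..<l - 1} \<union> {r..<r + ups w})" by auto
  then show ?case using 3 by simp
qed simp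

lemma distinct_enc:
  assumes "strict_mono I" "l \<le> r"
  shows "distinct (map base (enc I g l r w))"
  using assms
proof (induction I g l r w rule: enc.induct)
  case (2 I g l r w)
  then show ?case
    using base_enc[of l "r + 1" I g w] by (auto simp: strict_mono_eq)
next
  case (3 I g l r w)
  then show ?case
    using base_enc[of "l - 1" r I g w] by (auto simp: strict_mono_eq)
qed simp

text \<open>A later letter extends the interval written so far, so its only possible neighbour is
  the old end of the interval; a prime means that the gap to this end is at least 2. The first
  letter has no predecessors.\<close>

lemma marks_ok_enc:
  assumes I: "strict_mono I" and gap: "\<And>j. g j \<Longrightarrow> I j + 2 \<le> I (j + 1)"
  shows "marks_ok (enc I g l l w)"
  unfolding marks_ok_def
proof (intro allI impI)
  fix xs y ys assume eq: "enc I g l l w = xs @ y # ys" and y: "primed y"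
  obtain v w' where v: "xs = enc I g l l v"
    "y # ys = enc I g (l - downs v) (l + ups v) w'"
    using enc_eq_append[OF eq] by metis
  have xs: "base ` set xs = I ` {l - downs v..<l + ups v}"
    unfolding v(1) base_enc[OF order_refl] by (rule arg_cong[where f = "image I"]) auto
  obtain c w2 where w': "w' = c # w2" using v(2) by (cases w') auto
  have mono: "I a \<le> I b" if "a \<le> b" for a b using I that by (simp add: strict_mono_less_eq)
  show "base y - 1 \<notin> base ` set xs \<and> base y + 1 \<notin> base ` set xs"
  proof (cases "l - downs v = l + ups v")
    case True
    then show ?thesis unfolding xs by simp
  next
    case False
    show ?thesis
    proof (cases c)
      case True
      then have "base y = I (l + ups v)" "g (l + ups v - 1)" using v(2) w' y False by auto
      moreover have "I j \<le> I (l + ups v - 1)" if "j < l + ups v" for j using mono that by simp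
      ultimately show ?thesis unfolding xs using gap[of "l + ups v - 1"] by fastforce
    next
      case F: False
      then have "base y = I (l - downs v - 1)" "g (l - downs v - 1)" using v(2) w' y False by auto
      moreover have "I j \<ge> I (l - downs v)" if "j \<ge> l - downs v" for j using mono that by simp
      ultimately show ?thesis unfolding xs using gap[of "l - downs v - 1"] by fastforce
    qed
  qed
qed

section \<open>Coxeter-Knuth classes of encoded words\<close>

text \<open>Equivalence gives membership in the class of the tableau, and equality of involutions
  gives membership in \<open>R_O\<close>; both are carried along the same chain of moves.\<close>

definition similar :: "letter list \<Rightarrow> letter list \<Rightarrow> bool" where
  "similar u v \<longleftrightarrow> ck_equiv u v \<and> inv_word (map base u) = inv_word (map base v)"

lemma similar_refl: "similar u u"
  by (simp add: similar_def ck_equiv_def)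

lemma similar_sym: "similar u v \<Longrightarrow> similar v u"
  by (simp add: similar_def ck_equiv_def equivclp_sym)

lemma similar_trans: "similar u v \<Longrightarrow> similar v w \<Longrightarrow> similar u w"
  unfolding similar_def ck_equiv_def by (metis equivclp_trans)

lemma similarI:
  "ck_move u v \<or> ck_move v u \<Longrightarrow> inv_word (map base u) = inv_word (map base v) \<Longrightarrow> similar u v"
  unfolding similar_def ck_equiv_def by (auto intro: r_into_equivclp converse_r_into_equivclp)

lemma inv_step_id: "inv_step id i = simple i"
  by (simp add: inv_step_def fun_eq_iff)

text \<open>For neighbouring values this is the braid relation
  \<open>s_b s_a s_b = s_a s_b s_a\<close>, since the first letter is the involution
  \<open>s_a\<close> itself.\<close>

lemma inv_word_swap_first:
  assumes "a \<noteq> b" shows "inv_word (a # b # xs) = inv_word (b # a # xs)"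
proof -
  have "inv_step (simple a) b = inv_step (simple b) a"
  proof (cases "\<bar>a - b\<bar> \<ge> 2")
    case True
    then show ?thesis using inv_step_commute[of a b id] by (simp add: inv_step_id)
  next
    case False
    then have "b = a + 1 \<or> a = b + 1" using assms by linarith
    then show ?thesis by (auto simp: inv_step_def fun_eq_iff simple_apply)
  qed
  then show ?thesis by (simp add: inv_word_def inv_step_id)
qed

lemma inv_word_swap:
  assumes "\<bar>a - b\<bar> \<ge> 2" shows "inv_word (xs @ a # b # ys) = inv_word (xs @ b # a # ys)"
  using inv_step_commute[OF assms] by (simp add: inv_word_def)

text \<open>Turning a first \<open>False\<close> into \<open>True\<close> lowers the starting point
  by one, so the same letter is written, now with a prime, and the same interval results.\<close>

lemma enc0_toggle_first:
  "enc0 I g (c # w) = x # u \<Longrightarrow> enc0 I g ((\<not> c) # w) = toggle x # u"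
  by (cases c) (auto simp: enc0_def toggle_def algebra_simps)

text \<open>Flipping the second step moves the starting point by one. The same two letters are
  written in the other order across the same gap, so the primes stay in their places.\<close>

lemma enc0_swap_first:
  "enc0 I g (c # d # w) = Letter a p # Letter b q # u \<Longrightarrow>
   enc0 I g (c # (\<not> d) # w) = Letter b p # Letter a q # u"
  by (cases c; cases d) (auto simp: enc0_def algebra_simps)

lemma ck_move_toggle: "ck_move (x # u) (toggle x # u) \<or> ck_move (toggle x # u) (x # u)"
  by (cases x; cases "primed x") (auto simp: toggle_def intro: start1)

lemma ck_move_swap_first: "ck_move (Letter a p # Letter b q # u) (Letter b p # Letter a q # u)"
  by (cases p; cases q) (auto intro: start2 start3 start4 start5)

lemma similar_toggle_first: "similar (enc0 I g (c # w)) (enc0 I g ((\<not> c) # w))"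
proof -
  obtain x u where xu: "enc0 I g (c # w) = x # u" by (cases c) (auto simp: enc0_def)
  show ?thesis
    unfolding enc0_toggle_first[OF xu] xu
    by (rule similarI[OF ck_move_toggle]) (simp add: toggle_def)
qed

lemma similar_swap_first:
  assumes "strict_mono I"
  shows "similar (enc0 I g (c # d # w)) (enc0 I g (c # (\<not> d) # w))"
proof -
  obtain a p b q u where eq: "enc0 I g (c # d # w) = Letter a p # Letter b q # u"
    by (cases c; cases d) (auto simp: enc0_def)
  have "distinct (map base (enc0 I g (c # d # w)))"
    unfolding enc0_def by (rule distinct_enc[OF assms order_refl])
  then show ?thesis
    unfolding enc0_swap_first[OF eq] eq
    by (intro similarI disjI1 ck_move_swap_first) (simp add: inv_word_swap_first)
qed

text \<open>Opposite steps write a letter above and a letter below everything before them. The last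
  letter of the nonempty prefix lies strictly between and serves as the \<open>B\<close> of the move
  \<open>BCA\<close>.\<close>

lemma similar_swap:
  assumes I: "strict_mono I" and "v \<noteq> []"
  shows "similar (enc0 I g (v @ True # False # w)) (enc0 I g (v @ False # True # w))"
proof -
  define k where "k = 1 + downs v + 1 + downs w"
  define l r where "l = k - downs v" and "r = k + ups v"
  obtain u B where B: "enc I g k k v = u @ [B]"
    using assms(2) by (metis length_enc length_0_conv rev_exhaust)
  define A where "A = Letter (I (l - 1)) (g (l - 1))"
  define C where "C = Letter (I r) (g (r - 1))"
  define t where "t = enc I g (l - 1) (r + 1) w"
  have lr: "l < r" using length_ups_downs[of v] assms(2) by (auto simp: l_def r_def simp flip: length_greater_0_conv)
  have "base B \<in> base ` set (enc I g k k v)" by (simp add: B)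
  then have "base B \<in> I ` {l..<r}" unfolding base_enc[OF order_refl] by (auto simp: l_def r_def)
  then have ABC: "base A < base B" "base B < base C"
    using I by (auto simp: A_def C_def strict_mono_less)
  have "enc0 I g (v @ True # False # w) = enc I g k k (v @ True # False # w)"
    "enc0 I g (v @ False # True # w) = enc I g k k (v @ False # True # w)"
    by (simp_all add: enc0_def k_def algebra_simps)
  then have eq: "enc0 I g (v @ True # False # w) = u @ [B, C, A] @ t"
    "enc0 I g (v @ False # True # w) = u @ [B, A, C] @ t"
    using lr by (simp_all add: enc_append B l_def[symmetric] r_def[symmetric] A_def C_def t_def)
  show ?thesis
    unfolding eq using ABC inv_word_swap[of "base C" "base A" "map base u @ [base B]"]
    by (intro similarI disjI1 BCA) simp_all
qed

text \<open>The step \<open>False\<close> travels left by \<open>similar_swap\<close> until it is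
  the second step, where a starting move turns it into \<open>True\<close>; if it is the first step,
  its prime is toggled.\<close>

lemma similar_lower_step:
  assumes I: "strict_mono I"
  shows "similar (enc0 I g (replicate a True @ False # w)) (enc0 I g (replicate a True @ True # w))"
proof (induction a arbitrary: w)
  case 0
  show ?case using similar_toggle_first[of I g False w] by simp
next
  case (Suc a)
  show ?case
  proof (cases a)
    case 0
    then show ?thesis using similar_swap_first[OF I, of g True False w] by simp
  next
    case (Suc b)
    have "similar (enc0 I g (replicate a True @ True # False # w))
       (enc0 I g (replicate a True @ False # True # w))"
      by (rule similar_swap[OF I]) (simp add: Suc)
    then have "similar (enc0 I g (replicate a True @ True # False # w))
       (enc0 I g (replicate a True @ True # True # w))"
      using Suc.IH[of "True # w"] by (rule similar_trans)
    then show ?thesis by (simp add: replicate_app_Cons_same)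
  qed
qed

lemma similar_enc0_replicate:
  assumes I: "strict_mono I"
  shows "similar (enc0 I g (replicate a True @ w)) (enc0 I g (replicate (a + length w) True))"
proof (induction w arbitrary: a)
  case Nil
  show ?case by (simp add: similar_refl)
next
  case (Cons c w)
  have "similar (enc0 I g (replicate a True @ c # w)) (enc0 I g (replicate a True @ True # w))"
    using similar_lower_step[OF I] similar_refl by (cases c) auto
  moreover have "replicate a True @ True # w = replicate (Suc a) True @ w"
    by (simp add: replicate_app_Cons_same)
  ultimately have "similar (enc0 I g (replicate a True @ c # w)) (enc0 I g (replicate (Suc a) True @ w))"
    by simp
  from similar_trans[OF this Cons.IH[of "Suc a"]] show ?case by simp
qed

lemma similar_enc0:
  assumes "strict_mono I" "length v = length w"
  shows "similar (enc0 I g v) (enc0 I g w)"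
proof -
  have "similar (enc0 I g v) (enc0 I g (replicate (length v) True))"
    "similar (enc0 I g w) (enc0 I g (replicate (length v) True))"
    using similar_enc0_replicate[OF assms(1), of g 0 v] similar_enc0_replicate[OF assms(1), of g 0 w]
      assms(2) by simp_all
  then show ?thesis using similar_sym similar_trans by blast
qed

lemma enc_eq_Cons3:
  assumes "enc I g l r w = x # y # z # u"
  obtains c1 c2 c3 w' where "w = c1 # c2 # c3 # w'"
proof -
  have "length w = Suc (Suc (Suc (length u)))" using arg_cong[OF assms, of length] by simp
  then show ?thesis using that by (auto simp: length_Suc_conv)
qed

text \<open>Each letter lies outside the interval of those before it, hence never between the two
  preceding ones. This rules out the patterns of \<open>ACB\<close> and of all braid moves.\<close>

lemma enc_no_peak:
  assumes I: "strict_mono I" and "l \<le> r" and eq: "enc I g l r w = x # y # z # u"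
  shows "\<not> (base x < base z \<and> base z < base y)" "\<not> (base y < base z \<and> base z < base x)"
    "base x \<noteq> base z"
proof -
  obtain c1 c2 c3 w' where w: "w = c1 # c2 # c3 # w'" using enc_eq_Cons3[OF eq] .
  note [simp] = strict_mono_less[OF I] strict_mono_eq[OF I]
  show "\<not> (base x < base z \<and> base z < base y)" "\<not> (base y < base z \<and> base z < base x)"
    "base x \<noteq> base z"
    using eq assms(2) unfolding w by (cases c1; cases c2; cases c3; auto)+
qed

text \<open>If \<open>B\<close> lies between the next two letters, their steps are opposite.
  Exchanging them keeps the number of steps \<open>False\<close>, so neither the starting point nor
  the remaining word changes.\<close>

lemma enc_swap_BCA:
  assumes I: "strict_mono I" and "l \<le> r" and eq: "enc I g l r w = B # x # y # u"
    and between: "base x < base B \<and> base B < base y \<or> base y < base B \<and> base B < base x"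
  shows "\<exists>w'. length w' = length w \<and> downs w' = downs w \<and> enc I g l r w' = B # y # x # u"
proof -
  obtain c1 c2 c3 v where w: "w = c1 # c2 # c3 # v" using enc_eq_Cons3[OF eq] .
  note [simp] = strict_mono_less[OF I]
  have "c3 = (\<not> c2)" using eq between assms(2) unfolding w by (cases c1; cases c2; cases c3; auto)
  then show ?thesis
    using eq assms(2) unfolding w
    by (intro exI[of _ "c1 # c3 # c2 # v"]) (cases c1; cases c2; auto)
qed

text \<open>Encoded words are closed under the moves: \<open>BCA\<close> and the starting moves lead
  to encoded words, the others never apply. The equivalence covers both directions of a move, as the
  induction over \<open>equivclp\<close> requires.\<close>

lemma ck_move_enc0:
  assumes I: "strict_mono I" and ck: "ck_move u v"
  shows "(\<exists>w. length w = k \<and> u = enc0 I g w) \<longleftrightarrow> (\<exists>w. length w = k \<and> v = enc0 I g w)"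
proof -
  have suffix: "\<exists>l r w1 w2. w = w1 @ w2 \<and> l \<le> r \<and> xs = enc I g (1 + downs w) (1 + downs w) w1 \<and>
      l = 1 + downs w - downs w1 \<and> r = 1 + downs w + ups w1 \<and> enc I g l r w2 = ys"
    if "enc0 I g w = xs @ ys" for w xs ys
    using that unfolding enc0_def by (elim enc_eq_append) fastforce
  have bad: False
    if eq: "enc0 I g w = xs @ [x, y, z] @ ys"
      and between: "base x < base z \<and> base z < base y \<or> base y < base z \<and> base z < base x \<or> base x = base z"
    for w xs x y z ys
  proof -
    obtain l r w2 where "l \<le> r" "enc I g l r w2 = x # y # z # ys"
      using suffix[OF eq] by (metis append_Cons append_Nil)
    from enc_no_peak[OF I this] between show False by blast
  qed
  have bca: "\<exists>w'. length w' = length w \<and> xs @ [B, y, x] @ ys = enc0 I g w'"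
    if w: "enc0 I g w = xs @ [B, x, y] @ ys"
      and between: "base x < base B \<and> base B < base y \<or> base y < base B \<and> base B < base x"
    for w xs x y B ys
  proof -
    obtain l r w1 w2 where w': "w = w1 @ w2" "l \<le> r" "xs = enc I g (1 + downs w) (1 + downs w) w1"
      "l = 1 + downs w - downs w1" "r = 1 + downs w + ups w1" "enc I g l r w2 = B # x # y # ys"
      using suffix[OF w] by (metis append_Cons append_Nil)
    obtain w3 where w3: "length w3 = length w2" "downs w3 = downs w2" "enc I g l r w3 = B # y # x # ys"
      using enc_swap_BCA[OF I w'(2,6) between] by blast
    then have "enc0 I g (w1 @ w3) = xs @ [B, y, x] @ ys"
      using w' by (simp add: enc0_def enc_append)
    with w3(1) w'(1) show ?thesis by (intro exI[of _ "w1 @ w3"]) simp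
  qed
  have toggle: "\<exists>w'. length w' = length w \<and> toggle x # ys = enc0 I g w'"
    if eq: "enc0 I g w = x # ys" for w x ys
  proof -
    obtain c w' where "w = c # w'" using eq by (cases w) (auto simp: enc0_def)
    then show ?thesis using enc0_toggle_first[of I g c w'] eq
      by (intro exI[of _ "(\<not> c) # w'"]) simp
  qed
  have swap: "\<exists>w'. length w' = length w \<and> Letter b p # Letter a q # ys = enc0 I g w'"
    if eq: "enc0 I g w = Letter a p # Letter b q # ys" for w a b p q ys
  proof -
    have "length w \<ge> 2" using arg_cong[OF eq, of length] by (simp add: enc0_def)
    then obtain c d w' where "w = c # d # w'" by (metis Suc_le_length_iff numeral_2_eq_2)
    then show ?thesis using enc0_swap_first[of I g c d w'] eq
      by (intro exI[of _ "c # (\<not> d) # w'"]) simp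
  qed
  show ?thesis
    using ck
  proof cases
    case (ACB A B C xs ys)
    then show ?thesis using bad[of _ xs A C B ys] bad[of _ xs C A B ys] by metis
  next
    case (BCA A B C xs ys)
    then show ?thesis using bca[of _ xs B C A ys] bca[of _ xs B A C ys] by metis
  next
    case (start1 a ys)
    then show ?thesis
      using toggle[of _ "Unp a" ys] toggle[of _ "Prm a" ys] by (auto simp: toggle_def)
  next
    case (start2 a b ys)
    then show ?thesis using swap by metis
  next
    case (start3 a b ys)
    then show ?thesis using swap by metis
  next
    case (start4 a b ys)
    then show ?thesis using swap by metis
  next
    case (start5 a b ys)
    then show ?thesis using swap by metis
  qed (use bad letter.sel(1) in metis)+
qed

lemma ck_equiv_enc0:
  assumes "strict_mono I" "ck_equiv u (enc0 I g v)"
  shows "\<exists>w. length w = length v \<and> u = enc0 I g w"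
proof -
  have "(\<exists>w. length w = length v \<and> u = enc0 I g w) \<longleftrightarrow> (\<exists>w. length w = length v \<and> u' = enc0 I g w)"
    if "equivclp ck_move u u'" for u'
    using that by (induction rule: equivclp_induct) (use ck_move_enc0[OF assms(1)] in blast)+
  then show ?thesis using assms(2) unfolding ck_equiv_def by blast
qed


subsection \<open>Factorizations as sequences of step counts\<close>

text \<open>A factor is strictly decreasing iff its steps are at most one \<open>True\<close>, followed by \<open>False\<close>s:
  the pair \<open>(e, d)\<close> records whether there is a \<open>True\<close>, and the number of \<open>False\<close>s.\<close>

definition factor_steps :: "bool \<times> nat \<Rightarrow> bool list" where
  "factor_steps x = (if fst x then [True] else []) @ replicate (snd x) False"

definition steps :: "(bool \<times> nat) list \<Rightarrow> bool list" where
  "steps m = concat (map factor_steps m)"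

primrec encs ::
  "(int \<Rightarrow> int) \<Rightarrow> (int \<Rightarrow> bool) \<Rightarrow> int \<Rightarrow> int \<Rightarrow> (bool \<times> nat) list \<Rightarrow> factorization" where
  "encs I g l r [] = []"
| "encs I g l r (x # m) =
     enc I g l r (factor_steps x) # encs I g (l - int (snd x)) (r + of_bool (fst x)) m"

definition enc_fact :: "(int \<Rightarrow> int) \<Rightarrow> (int \<Rightarrow> bool) \<Rightarrow> (bool \<times> nat) list \<Rightarrow> factorization" where
  "enc_fact I g m = encs I g (1 + downs (steps m)) (1 + downs (steps m)) m"

definition shapes :: "nat \<Rightarrow> nat \<Rightarrow> (bool \<times> nat) list set" where
  "shapes n k = {m. length m = n \<and> length (steps m) = k}"

lemma count_list_replicate: "count_list (replicate n x) y = (if x = y then n else 0)"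
  by (induction n) auto

lemma downs_factor_steps [simp]: "downs (factor_steps x) = int (snd x)"
  by (simp add: factor_steps_def count_list_replicate)

lemma ups_factor_steps [simp]: "ups (factor_steps x) = of_bool (fst x)"
  by (simp add: factor_steps_def count_list_replicate)

lemma length_factor_steps: "length (factor_steps x) = of_bool (fst x) + snd x"
  by (simp add: factor_steps_def)

lemma steps_Nil [simp]: "steps [] = []"
  and steps_Cons [simp]: "steps (x # m) = factor_steps x @ steps m"
  and steps_append [simp]: "steps (m @ m') = steps m @ steps m'"
  by (simp_all add: steps_def)

lemma concat_encs: "concat (encs I g l r m) = enc I g l r (steps m)"
  by (induction m arbitrary: l r) (simp_all add: enc_append)

lemma length_encs [simp]: "length (encs I g l r m) = length m"
  by (induction m arbitrary: l r) auto

lemma concat_enc_fact: "concat (enc_fact I g m) = enc0 I g (steps m)"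
  by (simp add: enc_fact_def enc0_def concat_encs)

lemma encs_append:
  "encs I g l r (m @ m') =
     encs I g l r m @ encs I g (l - downs (steps m)) (r + ups (steps m)) m'"
  by (induction m arbitrary: l r) (simp_all add: algebra_simps)

lemma map_length_encs: "map length (encs I g l r m) = map (\<lambda>x. of_bool (fst x) + snd x) m"
  by (induction m arbitrary: l r) (simp_all add: length_factor_steps)

lemma weight_enc_fact: "weight (enc_fact I g m) = map (\<lambda>x. of_bool (fst x) + snd x) m"
  by (simp add: weight_def enc_fact_def map_length_encs)

lemma base_less_imp_less: "base x < base y \<Longrightarrow> x < y"
  by (cases "primed x"; cases "primed y") (auto simp: less_letter_def)

lemma sorted_enc_replicate:
  assumes "strict_mono I" "l \<le> r"
  shows "sorted_wrt (>) (enc I g l r (replicate d False))"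
  using assms(2)
proof (induction d arbitrary: l)
  case (Suc d)
  have "y < Letter (I (l - 1)) p" if "y \<in> set (enc I g (l - 1) r (replicate d False))" for y p
  proof (rule base_less_imp_less)
    have "base y \<in> I ` {l - 1 - int d..<l - 1}"
      using base_enc[of "l - 1" r I g "replicate d False"] that Suc.prems
      by (auto simp: count_list_replicate)
    then show "base y < base (Letter (I (l - 1)) p)" using assms(1) by (auto simp: strict_mono_less)
  qed
  with Suc show ?case by auto
qed simp

lemma sorted_enc_factor_steps:
  assumes "strict_mono I" "l \<le> r"
  shows "sorted_wrt (>) (enc I g l r (factor_steps x))"
proof (cases "fst x")
  case True
  have "y < Letter (I r) p" if "y \<in> set (enc I g l (r + 1) (replicate (snd x) False))" for y p
  proof (rule base_less_imp_less)
    have "base y \<in> I ` {l - int (snd x)..<l}"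
      using base_enc[of l "r + 1" I g "replicate (snd x) False"] that assms(2)
      by (auto simp: count_list_replicate)
    then show "base y < base (Letter (I r) p)" using assms by (auto simp: strict_mono_less)
  qed
  then show ?thesis
    using True sorted_enc_replicate[OF assms(1), of l "r + 1"] assms(2) by (auto simp: factor_steps_def)
next
  case False
  then show ?thesis using sorted_enc_replicate[OF assms] by (simp add: factor_steps_def)
qed

text \<open>A step \<open>True\<close> that is not the first one of the factor writes a letter
  larger than the first letter, which a decreasing word does not allow.\<close>

lemma sorted_enc_imp_factor_steps:
  assumes I: "strict_mono I" and "l \<le> r" "sorted_wrt (>) (enc I g l r w)"
  obtains x where "w = factor_steps x"
proof (cases w)
  case Nil
  then show ?thesis using that[of "(False, 0)"] by (simp add: factor_steps_def)
next
  case (Cons c w')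
  define l' r' where "l' = l - of_bool (\<not> c)" and "r' = r + of_bool c"
  obtain x where x: "enc I g l r w = x # enc I g l' r' w'" "base x < I r'"
    using I assms(2) unfolding Cons l'_def r'_def by (cases c) (auto simp: strict_mono_less)
  have "True \<notin> set w'"
  proof
    assume "True \<in> set w'"
    then obtain v v' where v: "w' = v @ True # v'" by (meson split_list)
    define y where "y = Letter (I (r' + ups v)) (l' - downs v = r' + ups v \<or> g (r' + ups v - 1))"
    have y: "y \<in> set (enc I g l' r' w')" "base y = I (r' + ups v)"
      unfolding v y_def by (auto simp: enc_append)
    have "I r' \<le> I (r' + ups v)" using I by (simp add: strict_mono_less_eq)
    then have "base x < base y" using x(2) y(2) by linarith
    then have "x < y" by (rule base_less_imp_less)
    moreover have "y < x" using assms(3) x(1) y(1) by auto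
    ultimately show False by simp
  qed
  then have "w' = replicate (length w') False"
    by (metis (full_types) replicate_length_same)
  then have "w = factor_steps (c, if c then length w' else Suc (length w'))"
    unfolding Cons factor_steps_def by auto
  then show ?thesis by (rule that)
qed

lemma sorted_encs:
  assumes "strict_mono I" "l \<le> r" "u \<in> set (encs I g l r m)"
  shows "sorted_wrt (>) u"
  using assms(2,3)
proof (induction m arbitrary: l r)
  case (Cons x m)
  have "sorted_wrt (>) (enc I g l r (factor_steps x))"
    by (rule sorted_enc_factor_steps[OF assms(1) Cons.prems(1)])
  moreover have "l - int (snd x) \<le> r + of_bool (fst x)" using Cons.prems(1) by simp
  ultimately show ?case using Cons.IH Cons.prems(2) by auto
qed simp

lemma sorted_factors_imp_encs:
  assumes "strict_mono I" "l \<le> r" "concat a = enc I g l r w" "\<forall>u\<in>set a. sorted_wrt (>) u"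
  shows "\<exists>m. a = encs I g l r m \<and> steps m = w"
  using assms(2-)
proof (induction a arbitrary: l r w)
  case Nil
  then have "length (enc I g l r w) = 0" by simp
  then have "w = []" by simp
  then show ?case by (intro exI[of _ "[]"]) simp
next
  case (Cons u a)
  obtain v w' where v: "w = v @ w'" "u = enc I g l r v"
    "concat a = enc I g (l - downs v) (r + ups v) w'"
    using enc_eq_append[of I g l r w u "concat a"] Cons.prems(2) by auto
  obtain x where x: "v = factor_steps x"
    using sorted_enc_imp_factor_steps[OF assms(1) Cons.prems(1), of g v] Cons.prems(3) v(2) by auto
  have "l - int (snd x) \<le> r + of_bool (fst x)" using Cons.prems(1) by simp
  then obtain m where m: "a = encs I g (l - int (snd x)) (r + of_bool (fst x)) m" "steps m = w'"
    using Cons.IH[of "l - int (snd x)" "r + of_bool (fst x)" w'] Cons.prems v(3) x by auto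
  show ?case using v x m by (intro exI[of _ "x # m"]) simp
qed

lemma enc_fact_in_RF_O:
  assumes "strict_mono I" "concat (enc_fact I g m) \<in> R_O z" "length m = n"
  shows "enc_fact I g m \<in> RF_O n z"
  using assms sorted_encs[OF assms(1) order_refl] by (auto simp: RF_O_def enc_fact_def)

lemma sorted_factors_imp_enc_fact:
  assumes "strict_mono I" "concat a = enc0 I g w" "\<forall>u\<in>set a. sorted_wrt (>) u"
  shows "\<exists>m. a = enc_fact I g m \<and> steps m = w"
  using sorted_factors_imp_encs[OF assms(1) order_refl assms(2)[unfolded enc0_def] assms(3)]
  by (auto simp: enc_fact_def)

lemma enc0_in_R_O:
  assumes I: "strict_mono I" and gap: "\<And>j. g j \<Longrightarrow> I j + 2 \<le> I (j + 1)"
    and "length v = length w"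
  shows "enc0 I g w \<in> R_O (inv_word (map base (enc0 I g v)))"
proof -
  have "distinct (map base (enc0 I g u))" for u
    unfolding enc0_def by (rule distinct_enc[OF I order_refl])
  moreover have "marks_ok (enc0 I g w)"
    unfolding enc0_def by (rule marks_ok_enc[OF I gap])
  moreover have "inv_word (map base (enc0 I g w)) = inv_word (map base (enc0 I g v))"
    using similar_enc0[OF I assms(3)] by (simp add: similar_def)
  ultimately show ?thesis using R_O_inv_word by blast
qed

text \<open>One inclusion holds because moves do not leave the encoded words, the other because all
  encoded words of one length are equivalent and have the same involution.\<close>

lemma RF_O_tab_eq:
  assumes I: "strict_mono I" and gap: "\<And>j. g j \<Longrightarrow> I j + 2 \<le> I (j + 1)"
    and T: "enc0 I g v \<in> R_O z"
  shows "RF_O_tab n z (enc0 I g v) = enc_fact I g ` shapes n (length v)"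
proof (intro set_eqI iffI)
  fix a assume "a \<in> RF_O_tab n z (enc0 I g v)"
  then have a: "length a = n" "\<forall>u\<in>set a. sorted_wrt (>) u" "ck_equiv (concat a) (enc0 I g v)"
    by (auto simp: RF_O_tab_def RF_O_def)
  obtain w where w: "length w = length v" "concat a = enc0 I g w" using ck_equiv_enc0[OF I a(3)] by blast
  obtain m where m: "a = enc_fact I g m" "steps m = w"
    using sorted_factors_imp_enc_fact[OF I w(2) a(2)] by blast
  show "a \<in> enc_fact I g ` shapes n (length v)"
    using m w(1) a(1) by (auto simp: shapes_def enc_fact_def)
next
  fix a assume "a \<in> enc_fact I g ` shapes n (length v)"
  then obtain m where m: "a = enc_fact I g m" "length m = n" "length (steps m) = length v"
    by (auto simp: shapes_def)
  have "z = inv_word (map base (enc0 I g v))"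
    using R_O_distinct[OF T] distinct_enc[OF I order_refl] by (simp add: enc0_def)
  then have "enc0 I g (steps m) \<in> R_O z" using enc0_in_R_O[OF I gap, of g v "steps m"] m(3) by simp
  moreover have "ck_equiv (enc0 I g (steps m)) (enc0 I g v)"
    using similar_enc0[OF I m(3)] by (simp add: similar_def)
  ultimately show "a \<in> RF_O_tab n z (enc0 I g v)"
    using m enc_fact_in_RF_O[OF I, of g m z n] by (simp add: RF_O_tab_def concat_enc_fact)
qed


subsection \<open>Involution words of a transposition\<close>

lemma base_enc0_id: "map base (enc0 (\<lambda>i. i) g (replicate k True)) = map int [1..<Suc k]"
proof -
  have "map base (enc (\<lambda>i. i) g l r (replicate k True)) = map (\<lambda>i. r + int i) [0..<k]" for l r
    by (induction k arbitrary: r) (simp_all add: upt_rec[of 0 "Suc _"] map_Suc_upt[symmetric] del: upt_Suc)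
  then show ?thesis
    by (simp add: enc0_def count_list_replicate map_Suc_upt[symmetric] del: upt_Suc)
qed

lemma inv_word_upt:
  assumes "k \<ge> 1"
  shows "inv_word (map int [1..<Suc k]) = transpose 1 (int k + 1)"
  using assms
proof (induction k rule: dec_induct)
  case base
  show ?case by (simp add: inv_word_def inv_step_id simple_def)
next
  case (step k)
  have "inv_word (map int [1..<Suc (Suc k)]) = inv_step (transpose 1 (int k + 1)) (int k + 1)"
    using step.IH inv_word_snoc[of "map int [1..<Suc k]" "int k + 1"] step.hyps(1)
    by (simp add: upt_Suc_append[of "Suc 0" "Suc k"] add.commute del: upt_Suc)
  also have "\<dots> = transpose 1 (int (Suc k) + 1)"
    using step.hyps by (auto simp: inv_step_def fun_eq_iff transpose_def simple_apply)
  finally show ?case .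
qed

lemma inv_word_enc0_id:
  assumes "length w = k" "k \<ge> 1"
  shows "inv_word (map base (enc0 (\<lambda>i. i) g w)) = transpose 1 (int k + 1)"
  using similar_enc0[of "\<lambda>i. i" w "replicate k True" g] assms inv_word_upt[OF assms(2)]
  by (simp add: similar_def base_enc0_id strict_mono_def del: upt_Suc)

text \<open>The transposition has a single cycle. The pair of the first letter \<open>x\<close> is
  carried to it, and so would be the pair of a letter \<open>y\<close> without earlier neighbours.
  Comparing the two, the letters between \<open>x\<close> and \<open>y\<close> would reverse the
  order of \<open>x\<close> and \<open>x + 1\<close>, which is impossible as \<open>x\<close> does
  not recur.\<close>

lemma transposition_word_connected:
  assumes d: "distinct (xs @ y # ys)" and "xs \<noteq> []"
    and z: "inv_word (xs @ y # ys) = transpose 1 (int k + 1)"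
  shows "y - 1 \<in> set xs \<or> y + 1 \<in> set xs"
proof (rule ccontr)
  assume "\<not> ?thesis"
  then have y: "(word_perm (rev ys) y, word_perm (rev ys) (y + 1)) \<in> Cyc (transpose 1 (int k + 1))"
    using mark_in_Cyc_iff[OF d] z by simp
  obtain x zs where xs: "xs = x # zs" using assms(2) by (cases xs) auto
  have x: "(word_perm (rev (zs @ y # ys)) x, word_perm (rev (zs @ y # ys)) (x + 1))
      \<in> Cyc (transpose 1 (int k + 1))"
    using mark_in_Cyc_iff[of "[]" x "zs @ y # ys"] d z xs by simp
  have inj: "word_perm (rev ys) p = word_perm (rev ys) q \<longleftrightarrow> p = q" for p q
    using perm_eq_iff[OF permutation_word_perm] .
  have "c \<in> Cyc (transpose 1 (int k + 1)) \<Longrightarrow> c = (1, int k + 1)" for c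
    by (auto simp: Cyc_def transpose_def split: if_splits)
  from this[OF y] this[OF x]
  have "word_perm (rev ys) (simple y (word_perm (rev zs) x)) = word_perm (rev ys) y"
    "word_perm (rev ys) (simple y (word_perm (rev zs) (x + 1))) = word_perm (rev ys) (y + 1)"
    by simp_all
  then have "simple y (word_perm (rev zs) x) = y" "simple y (word_perm (rev zs) (x + 1)) = y + 1"
    unfolding inj .
  then have P: "word_perm (rev zs) x = y + 1" "word_perm (rev zs) (x + 1) = y"
    by (auto simp: simple_apply split: if_splits)
  have "supported (word_perm (rev zs)) (set zs)" by (auto intro: supported_word_perm)
  from supportedD[OF this, of x x] supportedD[OF this, of x "x + 1"] P show False using d xs by simp
qed

lemma interval_growth_imp_enc:
  assumes "l < r" "{l..<r} = base ` set us" "distinct (map base (us @ vs))"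
    and "\<And>xs y ys. us @ vs = xs @ y # ys \<Longrightarrow> us \<noteq> [] \<Longrightarrow> length us \<le> length xs \<Longrightarrow>
      \<not> primed y \<and> (base y - 1 \<in> base ` set xs \<or> base y + 1 \<in> base ` set xs)"
  shows "\<exists>w. vs = enc (\<lambda>i. i) (\<lambda>_. False) l r w"
  using assms
proof (induction vs arbitrary: us l r)
  case Nil
  show ?case by (intro exI[of _ "[]"]) simp
next
  case (Cons y vs)
  have ne: "us \<noteq> []" using Cons.prems(1,2) by auto
  have y: "\<not> primed y" "base y - 1 \<in> {l..<r} \<or> base y + 1 \<in> {l..<r}" "base y \<notin> {l..<r}"
    using Cons.prems(4)[of us y vs] Cons.prems(2,3) ne by auto
  have next_letter: "us @ y # vs = (us @ [y]) @ vs" by simp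
  have IH: "\<exists>w. vs = enc (\<lambda>i. i) (\<lambda>_. False) l' r' w"
    if "l' < r'" "{l'..<r'} = insert (base y) {l..<r}" for l' r'
  proof (rule Cons.IH[of l' r' "us @ [y]"])
    show "{l'..<r'} = base ` set (us @ [y])" using that(2) Cons.prems(2) by simp
    show "\<not> primed x \<and> (base x - 1 \<in> base ` set xs \<or> base x + 1 \<in> base ` set xs)"
      if "(us @ [y]) @ vs = xs @ x # ys" "length (us @ [y]) \<le> length xs" for xs x ys
      using Cons.prems(4)[of xs x ys] that ne by simp
  qed (use Cons.prems(3) that(1) in auto)
  consider "base y = r" | "base y = l - 1" using y by force
  then show ?case
  proof cases
    case 1
    moreover have "{l..<r + 1} = insert r {l..<r}" using Cons.prems(1) by auto
    ultimately obtain w where "vs = enc (\<lambda>i. i) (\<lambda>_. False) l (r + 1) w" using IH[of l "r + 1"] Cons.prems(1) by auto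
    then show ?thesis using 1 y(1) Cons.prems(1) by (intro exI[of _ "True # w"]) (simp add: letter.expand)
  next
    case 2
    moreover have "{l - 1..<r} = insert (l - 1) {l..<r}" using Cons.prems(1) by auto
    ultimately obtain w where "vs = enc (\<lambda>i. i) (\<lambda>_. False) (l - 1) r w" using IH[of "l - 1" r] Cons.prems(1) by auto
    then show ?thesis using 2 y(1) Cons.prems(1) by (intro exI[of _ "False # w"]) (simp add: letter.expand)
  qed
qed

text \<open>The letters are 1, ..., k, and each one after the first has a neighbour before it. So
  the word grows an interval, and \<open>marks_ok\<close> forbids all primes but the first; hence
  the constant \<open>False\<close> for the gaps.\<close>

lemma R_O_transposition:
  assumes "k \<ge> 1" "u \<in> R_O (transpose 1 (int k + 1))"
  shows "\<exists>w. length w = k \<and> u = enc0 (\<lambda>i. i) (\<lambda>_. False) w"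
proof -
  let ?xs = "map int [1..<Suc k]"
  have d0: "distinct ?xs" by (simp add: distinct_map del: upt_Suc)
  from R_O_inv_word[OF d0, of u] have u: "distinct (map base u)"
    "inv_word (map base u) = transpose 1 (int k + 1)" "marks_ok u"
    using assms inv_word_upt[OF assms(1)] by auto
  have "set (map base u) = set ?xs"
  proof (rule set_eq_subset[THEN iffD2, OF conjI])
    show "set (map base u) \<subseteq> set ?xs"
      using supported_distinct_inv_word[OF u(1)] supported_inv_word[of ?xs "set ?xs"]
        u(2) inv_word_upt[OF assms(1)] by simp
    show "set ?xs \<subseteq> set (map base u)"
      using supported_distinct_inv_word[OF d0] supported_inv_word[of "map base u" "set (map base u)"]
        u(2) inv_word_upt[OF assms(1)] by simp
  qed
  also have "set ?xs = {1..<int k + 1}"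
    using image_int_atLeastLessThan[of 1 "Suc k"] by (simp add: add.commute del: upt_Suc)
  finally have set_u: "base ` set u = {1..<int k + 1}" by simp
  have "length u = card (base ` set u)" using distinct_card[OF u(1)] by simp
  then have len: "length u = k" using set_u by simp
  obtain x vs where xv: "u = x # vs" using len assms(1) by (cases u) auto
  obtain w where w: "vs = enc (\<lambda>i. i) (\<lambda>_. False) (base x) (base x + 1) w"
  proof -
    have "\<exists>w. vs = enc (\<lambda>i. i) (\<lambda>_. False) (base x) (base x + 1) w"
    proof (rule interval_growth_imp_enc[of _ _ "[x]"])
      fix xs y ys assume eq: "[x] @ vs = xs @ y # ys" "length [x] \<le> length xs"
      have uy: "u = xs @ y # ys" using eq(1) xv by simp
      have nb: "base y - 1 \<in> base ` set xs \<or> base y + 1 \<in> base ` set xs"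
        using transposition_word_connected[of "map base xs" "base y" "map base ys" k] u(1,2) uy eq(2)
        by (cases xs) auto
      moreover have "\<not> primed y" using u(3) uy nb unfolding marks_ok_def by blast
      ultimately show "\<not> primed y \<and> (base y - 1 \<in> base ` set xs \<or> base y + 1 \<in> base ` set xs)" by blast
    qed (use u(1) xv in auto)
    then show ?thesis using that by blast
  qed
  define c where "c = primed x"
  have set': "{1..<int k + 1} = {base x - downs w..<base x + 1 + ups w}"
  proof -
    have "base ` set u = insert (base x) (base ` set vs)" by (simp add: xv)
    also have "\<dots> = {base x - downs w..<base x + 1 + ups w}"
      unfolding w using base_enc[of "base x" "base x + 1" "\<lambda>i. i" "\<lambda>_. False" w] by auto
    finally show ?thesis using set_u by simp
  qed
  \<comment> \<open>The interval must reach down to 1, which fixes the starting point; the prime of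
    \<open>x\<close> then serves as the first step.\<close>
  then have "base x - downs w = 1" using assms(1) by (subst (asm) atLeastLessThan_eq_iff) auto
  then have "u = enc0 (\<lambda>i. i) (\<lambda>_. False) (c # w)"
    unfolding xv w enc0_def c_def by (cases x; cases "primed x") (auto simp: algebra_simps)
  then show ?thesis using len by (intro exI[of _ "c # w"]) (simp add: enc0_def)
qed

text \<open>All factorizations are covered here, so those of the transposition form one
  Coxeter-Knuth class.\<close>

lemma RF_O_transposition:
  assumes "k \<ge> 1"
  shows "RF_O n (transpose 1 (int k + 1)) = enc_fact (\<lambda>i. i) (\<lambda>_. False) ` shapes n k"
proof (intro set_eqI iffI)
  have I: "strict_mono (\<lambda>i :: int. i)" by (simp add: strict_mono_def)
  fix a assume "a \<in> RF_O n (transpose 1 (int k + 1))"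
  then have a: "length a = n" "\<forall>u\<in>set a. sorted_wrt (>) u" "concat a \<in> R_O (transpose 1 (int k + 1))"
    by (auto simp: RF_O_def)
  obtain w where w: "length w = k" "concat a = enc0 (\<lambda>i. i) (\<lambda>_. False) w"
    using R_O_transposition[OF assms a(3)] by blast
  obtain m where "a = enc_fact (\<lambda>i. i) (\<lambda>_. False) m" "steps m = w"
    using sorted_factors_imp_enc_fact[OF I w(2) a(2)] by blast
  then show "a \<in> enc_fact (\<lambda>i. i) (\<lambda>_. False) ` shapes n k"
    using w(1) a(1) by (auto simp: shapes_def enc_fact_def)
next
  have I: "strict_mono (\<lambda>i :: int. i)" by (simp add: strict_mono_def)
  fix a assume "a \<in> enc_fact (\<lambda>i. i) (\<lambda>_. False) ` shapes n k"
  then obtain m where m: "a = enc_fact (\<lambda>i. i) (\<lambda>_. False) m" "length m = n" "length (steps m) = k"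
    by (auto simp: shapes_def)
  have "enc0 (\<lambda>i. i) (\<lambda>_. False) (steps m) \<in> R_O (transpose 1 (int k + 1))"
    using enc0_in_R_O[OF I, of "\<lambda>_. False" "steps m" "steps m"] inv_word_enc0_id[OF m(3) assms] by simp
  then show "a \<in> RF_O n (transpose 1 (int k + 1))"
    using enc_fact_in_RF_O[OF I _ m(2)] m(1) by (simp add: concat_enc_fact)
qed


subsection \<open>The crystal operators on step counts\<close>

lemma decreasing_word_eq:
  assumes "sorted_wrt (>) u" "set u = A"
  shows "decreasing_word A = u"
proof -
  have "sorted_wrt (<) (rev u)" using assms(1) by (simp add: sorted_wrt_rev)
  then have "sorted_list_of_set (set (rev u)) = rev u"
    using strict_sorted_iff sorted_list_of_set.idem_if_sorted_distinct by blast
  then show ?thesis using assms(2) by (simp add: decreasing_word_def)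
qed

lemma Max_decreasing: "sorted_wrt (>) u \<Longrightarrow> u \<noteq> [] \<Longrightarrow> Max (set u) = hd (u :: letter list)"
  by (cases u) (auto intro!: Max_eqI simp: less_imp_le)

lemma Min_decreasing: "sorted_wrt (>) u \<Longrightarrow> u \<noteq> [] \<Longrightarrow> Min (set u) = last (u :: letter list)"
  by (cases u rule: rev_cases) (auto intro!: Min_eqI simp: less_imp_le sorted_wrt_append)

lemma distinct_decreasing: "sorted_wrt (>) u \<Longrightarrow> distinct (u :: letter list)"
  by (induction u) auto

lemma pair_letters_below:
  assumes "\<And>c b. c \<in> set cs \<Longrightarrow> b \<in> U \<Longrightarrow> \<not> base b < base c"
  shows "pair_letters U (cs @ ds) = pair_letters U ds"
  using assms
proof (induction cs)
  case (Cons c cs)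
  then have "{b \<in> U. base b < base c} = {}" by auto
  with Cons show ?case by (simp only: append_Cons pair_letters.simps Let_def simp_thms if_True) simp
qed simp

lemma Least_shift_eq_0: "b \<notin> B \<Longrightarrow> (LEAST q. b + int q \<notin> B) = 0" "b \<notin> B \<Longrightarrow> (LEAST q. b - int q \<notin> B) = 0"
  by (intro Least_eq_0; simp)+

lemma swap_empty: "swap_left {} = id" "swap_right {} = id"
  by (simp_all add: fun_eq_iff swap_left_def swap_right_def)

lemma shift_0: "shift x 0 = x"
  by (simp add: shift_def)

text \<open>Two consecutive factors of an encoded word. The second is \<open>t @ v\<close>: its
  optional step \<open>True\<close> writes \<open>t\<close>, above all of \<open>u\<close>, and its
  steps \<open>False\<close> write \<open>v\<close>, below all of \<open>u\<close>.\<close>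

locale separated =
  fixes u t v :: "letter list"
  assumes t: "length t \<le> 1"
    and below: "\<And>b d. b \<in> set u \<Longrightarrow> d \<in> set v \<Longrightarrow> base d < base b"
    and above: "\<And>b c. b \<in> set u \<Longrightarrow> c \<in> set t \<Longrightarrow> base b < base c"
    and su: "sorted_wrt (>) u" and sv: "sorted_wrt (>) (t @ v)"
begin

text \<open>The letters of \<open>v\<close> come first in the pairing and find nothing smaller in
  \<open>u\<close>; so at most the letter of \<open>t\<close> is paired, with the largest letter of
  \<open>u\<close>.\<close>

lemma pairing_eq:
  "pairing u (t @ v) = (if u = [] \<or> t = [] then {} else {(hd u, hd t)})"
proof -
  have "pairing u (t @ v) = pair_letters (set u) (rev t)"
    unfolding pairing_def rev_append
    by (rule pair_letters_below) (use below in fastforce)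
  also have "\<dots> = (if u = [] \<or> t = [] then {} else {(hd u, hd t)})"
  proof (cases t)
    case (Cons c t')
    then have "t = [c]" using t by simp
    moreover have "{b \<in> set u. base b < base c} = set u" using above Cons by auto
    ultimately show ?thesis using Max_decreasing[OF su] by simp
  qed simp
  finally show ?thesis .
qed

text \<open>The moved letter has a base not occurring in \<open>u\<close>, so \<open>q = 0\<close>
  and no primes are swapped. The letter of \<open>t\<close> is unpaired only if \<open>u\<close> is
  empty; otherwise the head of \<open>v\<close> moves.\<close>

lemma e_pair_eq:
  "e_pair u (t @ v) =
     (if u = [] \<and> t \<noteq> [] then Some (t, v)
      else if v \<noteq> [] then Some (u @ [hd v], t @ tl v) else None)"
proof -
  define P where "P = pairing u (t @ v)"
  have P: "P = (if u = [] \<or> t = [] then {} else {(hd u, hd t)})"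
    unfolding P_def by (rule pairing_eq)
  have dist: "distinct (t @ v)" using distinct_decreasing[OF sv] .
  have step: "e_pair u (t @ v) = Some (u', v')"
    if X: "set (t @ v) - snd ` P \<noteq> {}" "Max (set (t @ v) - snd ` P) = x"
      and x: "base x \<notin> base ` set u"
      and u': "sorted_wrt (>) u'" "set u' = insert x (set u)"
      and v': "sorted_wrt (>) v'" "set v' = set (t @ v) - {x}"
    for x u' v'
  proof -
    have S: "{(b, c) \<in> P. base c \<le> base x + int 0 \<and> base x < base c} = {}" by auto
    show ?thesis
      unfolding e_pair_def Let_def P_def[symmetric] X(2) Least_shift_eq_0(1)[OF x] S swap_empty image_id
      using X(1) decreasing_word_eq[OF u'] decreasing_word_eq[OF v'] by (simp add: shift_0)
  qed
  consider "u = []" "t \<noteq> []" | "u \<noteq> [] \<or> t = []" "v \<noteq> []" | "u \<noteq> [] \<or> t = []" "v = []" by blast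
  then show ?thesis
  proof cases
    case 1
    then obtain c where c: "t = [c]" using t by (cases t) auto
    have "e_pair u (t @ v) = Some (t, v)"
    proof (rule step[of c])
      show "Max (set (t @ v) - snd ` P) = c" using Max_decreasing[OF sv] 1 P c by simp
    qed (use 1 P c sv dist in auto)
    then show ?thesis using 1 by simp
  next
    case 2
    have X: "set (t @ v) - snd ` P = set v" using 2 P dist t by (cases t) auto
    have "e_pair u (t @ v) = Some (u @ [hd v], t @ tl v)"
    proof (rule step[of "hd v"])
      show "Max (set (t @ v) - snd ` P) = hd v" unfolding X
        by (rule Max_decreasing) (use sv 2 in \<open>auto simp: sorted_wrt_append\<close>)
      show "base (hd v) \<notin> base ` set u" using below[OF _ hd_in_set[OF 2(2)]] by force
      show "sorted_wrt (>) (u @ [hd v])"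
        using su below 2(2) by (auto simp: sorted_wrt_append intro: base_less_imp_less)
      show "sorted_wrt (>) (t @ tl v)" using sv 2(2) by (cases v) (auto simp: sorted_wrt_append)
      show "set (t @ tl v) = set (t @ v) - {hd v}" using dist 2(2) by (cases v) auto
    qed (use X 2 in auto)
    then show ?thesis using 2 by auto
  next
    case 3
    then have "set (t @ v) - snd ` P = {}" using P t by (cases t) auto
    then have "e_pair u (t @ v) = None" unfolding e_pair_def Let_def P_def[symmetric] by simp
    then show ?thesis using 3 by auto
  qed
qed

text \<open>Again \<open>q = 0\<close>. A letter in \<open>t\<close> occupies the head of
  \<open>u\<close>, so the last letter of \<open>u\<close> is free unless it is that head.\<close>

lemma f_pair_eq:
  "f_pair u (t @ v) =
     (if u = [] \<or> t \<noteq> [] \<and> tl u = [] then None else Some (butlast u, t @ last u # v))"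
proof -
  define P where "P = pairing u (t @ v)"
  have P: "P = (if u = [] \<or> t = [] then {} else {(hd u, hd t)})"
    unfolding P_def by (rule pairing_eq)
  have dist: "distinct u" using distinct_decreasing[OF su] .
  show ?thesis
  proof (cases "u = [] \<or> t \<noteq> [] \<and> tl u = []")
    case True
    then have "set u - fst ` P = {}" using P by (cases u) auto
    then have "f_pair u (t @ v) = None" unfolding f_pair_def Let_def P_def[symmetric] by simp
    then show ?thesis using True by simp
  next
    case False
    then have ne: "u \<noteq> []" by simp
    define y where "y = last u"
    have "set u - fst ` P = (if t = [] then set u else set (tl u))"
      using False P dist by (cases u) auto
    moreover have "Min (set (tl u)) = last u" if "tl u \<noteq> []"
    proof -
      have "sorted_wrt (>) (tl u)" using su by (cases u) auto
      from Min_decreasing[OF this that] show ?thesis using that by (simp add: last_tl)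
    qed
    ultimately have Y: "set u - fst ` P \<noteq> {}" "Min (set u - fst ` P) = y"
      using False Min_decreasing[OF su ne] unfolding y_def by auto
    have yu: "y \<in> set u" using ne by (simp add: y_def)
    have y: "base y \<notin> base ` set (t @ v)" using below[OF yu] above[OF yu] by force
    have S: "{(b, c) \<in> P. base b < base y \<and> base y - int 0 \<le> base b} = {}" by auto
    have "set (butlast u) = set u - {y}" "sorted_wrt (>) (butlast u)"
      using ne dist su by (cases u rule: rev_cases; auto simp: y_def sorted_wrt_append)+
    moreover have "sorted_wrt (>) (t @ y # v)"
      using sv below[OF yu] above[OF yu] by (auto simp: sorted_wrt_append intro: base_less_imp_less)
    ultimately have "f_pair u (t @ v) = Some (butlast u, t @ y # v)"
      unfolding f_pair_def Let_def P_def[symmetric] Y(2) Least_shift_eq_0(2)[OF y] S swap_empty image_id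
      using Y(1) decreasing_word_eq[of "butlast u" "set u - {y}"]
        decreasing_word_eq[of "t @ y # v" "insert y (set (t @ v))"] by (simp add: shift_0)
    then show ?thesis using False y_def by simp
  qed
qed

end

text \<open>Normally a step \<open>False\<close> passes from the second factor to the first. The
  exception is the case of an unpaired step \<open>True\<close>: the first factor is empty, and the
  step moves as a whole.\<close>

definition e_shape ::
  "bool \<times> nat \<Rightarrow> bool \<times> nat \<Rightarrow> ((bool \<times> nat) \<times> (bool \<times> nat)) option" where
  "e_shape x y =
     (if x = (False, 0) \<and> fst y then Some ((True, 0), (False, snd y))
      else if snd y > 0 then Some ((fst x, snd x + 1), (fst y, snd y - 1)) else None)"

definition f_shape ::
  "bool \<times> nat \<Rightarrow> bool \<times> nat \<Rightarrow> ((bool \<times> nat) \<times> (bool \<times> nat)) option" where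
  "f_shape x y =
     (if x = (False, 0) \<or> fst y \<and> (x = (True, 0) \<or> x = (False, 1)) then None
      else if snd x > 0 then Some ((fst x, snd x - 1), (fst y, snd y + 1))
      else Some ((False, 0), (True, snd y)))"

definition enc_pair ::
  "(int \<Rightarrow> int) \<Rightarrow> (int \<Rightarrow> bool) \<Rightarrow> int \<Rightarrow> int \<Rightarrow> (bool \<times> nat) \<times> (bool \<times> nat) \<Rightarrow> letter list \<times> letter list" where
  "enc_pair I g l r = (\<lambda>(x, y). (enc I g l r (factor_steps x),
     enc I g (l - int (snd x)) (r + of_bool (fst x)) (factor_steps y)))"

lemma enc_factor_steps:
  "enc I g l r (factor_steps (e, d)) =
     (if e then [Letter (I r) (l = r \<or> g (r - 1))] else []) @
     enc I g l (r + of_bool e) (replicate d False)"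
  by (simp add: factor_steps_def)

lemma enc_factor_steps_snoc:
  "enc I g l r (factor_steps (e, Suc d)) =
     enc I g l r (factor_steps (e, d)) @
       [Letter (I (l - int d - 1)) (l - int d \<noteq> r + of_bool e \<and> g (l - int d - 1))]"
proof -
  have "factor_steps (e, Suc d) = factor_steps (e, d) @ [False]"
    by (simp add: factor_steps_def replicate_append_same)
  then show ?thesis by (simp add: enc_append)
qed

lemma enc_eq_Nil_iff [simp]: "enc I g l r w = [] \<longleftrightarrow> w = []"
  using length_enc[of I g l r w] by (metis length_0_conv)

lemma enc_pair_separated:
  fixes x y :: "bool \<times> nat" and I :: "int \<Rightarrow> int" and g :: "int \<Rightarrow> bool"
  assumes I: "strict_mono I" and "l \<le> r"
  defines "L \<equiv> l - int (snd x)" and "R \<equiv> r + of_bool (fst x)"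
  defines "u \<equiv> enc I g l r (factor_steps x)"
    and "t \<equiv> if fst y then [Letter (I R) (L = R \<or> g (R - 1))] else []"
    and "v \<equiv> enc I g L (R + of_bool (fst y)) (replicate (snd y) False)"
  shows "enc_pair I g l r (x, y) = (u, t @ v)"
    and "separated u t v"
proof -
  have LR: "L \<le> l" "r \<le> R" "L \<le> R" "L \<le> R + of_bool (fst y)"
    using assms(2) by (auto simp: L_def R_def)
  show eq: "enc_pair I g l r (x, y) = (u, t @ v)"
    using enc_factor_steps[of I g L R "fst y" "snd y"]
    by (simp add: enc_pair_def u_def t_def v_def L_def R_def)
  have u: "base b \<in> I ` {L..<R}" if "b \<in> set u" for b
  proof -
    have "base b \<in> I ` ({l - int (snd x)..<l} \<union> {r..<r + of_bool (fst x)})"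
      using base_enc[OF assms(2), of I g "factor_steps x"] that unfolding u_def
      by (metis downs_factor_steps ups_factor_steps imageI)
    moreover have "{l - int (snd x)..<l} \<union> {r..<r + of_bool (fst x)} \<subseteq> {L..<R}"
      using assms(2) by (auto simp: L_def R_def)
    ultimately show ?thesis by blast
  qed
  have v: "base d \<in> I ` {..<L}" if "d \<in> set v" for d
  proof -
    have "base d \<in> base ` set v" using that by simp
    then show ?thesis
      unfolding v_def base_enc[OF LR(4)] by (auto simp: count_list_replicate)
  qed
  show "separated u t v"
  proof
    show "length t \<le> 1" by (simp add: t_def)
    show "\<And>b d. b \<in> set u \<Longrightarrow> d \<in> set v \<Longrightarrow> base d < base b"
      using u v I by (fastforce simp: strict_mono_less)
    show "\<And>b c. b \<in> set u \<Longrightarrow> c \<in> set t \<Longrightarrow> base b < base c"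
      using u I by (fastforce simp: strict_mono_less t_def split: if_splits)
    show "sorted_wrt (>) u"
      unfolding u_def by (rule sorted_enc_factor_steps[OF I assms(2)])
    show "sorted_wrt (>) (t @ v)"
      using sorted_enc_factor_steps[OF I LR(3), of g y] enc_factor_steps[of I g L R "fst y" "snd y"]
      by (simp add: t_def v_def)
  qed
qed

lemma e_pair_enc:
  assumes I: "strict_mono I" and lr: "l \<le> r"
  shows "case_prod e_pair (enc_pair I g l r (x, y)) = map_option (enc_pair I g l r) (e_shape x y)"
proof -
  obtain e d e' d' where xy: "x = (e, d)" "y = (e', d')" by (cases x; cases y)
  define L R where "L = l - int d" and "R = r + of_bool e"
  define u where "u = enc I g l r (factor_steps (e, d))"
  have nil: "u = [] \<longleftrightarrow> \<not> e \<and> d = 0" by (auto simp: u_def factor_steps_def)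
  note sep = enc_pair_separated[OF I lr, where x = x and y = y and g = g]
  note eq = separated.e_pair_eq[OF sep(2), unfolded xy fst_conv snd_conv,
      folded u_def L_def R_def]
  show ?thesis
  proof (cases "\<not> e \<and> d = 0 \<and> e' \<or> d' = 0")
    case True
    then show ?thesis
      unfolding sep(1) case_prod_conv unfolding xy fst_conv snd_conv
      unfolding u_def[symmetric] L_def[symmetric] R_def[symmetric] eq
      by (auto simp: nil e_shape_def enc_pair_def enc_factor_steps L_def R_def)
  next
    case False
    then obtain d'' where d'': "d' = Suc d''" by (cases d') auto
    \<comment> \<open>With a step \<open>True\<close> in the second factor, something precedes it,
      as the first factor is not empty here. So neither this letter nor the moved one is the first
      of the word, and their primes are those of the same gaps as before.\<close>
    have LR: "L \<le> R" "e' \<Longrightarrow> L < R" using False lr by (auto simp: L_def R_def)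
    have L1: "l - int (Suc d) = L - 1" by (simp add: L_def)
    have "enc_pair I g l r ((e, Suc d), (e', d'')) =
        (u @ [Letter (I (L - 1)) (L \<noteq> R \<and> g (L - 1))],
         (if e' then [Letter (I R) (L - 1 = R \<or> g (R - 1))] else []) @
           enc I g (L - 1) (R + of_bool e') (replicate d'' False))"
      unfolding enc_pair_def case_prod_conv fst_conv snd_conv enc_factor_steps_snoc u_def[symmetric]
        L1 R_def[symmetric] L_def[symmetric]
      by (simp add: enc_factor_steps[of I g "L - 1"])
    moreover have "e_shape x y = Some ((e, Suc d), (e', d''))"
      using False by (auto simp: e_shape_def xy d'')
    ultimately show ?thesis
      using False LR
      unfolding sep(1) case_prod_conv unfolding xy fst_conv snd_conv
      unfolding u_def[symmetric] L_def[symmetric] R_def[symmetric] eq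
      unfolding d'' by (auto simp: nil)
  qed
qed

lemma f_pair_enc:
  assumes I: "strict_mono I" and lr: "l \<le> r"
  shows "case_prod f_pair (enc_pair I g l r (x, y)) = map_option (enc_pair I g l r) (f_shape x y)"
proof -
  obtain e d e' d' where xy: "x = (e, d)" "y = (e', d')" by (cases x; cases y)
  define L R where "L = l - int d" and "R = r + of_bool e"
  define u where "u = enc I g l r (factor_steps (e, d))"
  have nil: "u = [] \<longleftrightarrow> \<not> e \<and> d = 0" by (auto simp: u_def factor_steps_def)
  have "length u = of_bool e + d" by (simp add: u_def length_factor_steps)
  then have single: "tl u = [] \<longleftrightarrow> of_bool e + d \<le> (1 :: nat)" by (cases u) auto
  note sep = enc_pair_separated[OF I lr, where x = x and y = y and g = g]
  note eq = separated.f_pair_eq[OF sep(2), unfolded xy fst_conv snd_conv,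
      folded u_def L_def R_def]
  show ?thesis
  proof (cases "d = 0 \<or> e' \<and> of_bool e + d \<le> (1 :: nat)")
    case True
    then show ?thesis
      unfolding sep(1) case_prod_conv unfolding xy fst_conv snd_conv
      unfolding u_def[symmetric] L_def[symmetric] R_def[symmetric] eq
      by (cases e) (auto simp: nil single f_shape_def enc_pair_def enc_factor_steps L_def R_def u_def
        split: if_splits)
  next
    case False
    then obtain d1 where d1: "d = Suc d1" by (cases d) auto
    \<comment> \<open>If the second factor has a step \<open>True\<close>, the first factor keeps at
      least one letter after the move, so the letter of this step does not become the first of the
      word.\<close>
    have LR: "L < R" "e' \<Longrightarrow> L + 1 < R" using False lr by (auto simp: L_def R_def d1 split: if_splits)
    have L1: "l - int d1 = L + 1" by (simp add: L_def d1)
    have "u = enc I g l r (factor_steps (e, d1)) @ [Letter (I L) (L + 1 \<noteq> R \<and> g L)]"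
      unfolding u_def d1 enc_factor_steps_snoc L1 R_def by simp
    then have u: "butlast u = enc I g l r (factor_steps (e, d1))"
      "last u = Letter (I L) (L + 1 \<noteq> R \<and> g L)" by simp_all
    have "enc_pair I g l r ((e, d1), (e', Suc d')) =
        (butlast u, (if e' then [Letter (I R) (L + 1 = R \<or> g (R - 1))] else []) @
           Letter (I L) (L + 1 \<noteq> R + of_bool e' \<and> g L) #
           enc I g L (R + of_bool e') (replicate d' False))"
      unfolding enc_pair_def case_prod_conv fst_conv snd_conv L1 R_def[symmetric]
      by (simp add: u(1) enc_factor_steps[of I g "L + 1"])
    moreover have "f_shape x y = Some ((e, d1), (e', Suc d'))"
      using False by (auto simp: f_shape_def xy d1)
    ultimately show ?thesis
      using False LR
      unfolding sep(1) case_prod_conv unfolding xy fst_conv snd_conv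
      unfolding u_def[symmetric] L_def[symmetric] R_def[symmetric] eq
      by (auto simp: nil single u)
  qed
qed

definition on_shapes ::
  "(bool \<times> nat \<Rightarrow> bool \<times> nat \<Rightarrow> ((bool \<times> nat) \<times> (bool \<times> nat)) option) \<Rightarrow>
   nat \<Rightarrow> (bool \<times> nat) list \<Rightarrow> (bool \<times> nat) list option" where
  "on_shapes h i m =
     (if 1 \<le> i \<and> i < length m
      then map_option (\<lambda>(x, y). m[i - 1 := x, i := y]) (h (m ! (i - 1)) (m ! i))
      else None)"

text \<open>Keeping both numbers of steps fixes the starting point and the interval reached after
  the two factors, so all other factors are written as before.\<close>

definition conserves ::
  "(bool \<times> nat \<Rightarrow> bool \<times> nat \<Rightarrow> ((bool \<times> nat) \<times> (bool \<times> nat)) option) \<Rightarrow> bool" where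
  "conserves h \<longleftrightarrow> (\<forall>x y x' y'. h x y = Some (x', y') \<longrightarrow>
     snd x' + snd y' = snd x + snd y \<and>
     of_bool (fst x') + of_bool (fst y') = (of_bool (fst x) + of_bool (fst y) :: nat))"

lemma conserves_e_shape: "conserves e_shape" and conserves_f_shape: "conserves f_shape"
  by (auto simp: conserves_def e_shape_def f_shape_def split: if_splits)

lemma nth_pair_split:
  assumes "1 \<le> i" "i < length m"
  obtains m1 x y m2 where "m = m1 @ x # y # m2" "length m1 = i - 1" "m ! (i - 1) = x" "m ! i = y"
proof -
  have "m = take (i - 1) m @ m ! (i - 1) # m ! i # drop (Suc i) m"
    using assms id_take_nth_drop[of "i - 1" m] Cons_nth_drop_Suc[of i m] by simp
  then show ?thesis using that[of "take (i - 1) m" "m ! (i - 1)" "m ! i" "drop (Suc i) m"] assms by simp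
qed

lemma update_pair:
  "length m1 = i - 1 \<Longrightarrow> 1 \<le> i \<Longrightarrow>
   (m1 @ x # y # m2)[i - 1 := x', i := y'] = m1 @ x' # y' # m2"
  by (cases i) (auto simp: list_update_append)

lemma on_factors_enc_fact:
  assumes pair: "\<And>l r x y. l \<le> r \<Longrightarrow>
      case_prod G (enc_pair I g l r (x, y)) = map_option (enc_pair I g l r) (h x y)"
    and cons: "conserves h"
  shows "on_factors G i (enc_fact I g m) = map_option (enc_fact I g) (on_shapes h i m)"
proof (cases "1 \<le> i \<and> i < length m")
  case True
  then obtain m1 x y m2 where m: "m = m1 @ x # y # m2" "length m1 = i - 1"
    and nth: "m ! (i - 1) = x" "m ! i = y"
    using nth_pair_split by metis
  define K l r where "K = 1 + downs (steps m)" and "l = K - downs (steps m1)"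
    and "r = K + ups (steps m1)"
  have lr: "l \<le> r" by (simp add: l_def r_def)
  obtain u v where uv: "enc_pair I g l r (x, y) = (u, v)" by (rule prod.exhaust)
  define rest where "rest = encs I g (l - int (snd x + snd y))
    (r + int (of_bool (fst x) + of_bool (fst y))) m2"
  have enc: "enc_fact I g (m1 @ x' # y' # m2) = encs I g K K m1 @ u' # v' # rest"
    if "enc_pair I g l r (x', y') = (u', v')" "snd x' + snd y' = snd x + snd y"
      "of_bool (fst x') + of_bool (fst y') = (of_bool (fst x) + of_bool (fst y) :: nat)"
    for x' y' u' v'
  proof -
    have K: "1 + downs (steps (m1 @ x' # y' # m2)) = K"
      using arg_cong[OF that(2), of int] by (simp add: K_def m)
    have r': "r + of_bool (fst x') + of_bool (fst y') = r + int (of_bool (fst x) + of_bool (fst y))"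
      using arg_cong[OF that(3), of int] by simp
    have l': "l - int (snd x') - int (snd y') = l - int (snd x + snd y)"
      using arg_cong[OF that(2), of int] by simp
    show ?thesis
      using that(1) unfolding enc_fact_def K encs_append l_def[symmetric] r_def[symmetric]
      by (simp add: enc_pair_def r' l' rest_def)
  qed
  have e: "enc_fact I g m = encs I g K K m1 @ u # v # rest" unfolding m(1) by (rule enc[OF uv]) simp_all
  have len: "length (encs I g K K m1) = i - 1" using m(2) by simp
  have "on_factors G i (enc_fact I g m) =
      map_option (\<lambda>(u', v'). encs I g K K m1 @ u' # v' # rest) (G u v)"
    unfolding on_factors_def e update_pair[OF len conjunct1[OF True]]
    using True len by (cases i) (simp_all add: nth_append)
  also have "G u v = map_option (enc_pair I g l r) (h x y)" using pair[OF lr, of x y] uv by simp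
  also have "map_option (\<lambda>(u', v'). encs I g K K m1 @ u' # v' # rest) \<dots> =
      map_option (enc_fact I g) (on_shapes h i m)"
  proof (cases "h x y")
    case (Some xy')
    obtain x' y' where xy': "xy' = (x', y')" by (rule prod.exhaust)
    obtain u' v' where uv': "enc_pair I g l r (x', y') = (u', v')" by (rule prod.exhaust)
    have "h x y = Some (x', y')" using Some xy' by simp
    then have "enc_fact I g (m1 @ x' # y' # m2) = encs I g K K m1 @ u' # v' # rest"
      using enc[OF uv'] cons unfolding conserves_def by blast
    then show ?thesis
      unfolding on_shapes_def nth using True Some xy' uv' update_pair[OF m(2) conjunct1[OF True]] m(1) by simp
  next
    case None
    then show ?thesis unfolding on_shapes_def nth by simp
  qed
  finally show ?thesis .
qed (auto simp: on_factors_def on_shapes_def enc_fact_def)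

lemma on_shapes_in_shapes:
  assumes "conserves h" "m \<in> shapes n k" "on_shapes h i m = Some m'"
  shows "m' \<in> shapes n k"
proof -
  have i: "1 \<le> i" "i < length m" using assms(3) by (auto simp: on_shapes_def split: if_splits)
  then obtain m1 x y m2 where m: "m = m1 @ x # y # m2" "length m1 = i - 1"
    and nth: "m ! (i - 1) = x" "m ! i = y"
    using nth_pair_split by metis
  have "map_option (\<lambda>(x, y). m[i - 1 := x, i := y]) (h x y) = Some m'"
    using assms(3) i unfolding on_shapes_def nth by simp
  then obtain x' y' where "h x y = Some (x', y')" "m' = m1 @ x' # y' # m2"
    unfolding m(1) update_pair[OF m(2) i(1)] by auto
  moreover from this(1) have "snd x' + snd y' = snd x + snd y"
    "of_bool (fst x') + of_bool (fst y') = (of_bool (fst x) + of_bool (fst y) :: nat)"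
    using assms(1) unfolding conserves_def by blast+
  ultimately show ?thesis
    using assms(2) m(1) by (simp add: shapes_def length_factor_steps)
qed

lemma e_op_enc_fact:
  "strict_mono I \<Longrightarrow> e_op i (enc_fact I g m) = map_option (enc_fact I g) (on_shapes e_shape i m)"
  unfolding e_op_def by (rule on_factors_enc_fact[OF e_pair_enc conserves_e_shape])

lemma f_op_enc_fact:
  "strict_mono I \<Longrightarrow> f_op i (enc_fact I g m) = map_option (enc_fact I g) (on_shapes f_shape i m)"
  unfolding f_op_def by (rule on_factors_enc_fact[OF f_pair_enc conserves_f_shape])

section \<open>The operators that act at the start of the word\<close>

definition on_first_shapes ::
  "(bool \<times> nat \<Rightarrow> bool \<times> nat \<Rightarrow> ((bool \<times> nat) \<times> (bool \<times> nat)) option) \<Rightarrow>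
   (bool \<times> nat) list \<Rightarrow> (bool \<times> nat) list option" where
  "on_first_shapes h m =
     (case m of x # y # m' \<Rightarrow> map_option (\<lambda>(x', y'). x' # y' # m') (h x y) | _ \<Rightarrow> None)"

text \<open>Behind a nonempty first factor, the second has the larger maximum iff it starts with a
  step \<open>True\<close>. After the move this letter comes first; the exchange of primes leaves
  the first flag in its place, hence the kind of the first step, and the former first letter becomes
  a step \<open>False\<close> across the same gap.\<close>

definition e_bar1_shape ::
  "bool \<times> nat \<Rightarrow> bool \<times> nat \<Rightarrow> ((bool \<times> nat) \<times> (bool \<times> nat)) option" where
  "e_bar1_shape x y =
     (if x = (False, 0) then e_shape x y
      else if fst y then Some ((fst x, snd x + 1), (False, snd y)) else None)"

text \<open>A single letter of the first factor remains the first letter of the word and keeps its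
  kind of step. From a longer factor the maximum is moved behind letters that are all smaller, so it
  becomes a step \<open>True\<close>.\<close>

definition f_bar1_shape ::
  "bool \<times> nat \<Rightarrow> bool \<times> nat \<Rightarrow> ((bool \<times> nat) \<times> (bool \<times> nat)) option" where
  "f_bar1_shape x y =
     (if x = (False, 0) \<or> fst y then None
      else if x = (True, 0) then Some ((False, 0), (True, snd y))
      else if x = (False, 1) then Some ((False, 0), (False, snd y + 1))
      else Some ((fst x, snd x - 1), (True, snd y)))"

definition conserves_length ::
  "(bool \<times> nat \<Rightarrow> bool \<times> nat \<Rightarrow> ((bool \<times> nat) \<times> (bool \<times> nat)) option) \<Rightarrow> bool" where
  "conserves_length h \<longleftrightarrow> (\<forall>x y x' y'. h x y = Some (x', y') \<longrightarrow>
     of_bool (fst x') + snd x' + of_bool (fst y') + snd y' =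
     of_bool (fst x) + snd x + of_bool (fst y) + snd y)"

lemma conserves_length_bar1: "conserves_length e_bar1_shape" "conserves_length f_bar1_shape"
  by (auto simp: conserves_length_def e_bar1_shape_def f_bar1_shape_def e_shape_def split: if_splits)

lemma enc_replicate_False_cong:
  assumes "l < r" "l < r'"
  shows "enc I g l r (replicate d False) = enc I g l r' (replicate d False)"
  using assms by (induction d arbitrary: l) auto

text \<open>These operators may exchange a \<open>False\<close> for a \<open>True\<close>, which
  shifts the starting point to \<open>K'\<close>. As the total is kept, the interval after the two
  factors is the same. The shift is possible because nothing precedes them.\<close>

lemma on_factors_1_enc_fact:
  assumes pair: "\<And>K x y. case_prod G (enc_pair I g K K (x, y)) =
      map_option (\<lambda>xy'. let K' = K + int (snd (fst xy') + snd (snd xy')) - int (snd x + snd y)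
                        in enc_pair I g K' K' xy') (h x y)"
    and cons: "conserves_length h"
  shows "on_factors G 1 (enc_fact I g m) = map_option (enc_fact I g) (on_first_shapes h m)"
proof -
  consider "length m < 2" | x y m' where "m = x # y # m'"
    by (cases m; cases "tl m") auto
  then show ?thesis
  proof cases
    case 1
    then show ?thesis
      by (auto simp: on_factors_def enc_fact_def on_first_shapes_def split: list.splits)
  next
    case (2 x y m')
    define K where "K = 1 + downs (steps m)"
    define l r where "l = K - int (snd x + snd y)" and "r = K + int (of_bool (fst x) + of_bool (fst y))"
    obtain u v where uv: "enc_pair I g K K (x, y) = (u, v)" by (rule prod.exhaust)
    have e: "enc_fact I g m = u # v # encs I g l r m'"
    proof -
      have lr: "K - int (snd x) - int (snd y) = l" "K + of_bool (fst x) + of_bool (fst y) = r"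
        by (simp_all add: l_def r_def)
      show ?thesis
        unfolding enc_fact_def K_def[symmetric] using uv by (simp add: 2 enc_pair_def lr)
    qed
    have "on_factors G 1 (enc_fact I g m) = map_option (\<lambda>(u', v'). u' # v' # encs I g l r m') (G u v)"
      unfolding e on_factors_def by (auto split: prod.splits intro!: option.map_cong)
    also have "G u v = map_option (\<lambda>xy'. let K' = K + int (snd (fst xy') + snd (snd xy')) - int (snd x + snd y)
                        in enc_pair I g K' K' xy') (h x y)"
      using pair[of K x y] uv by simp
    also have "map_option (\<lambda>(u', v'). u' # v' # encs I g l r m') \<dots> =
        map_option (enc_fact I g) (on_first_shapes h m)"
    proof (cases "h x y")
      case None
      then show ?thesis by (simp add: on_first_shapes_def 2)
    next
      case (Some xy')
      obtain x' y' where xy': "xy' = (x', y')" by (rule prod.exhaust)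
      define K' where "K' = K + int (snd x' + snd y') - int (snd x + snd y)"
      have c: "int (of_bool (fst x') + snd x' + of_bool (fst y') + snd y') =
          int (of_bool (fst x) + snd x + of_bool (fst y) + snd y)"
        using cons Some xy' unfolding conserves_length_def by (metis (no_types))
      have K'_eq: "1 + downs (steps (x' # y' # m')) = K'"
        by (simp add: K'_def K_def 2)
      have "K' - int (snd x') - int (snd y') = l"
        "K' + of_bool (fst x') + of_bool (fst y') = r"
        using c by (simp_all add: K'_def l_def r_def)
      then have "enc_fact I g (x' # y' # m') =
          (case enc_pair I g K' K' (x', y') of (u', v') \<Rightarrow> u' # v' # encs I g l r m')"
        unfolding enc_fact_def K'_eq by (simp add: enc_pair_def)
      then show ?thesis using Some xy' by (simp add: on_first_shapes_def 2 K'_def Let_def)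
    qed
    finally show ?thesis .
  qed
qed

lemma enc_factor_steps_True_Suc:
  "enc I g (K + 1) (K + 1) (factor_steps (True, Suc d)) =
     Letter (I (K + 1)) True # Letter (I K) (g K) # enc I g K (K + 1) (replicate d False)"
  using enc_replicate_False_cong[of K "2 + K" "1 + K" I g d] by (simp add: factor_steps_def add.commute)

lemma enc_factor_steps_False_Suc:
  "enc I g (K + 1) (K + 1) (factor_steps (False, Suc d)) =
     Letter (I K) False # enc I g K (K + 1) (replicate d False)"
  by (simp add: factor_steps_def)

lemma e_bar1_pair_enc:
  assumes I: "strict_mono I"
  shows "case_prod e_bar1_pair (enc_pair I g K K (x, y)) =
      map_option (\<lambda>xy'. let K' = K + int (snd (fst xy') + snd (snd xy')) - int (snd x + snd y)
                        in enc_pair I g K' K' xy') (e_bar1_shape x y)"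
proof -
  obtain e d e' d' where xy: "x = (e, d)" "y = (e', d')" by (cases x; cases y)
  note [simp] = strict_mono_less_eq[OF I]
  have T: "enc I g K K (factor_steps (True, d)) =
      Letter (I K) True # enc I g K (K + 1) (replicate d False)" for d
    by (simp add: factor_steps_def)
  have F: "enc I g K K (factor_steps (False, Suc d)) =
      Letter (I (K - 1)) False # enc I g (K - 1) K (replicate d False)" for d
    using enc_factor_steps_False_Suc[of I g "K - 1" d] by simp
  show ?thesis
  proof (cases e)
    case True
    show ?thesis
      using True enc_replicate_False_cong[of K "2 + K" "1 + K" I g d] unfolding xy
      by (cases e'; cases d')
         (auto simp: e_bar1_shape_def enc_pair_def T enc_factor_steps_True_Suc[of I g K d]
           enc_factor_steps Let_def algebra_simps)
  next
    case False
    show ?thesis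
    proof (cases d)
      case 0
      then show ?thesis
        using False unfolding xy
        by (cases e'; cases d')
           (auto simp: e_bar1_shape_def e_shape_def enc_pair_def T F factor_steps_def Let_def algebra_simps)
    next
      case (Suc d1)
      show ?thesis
        using False Suc enc_replicate_False_cong[of "K - 1" K "K + 1" I g d1] unfolding xy
        by (cases e'; cases d')
           (auto simp: e_bar1_shape_def enc_pair_def F enc_factor_steps_False_Suc[of I g K "Suc d1"]
             enc_factor_steps Let_def algebra_simps)
    qed
  qed
qed

lemma f_bar1_pair_enc:
  assumes I: "strict_mono I"
  shows "case_prod f_bar1_pair (enc_pair I g K K (x, y)) =
      map_option (\<lambda>xy'. let K' = K + int (snd (fst xy') + snd (snd xy')) - int (snd x + snd y)
                        in enc_pair I g K' K' xy') (f_bar1_shape x y)"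
proof -
  obtain e d e' d' where xy: "x = (e, d)" "y = (e', d')" by (cases x; cases y)
  note [simp] = strict_mono_less_eq[OF I]
  have T: "enc I g K K (factor_steps (True, d)) =
      Letter (I K) True # enc I g K (K + 1) (replicate d False)" for d
    by (simp add: factor_steps_def)
  have F: "enc I g K K (factor_steps (False, Suc d)) =
      Letter (I (K - 1)) False # enc I g (K - 1) K (replicate d False)" for d
    using enc_factor_steps_False_Suc[of I g "K - 1" d] by simp
  show ?thesis
  proof (cases e)
    case True
    show ?thesis
      using True enc_replicate_False_cong[of "K - 1" K "K + 1" I g] unfolding xy
      by (cases e'; cases d'; cases d)
         (auto simp: f_bar1_shape_def enc_pair_def T F enc_factor_steps Let_def algebra_simps)
  next
    case False
    show ?thesis
      using False enc_replicate_False_cong[of "K - 2" K "K - 1" I g] unfolding xy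
      by (cases e'; cases d'; cases d; cases "d - 1")
         (auto simp: f_bar1_shape_def enc_pair_def T F enc_factor_steps Let_def algebra_simps)
  qed
qed

lemma on_first_shapes_in_shapes:
  assumes "conserves_length h" "m \<in> shapes n k" "on_first_shapes h m = Some m'"
  shows "m' \<in> shapes n k"
proof -
  obtain x y m1 where m: "m = x # y # m1"
    using assms(3) by (auto simp: on_first_shapes_def split: list.splits)
  then obtain x' y' where xy': "h x y = Some (x', y')" "m' = x' # y' # m1"
    using assms(3) by (auto simp: on_first_shapes_def)
  have "of_bool (fst x') + snd x' + of_bool (fst y') + snd y' =
     of_bool (fst x) + snd x + of_bool (fst y) + snd y"
    using assms(1) xy'(1) unfolding conserves_length_def by blast
  then show ?thesis
    using assms(2) m xy'(2) by (simp add: shapes_def length_factor_steps)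
qed

lemma e_bar1_enc_fact:
  "strict_mono I \<Longrightarrow> e_bar1 (enc_fact I g m) = map_option (enc_fact I g) (on_first_shapes e_bar1_shape m)"
  unfolding e_bar1_def by (rule on_factors_1_enc_fact[OF e_bar1_pair_enc conserves_length_bar1(1)])

lemma f_bar1_enc_fact:
  "strict_mono I \<Longrightarrow> f_bar1 (enc_fact I g m) = map_option (enc_fact I g) (on_first_shapes f_bar1_shape m)"
  unfolding f_bar1_def by (rule on_factors_1_enc_fact[OF f_bar1_pair_enc conserves_length_bar1(2)])

text \<open>The maximum of a nonempty first factor is the first letter of the word, so its prime is
  its kind of step.\<close>

fun e_prime1_shape :: "(bool \<times> nat) list \<Rightarrow> (bool \<times> nat) list option" where
  "e_prime1_shape ((True, d) # m) = Some ((False, Suc d) # m)"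
| "e_prime1_shape _ = None"

fun f_prime1_shape :: "(bool \<times> nat) list \<Rightarrow> (bool \<times> nat) list option" where
  "f_prime1_shape ((False, Suc d) # m) = Some ((True, d) # m)"
| "f_prime1_shape _ = None"

lemma enc_fact_toggle:
  obtains a u where "enc_fact I g ((True, d) # m) = (Letter a True # u) # encs I g (1 + downs (steps m)) (2 + downs (steps m) + int d) m"
    "enc_fact I g ((False, Suc d) # m) = (Letter a False # u) # encs I g (1 + downs (steps m)) (2 + downs (steps m) + int d) m"
  by (rule that) (simp_all add: enc_fact_def factor_steps_def count_list_replicate algebra_simps)

lemma e_prime1_enc_fact:
  "e_prime1 (enc_fact I g m) = map_option (enc_fact I g) (e_prime1_shape m)"
proof (cases m rule: e_prime1_shape.cases)
  case (1 d m')
  obtain a u r where "enc_fact I g ((True, d) # m') = (Letter a True # u) # r"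
    "enc_fact I g ((False, Suc d) # m') = (Letter a False # u) # r"
    using enc_fact_toggle by metis
  then show ?thesis using 1 by (simp add: toggle_def)
next
  case ("2_2" d m')
  then show ?thesis by (cases d) (simp_all add: enc_fact_def factor_steps_def)
qed (simp_all add: enc_fact_def)

lemma f_prime1_enc_fact:
  "f_prime1 (enc_fact I g m) = map_option (enc_fact I g) (f_prime1_shape m)"
proof (cases m rule: f_prime1_shape.cases)
  case (1 d m')
  obtain a u r where "enc_fact I g ((True, d) # m') = (Letter a True # u) # r"
    "enc_fact I g ((False, Suc d) # m') = (Letter a False # u) # r"
    using enc_fact_toggle by metis
  then show ?thesis using 1 by (simp add: toggle_def)
qed (simp_all add: enc_fact_def factor_steps_def)

lemma prime1_in_shapes:
  "m \<in> shapes n k \<Longrightarrow> e_prime1_shape m = Some m' \<Longrightarrow> m' \<in> shapes n k"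
  "m \<in> shapes n k \<Longrightarrow> f_prime1_shape m = Some m' \<Longrightarrow> m' \<in> shapes n k"
  by (cases m rule: e_prime1_shape.cases; auto simp: shapes_def factor_steps_def)
     (cases m rule: f_prime1_shape.cases; auto simp: shapes_def factor_steps_def)


subsection \<open>Isomorphisms between factorizations of the same shapes\<close>

lemma inj_factor_steps: "factor_steps x = factor_steps y \<Longrightarrow> x = y"
  using downs_factor_steps[of x] downs_factor_steps[of y] ups_factor_steps[of x] ups_factor_steps[of y]
  by (metis of_bool_eq_iff of_nat_eq_iff prod.expand)

lemma inj_enc:
  assumes "strict_mono I" "l \<le> r" "enc I g l r v = enc I g l r w"
  shows "v = w"
  using assms(2,3)
proof (induction v arbitrary: l r w)
  case Nil
  then show ?case by (metis enc_eq_Nil_iff enc.simps(1))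
next
  case (Cons c v)
  then obtain d w' where w: "w = d # w'" by (cases w) auto
  show ?case
    using Cons.prems Cons.IH[of l "r + 1" w'] Cons.IH[of "l - 1" r w'] unfolding w
    by (cases c; cases d) (auto simp: strict_mono_eq[OF assms(1)])
qed

lemma inj_encs:
  assumes "strict_mono I" "l \<le> r" "encs I g l r m = encs I g l r m'"
  shows "m = m'"
  using assms(2,3)
proof (induction m arbitrary: l r m')
  case Nil
  then show ?case by (cases m') auto
next
  case (Cons x m)
  then obtain y m1 where m': "m' = y # m1" by (cases m') auto
  have "enc I g l r (factor_steps x) = enc I g l r (factor_steps y)" using Cons.prems(2) m' by simp
  then have "x = y" by (rule inj_factor_steps[OF inj_enc[OF assms(1) Cons.prems(1)]])
  moreover have "l - int (snd x) \<le> r + of_bool (fst x)" using Cons.prems(1) by simp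
  ultimately show ?case using Cons.IH Cons.prems(2) m' by auto
qed

text \<open>The prime of the first letter reveals the first step, its value then reveals the
  starting point, and from there the steps can be read off one by one.\<close>

lemma inj_enc_fact:
  assumes I: "strict_mono I" and eq: "enc_fact I g m = enc_fact I g m'"
  shows "m = m'"
proof -
  have e: "enc0 I g (steps m) = enc0 I g (steps m')"
    using arg_cong[OF eq, of concat] by (simp add: concat_enc_fact)
  have "downs (steps m) = downs (steps m')"
  proof (cases "steps m")
    case Nil
    then have "length (enc0 I g (steps m')) = 0" using e by (simp add: enc0_def)
    then show ?thesis using Nil by (simp add: enc0_def)
  next
    case (Cons c w)
    then obtain d w' where "steps m' = d # w'"
      using arg_cong[OF e, of length] by (cases "steps m'") (auto simp: enc0_def)
    then show ?thesis
      using e Cons by (cases c; cases d) (auto simp: enc0_def strict_mono_eq[OF I])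
  qed
  then show ?thesis using eq inj_encs[OF I order_refl] unfolding enc_fact_def by metis
qed

definition same_shape :: "nat \<Rightarrow> nat \<Rightarrow> (int \<Rightarrow> int) \<Rightarrow> (int \<Rightarrow> bool) \<Rightarrow> (int \<Rightarrow> int) \<Rightarrow> (int \<Rightarrow> bool) \<Rightarrow>
    factorization \<Rightarrow> factorization \<Rightarrow> bool" where
  "same_shape n k I g J h a b \<longleftrightarrow> (\<exists>m\<in>shapes n k. a = enc_fact I g m \<and> b = enc_fact J h m)"

text \<open>This property passes through composition and iteration, so it has to be checked for six
  basic operators only. It concerns all of \<open>shapes\<close>: intermediate results of a
  conjugated operator need not stay in the subset to which the crystal is restricted.\<close>

definition preserves :: "('a \<Rightarrow> 'a \<Rightarrow> bool) \<Rightarrow> ('a \<Rightarrow> 'a option) \<Rightarrow> bool" where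
  "preserves R F \<longleftrightarrow> (\<forall>a b. R a b \<longrightarrow> rel_option R (F a) (F b))"

lemma preserves_None: "preserves R (\<lambda>_. None)"
  by (simp add: preserves_def)

lemma preserves_Some: "preserves R Some"
  by (simp add: preserves_def)

lemma preserves_comp: "preserves R F \<Longrightarrow> preserves R G \<Longrightarrow> preserves R (F \<odot> G)"
  unfolding preserves_def
proof (intro allI impI)
  fix a b assume F: "\<forall>a b. R a b \<longrightarrow> rel_option R (F a) (F b)"
    and G: "\<forall>a b. R a b \<longrightarrow> rel_option R (G a) (G b)" and "R a b"
  then have "rel_option R (G a) (G b)" by blast
  then show "rel_option R ((F \<odot> G) a) ((F \<odot> G) b)"
    using F by (cases rule: option.rel_cases) (auto simp: comp_op_def)
qed

lemma preserves_iterate: "preserves R F \<Longrightarrow> preserves R (iterate_op F k)"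
  unfolding iterate_op_def by (induction k) (auto intro: preserves_comp preserves_Some)

lemma preserves_shape_map:
  assumes "\<And>m. F (enc_fact I g m) = map_option (enc_fact I g) (H m)"
    and "\<And>m. F (enc_fact J h m) = map_option (enc_fact J h) (H m)"
    and "\<And>m m'. m \<in> shapes n k \<Longrightarrow> H m = Some m' \<Longrightarrow> m' \<in> shapes n k"
  shows "preserves (same_shape n k I g J h) F"
  unfolding preserves_def same_shape_def
proof (intro allI impI)
  fix a b assume "\<exists>m\<in>shapes n k. a = enc_fact I g m \<and> b = enc_fact J h m"
  then obtain m where "m \<in> shapes n k" "a = enc_fact I g m" "b = enc_fact J h m" by blast
  then show "rel_option (\<lambda>a b. \<exists>m\<in>shapes n k. a = enc_fact I g m \<and> b = enc_fact J h m) (F a) (F b)"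
    using assms by (cases "H m") auto
qed

context
  fixes n k :: nat and I J :: "int \<Rightarrow> int" and g h :: "int \<Rightarrow> bool"
  assumes I: "strict_mono I" and J: "strict_mono J"
begin

lemma preserves_basic:
  "preserves (same_shape n k I g J h) (e_op i)" "preserves (same_shape n k I g J h) (f_op i)" "preserves (same_shape n k I g J h) e_bar1" "preserves (same_shape n k I g J h) f_bar1"
  "preserves (same_shape n k I g J h) e_prime1" "preserves (same_shape n k I g J h) f_prime1"
  by (rule preserves_shape_map; fact e_op_enc_fact[OF I] e_op_enc_fact[OF J] f_op_enc_fact[OF I]
      f_op_enc_fact[OF J] e_bar1_enc_fact[OF I] e_bar1_enc_fact[OF J] f_bar1_enc_fact[OF I]
      f_bar1_enc_fact[OF J] e_prime1_enc_fact f_prime1_enc_fact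
      on_shapes_in_shapes[OF conserves_e_shape] on_shapes_in_shapes[OF conserves_f_shape]
      on_first_shapes_in_shapes[OF conserves_length_bar1(1)]
      on_first_shapes_in_shapes[OF conserves_length_bar1(2)] prime1_in_shapes)+

text \<open>The direction and the number of iterations depend on the weight, which is a function of
  the shape.\<close>

lemma preserves_sigma: "preserves (same_shape n k I g J h) (sigma i)"
  unfolding preserves_def
proof (intro allI impI)
  fix a b assume ab: "same_shape n k I g J h a b"
  then have "weight a = weight b" by (auto simp: same_shape_def weight_enc_fact)
  then show "rel_option (same_shape n k I g J h) (sigma i a) (sigma i b)"
    using preserves_iterate[OF preserves_basic(1)] preserves_iterate[OF preserves_basic(2)] ab
    unfolding sigma_def preserves_def Let_def by auto
qed

lemma preserves_sigma_w0: "preserves (same_shape n k I g J h) (sigma_w0 n')"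
proof -
  have "preserves (same_shape n k I g J h) (foldr (\<lambda>i g. sigma i \<odot> g) xs Some)" for xs
    by (induction xs) (auto intro: preserves_Some preserves_comp preserves_sigma)
  then show ?thesis by (simp add: sigma_w0_def)
qed

lemma preserves_bar_op: "preserves (same_shape n k I g J h) F \<Longrightarrow> preserves (same_shape n k I g J h) (bar_op F i)"
  by (induction i) (auto intro!: preserves_comp preserves_sigma preserves_None)

lemma preserves_prime_op: "preserves (same_shape n k I g J h) F \<Longrightarrow> preserves (same_shape n k I g J h) (prime_op F i)"
  by (induction i) (auto intro!: preserves_comp preserves_sigma preserves_None)

lemma preserves_crystal: "preserves (same_shape n k I g J h) (crystal_e n' j)" "preserves (same_shape n k I g J h) (crystal_f n' j)"
  by (cases j; auto intro!: preserves_comp preserves_bar_op preserves_prime_op preserves_sigma_w0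
      preserves_basic)+

lemma crystal_isomorphic_shapes:
  assumes "M \<subseteq> shapes n k"
  shows "crystal_isomorphic n (enc_fact I g ` M) (enc_fact J h ` M)"
proof -
  define \<phi> where "\<phi> a = enc_fact J h (THE m. a = enc_fact I g m)" for a
  have \<phi>: "\<phi> (enc_fact I g m) = enc_fact J h m" for m
    unfolding \<phi>_def using inj_enc_fact[OF I] by (metis (mono_tags, lifting) the_equality)
  have inM: "enc_fact I g m \<in> enc_fact I g ` M \<longleftrightarrow> m \<in> M" "enc_fact J h m \<in> enc_fact J h ` M \<longleftrightarrow> m \<in> M" for m
    using inj_enc_fact[OF I] inj_enc_fact[OF J] by blast+
  have op: "restrict_op (enc_fact J h ` M) F (\<phi> b) = map_option \<phi> (restrict_op (enc_fact I g ` M) F b)"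
    if F: "preserves (same_shape n k I g J h) F" and b: "b \<in> enc_fact I g ` M" for F b
  proof -
    obtain m where m: "m \<in> M" "b = enc_fact I g m" using b by blast
    then have "same_shape n k I g J h b (\<phi> b)" using assms by (auto simp: same_shape_def \<phi>)
    then have "rel_option (same_shape n k I g J h) (F b) (F (\<phi> b))" using F by (simp add: preserves_def)
    then show ?thesis
      by (cases rule: option.rel_cases)
        (auto simp: restrict_op_def same_shape_def \<phi> inM dest!: inj_enc_fact[OF I] inj_enc_fact[OF J])
  qed
  have "bij_betw \<phi> (enc_fact I g ` M) (enc_fact J h ` M)"
    unfolding bij_betw_def
    using inj_enc_fact[OF J] by (auto simp: inj_on_def \<phi> image_image)
  moreover have "weight (\<phi> b) = weight b" if "b \<in> enc_fact I g ` M" for b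
    using that by (auto simp: \<phi> weight_enc_fact)
  ultimately have "crystal_iso n (enc_fact I g ` M) (enc_fact J h ` M) \<phi>"
    unfolding crystal_iso_def using op preserves_crystal by blast
  then show ?thesis unfolding crystal_isomorphic_def by blast
qed

end


subsection \<open>Bounded factorizations\<close>

definition ups_from :: "(bool \<times> nat) list \<Rightarrow> nat \<Rightarrow> nat" where
  "ups_from m t = length (filter fst (drop t m))"

text \<open>The shapes of bounded factorizations depend only on the set \<open>A\<close> of letters in use: the
  smallest letter is reached by the last step \<open>False\<close>, and the last \<open>s\<close> steps \<open>True\<close> produce the
  \<open>s\<close> largest letters. List position \<open>t\<close> holds factor \<open>t + 1\<close>, so \<open>t\<close> is the largest value that is
  too small for its letters.\<close>

definition bounded_shapes :: "nat \<Rightarrow> nat \<Rightarrow> int set \<Rightarrow> (bool \<times> nat) list set" where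
  "bounded_shapes n k A = {m \<in> shapes n k. \<forall>t. Min A \<le> int t \<longrightarrow>
     (t < n \<longrightarrow> snd (m ! t) = 0) \<and> ups_from m t \<le> card {i \<in> A. int t < i}}"

lemma ups_steps: "ups (steps m) = int (length (filter fst m))"
  by (induction m) auto

lemma downs_steps: "downs (steps m) = int (sum_list (map snd m))"
  by (induction m) auto

lemma nth_encs:
  "j < length m \<Longrightarrow> encs I g l r m ! j =
     enc I g (l - downs (steps (take j m))) (r + ups (steps (take j m))) (factor_steps (m ! j))"
proof (induction m arbitrary: l r j)
  case (Cons x m)
  then show ?case by (cases j) (simp_all add: algebra_simps)
qed simp

text \<open>Counted from the end: the last step \<open>False\<close> writes \<open>I 1\<close> and
  the last step \<open>True\<close> writes \<open>I k\<close>, so the letters of a factor are known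
  from the numbers of steps still to come.\<close>

lemma base_nth_enc_fact:
  assumes "j < length m"
  shows "base ` set (enc_fact I g m ! j) =
    I ` ({1 + downs (steps (drop (Suc j) m))..<1 + downs (steps (drop j m))} \<union>
      (if fst (m ! j) then {1 + int (length (steps m)) - int (ups_from m j)} else {}))"
proof -
  define K l r where "K = 1 + downs (steps m)" and "l = K - downs (steps (take j m))"
    and "r = K + ups (steps (take j m))"
  have split: "steps m = steps (take j m) @ steps (drop j m)"
    using append_take_drop_id[of j m] by (metis steps_append)
  have drop: "drop j m = m ! j # drop (Suc j) m" using assms by (rule Cons_nth_drop_Suc[symmetric])
  have l: "l = 1 + downs (steps (drop j m))" by (simp add: l_def K_def split)
  have r: "r = 1 + int (length (steps m)) - int (ups_from m j)"
    using ups_steps[of "drop j m"] length_ups_downs[of "steps m"]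
    by (simp add: r_def K_def split ups_from_def)
  have ld: "l - int (snd (m ! j)) = 1 + downs (steps (drop (Suc j) m))" by (simp add: l drop)
  have "l \<le> r" by (simp add: l_def r_def)
  have "enc_fact I g m ! j = enc I g l r (factor_steps (m ! j))"
    using nth_encs[OF assms, of I g K K] by (simp add: enc_fact_def K_def l_def r_def)
  then have "base ` set (enc_fact I g m ! j) =
      I ` ({l - int (snd (m ! j))..<l} \<union> {r..<r + of_bool (fst (m ! j))})"
    using base_enc[OF \<open>l \<le> r\<close>, of I g "factor_steps (m ! j)"] by simp
  also have "{r..<r + of_bool (fst (m ! j))} = (if fst (m ! j) then {r} else {})" by auto
  finally show ?thesis unfolding ld unfolding l r .
qed

text \<open>Locates the factor that contains the smallest letter \<open>I 1\<close>.\<close>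

lemma last_down:
  fixes m :: "(bool \<times> nat) list"
  assumes "sum_list (map snd (drop j m)) > 0"
  shows "\<exists>i\<ge>j. i < length m \<and> snd (m ! i) > 0 \<and> sum_list (map snd (drop (Suc i) m)) = 0"
  using assms
proof (induction "length m - j" arbitrary: j)
  case 0
  then show ?case by simp
next
  case (Suc d)
  then have j: "j < length m" by linarith
  show ?case
  proof (cases "sum_list (map snd (drop (Suc j) m)) > 0")
    case True
    moreover have "d = length m - Suc j" using Suc.hyps(2) by simp
    ultimately show ?thesis using Suc.hyps(1)[of "Suc j"] by (meson Suc_leD)
  next
    case False
    then have "snd (m ! j) > 0" using Suc.prems Cons_nth_drop_Suc[OF j] by (metis (no_types) add_cancel_right_right gr0I list.simps(9) sum_list.Cons)
    then show ?thesis using j False by auto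
  qed
qed

text \<open>Locates the smallest letter written by the steps \<open>True\<close> from factor
  \<open>t\<close> on.\<close>

lemma first_up:
  assumes "ups_from m t > 0"
  shows "\<exists>j\<ge>t. j < length m \<and> fst (m ! j) \<and> ups_from m j = ups_from m t"
  using assms
proof (induction "length m - t" arbitrary: t)
  case 0
  then show ?case by (simp add: ups_from_def)
next
  case (Suc d)
  then have t: "t < length m" by linarith
  show ?case
  proof (cases "fst (m ! t)")
    case False
    then have "ups_from m (Suc t) = ups_from m t"
      using Cons_nth_drop_Suc[OF t] unfolding ups_from_def by (metis filter.simps(2))
    moreover have "d = length m - Suc t" using Suc.hyps(2) by simp
    ultimately obtain j where "j \<ge> Suc t" "j < length m" "fst (m ! j)" "ups_from m j = ups_from m t"
      using Suc.hyps(1)[of "Suc t"] Suc.prems by auto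
    then show ?thesis by (meson Suc_leD)
  qed (use t in auto)
qed

text \<open>Only extreme letters matter. If a step \<open>False\<close> occurs at list position
  \<open>t\<close> or later, so does the letter \<open>I 1\<close>, which must exceed its position.
  The steps \<open>True\<close> from \<open>t\<close> on write the largest letters, and the smallest
  of these exceeds \<open>t\<close> iff enough elements of the set do.\<close>

lemma bounded_enc_fact_iff:
  assumes I: "strict_mono I" and m: "m \<in> shapes n k" and k: "k \<ge> 1"
  shows "bounded_fact (enc_fact I g m) \<longleftrightarrow> m \<in> bounded_shapes n k (I ` {1..int k})"
proof -
  let ?A = "I ` {1..int k}"
  have mono: "I x < I y \<longleftrightarrow> x < y" "I x \<le> I y \<longleftrightarrow> x \<le> y" for x y
    using I by (simp_all add: strict_mono_less strict_mono_less_eq)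
  have Min: "Min ?A = I 1" by (rule Min_eqI) (use k mono in auto)
  have len: "length m = n" "length (steps m) = k" using m by (auto simp: shapes_def)
  have ups_le: "ups_from m t \<le> k" for t
  proof -
    have "length (filter fst (drop t m)) \<le> length (filter fst m)"
      by (metis append_take_drop_id filter_append le_add2 length_append)
    then show ?thesis using length_ups_downs[of "steps m"] ups_steps[of m] len(2) by (simp add: ups_from_def)
  qed
  have card: "card {i \<in> ?A. c < i} = card {x \<in> {1..int k}. c < I x}" for c
  proof -
    have "{i \<in> ?A. c < i} = I ` {x \<in> {1..int k}. c < I x}" by auto
    moreover have "inj_on I {x \<in> {1..int k}. c < I x}"
      using I strict_mono_imp_inj_on[of I] inj_on_subset by blast
    ultimately show ?thesis by (simp add: card_image)
  qed
  have bounded: "bounded_fact (enc_fact I g m) \<longleftrightarrow>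
      (\<forall>j<n. \<forall>b\<in>base ` set (enc_fact I g m ! j). int j < b)"
  proof -
    have "(\<forall>i\<in>{1..n}. P i) \<longleftrightarrow> (\<forall>j<n. P (Suc j))" for P
      by (metis Suc_le_eq atLeastAtMost_iff le_add1 plus_1_eq_Suc not0_implies_Suc not_one_le_zero)
    then show ?thesis
      unfolding bounded_fact_def using len(1) by (simp add: enc_fact_def int_one_le_iff_zero_less)
         (metis zle_add1_eq_le add.commute less_add_one zless_add1_eq add1_zle_eq)
  qed
  show ?thesis
    unfolding bounded
  proof
    assume b: "\<forall>j<n. \<forall>b\<in>base ` set (enc_fact I g m ! j). int j < b"
    have "snd (m ! t) = 0" if t: "I 1 \<le> int t" "t < n" for t
    proof (rule ccontr)
      assume "snd (m ! t) \<noteq> 0"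
      then have "sum_list (map snd (drop t m)) > 0"
        using Cons_nth_drop_Suc[of t m, symmetric] t(2) len(1) by simp
      then obtain i where i: "i \<ge> t" "i < n" "snd (m ! i) > 0" "sum_list (map snd (drop (Suc i) m)) = 0"
        using last_down len(1) by blast
      then have "sum_list (map snd (drop i m)) > 0"
        using Cons_nth_drop_Suc[of i m, symmetric] len(1) by simp
      then have "I 1 \<in> base ` set (enc_fact I g m ! i)"
        using base_nth_enc_fact[of i m I g] i(2,4) len(1) unfolding downs_steps by auto
      then have "int i < I 1" using b i(2) by blast
      then show False using t(1) i(1) by linarith
    qed
    moreover have "ups_from m t \<le> card {i \<in> ?A. int t < i}" for t
    proof (cases "ups_from m t > 0")
      case True
      then obtain j where j: "j \<ge> t" "j < n" "fst (m ! j)" "ups_from m j = ups_from m t"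
        using first_up len(1) by blast
      \<comment> \<open>The last step \<open>True\<close> writes \<open>I k\<close>, so the first of
        the remaining \<open>ups_from m t\<close> ones writes \<open>I r\<close>.\<close>
      define r where "r = 1 + int k - int (ups_from m t)"
      have "I r \<in> base ` set (enc_fact I g m ! j)"
        using base_nth_enc_fact[of j m I g] j len by (simp add: r_def)
      then have "int j < I r" using b j(2) by blast
      then have "int t < I x" if "x \<ge> r" for x
        using mono(2)[of r x] that j(1) by linarith
      then have "{r..int k} \<subseteq> {x \<in> {1..int k}. int t < I x}"
        using ups_le[of t] by (auto simp: r_def)
      then have "card {r..int k} \<le> card {x \<in> {1..int k}. int t < I x}"
        by (rule card_mono[rotated]) (auto intro: finite_subset[of _ "{1..int k}"])
      then show ?thesis unfolding card using ups_le[of t] by (simp add: r_def)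
    qed simp
    ultimately show "m \<in> bounded_shapes n k ?A"
      unfolding bounded_shapes_def Min using m by blast
  next
    assume "m \<in> bounded_shapes n k ?A"
    then have bm: "\<forall>t. I 1 \<le> int t \<longrightarrow>
        (t < n \<longrightarrow> snd (m ! t) = 0) \<and> ups_from m t \<le> card {i \<in> ?A. int t < i}"
      unfolding bounded_shapes_def Min by blast
    have m0: "snd (m ! t) = 0" if "I 1 \<le> int t" "t < n" for t using bm that by blast
    have mu: "ups_from m t \<le> card {i \<in> ?A. int t < i}" if "I 1 \<le> int t" for t using bm that by blast
    show "\<forall>j<n. \<forall>b\<in>base ` set (enc_fact I g m ! j). int j < b"
    proof (intro allI impI ballI)
      fix j b assume j: "j < n" and "b \<in> base ` set (enc_fact I g m ! j)"
      then consider x where "b = I x" "1 + downs (steps (drop (Suc j) m)) \<le> x" "x < 1 + downs (steps (drop j m))"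
        | "fst (m ! j)" "b = I (1 + int k - int (ups_from m j))"
        using base_nth_enc_fact[of j m I g] len by (auto split: if_splits)
      then show "int j < b"
      proof cases
        case 1
        then have "snd (m ! j) \<noteq> 0"
          using Cons_nth_drop_Suc[of j m, symmetric] j len(1) by auto
        then have "\<not> I 1 \<le> int j" using m0[OF _ j] by auto
        then have "int j < I 1" by simp
        also have "I 1 \<le> I x"
        proof -
          have "1 \<le> x" using 1(2) by linarith
          then show ?thesis by (simp only: mono)
        qed
        finally show ?thesis using 1 by simp
      next
        case 2
        define r where "r = 1 + int k - int (ups_from m j)"
        have pos: "ups_from m j > 0"
          using Cons_nth_drop_Suc[of j m, symmetric] j len(1) 2(1) by (simp add: ups_from_def)
        have "I 1 \<le> I r" unfolding mono using ups_le[of j] by (simp add: r_def)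
        show ?thesis
        proof (rule ccontr)
          assume "\<not> int j < b"
          then have Ir: "I r \<le> int j" using 2 by (simp add: r_def)
          have "{x \<in> {1..int k}. int j < I x} \<subseteq> {r + 1..int k}"
          proof
            fix x assume x: "x \<in> {x \<in> {1..int k}. int j < I x}"
            then have "I r < I x" using Ir by simp
            then show "x \<in> {r + 1..int k}" using x unfolding mono by simp
          qed
          then have "card {x \<in> {1..int k}. int j < I x} \<le> card {r + 1..int k}"
            by (intro card_mono) auto
          then have "ups_from m j \<le> card {r + 1..int k}"
            using mu[of j] \<open>I 1 \<le> I r\<close> Ir unfolding card by linarith
          then show False using pos by (simp add: r_def)
        qed
      qed
    qed
  qed
qed


subsection \<open>Demazure operators\<close>

lemma iterate_op_0: "iterate_op f 0 b = Some b"
  by (simp add: iterate_op_def)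

lemma iterate_op_Suc: "iterate_op f (Suc k) b = Option.bind (f b) (iterate_op f k)"
proof (induction k arbitrary: b)
  case 0
  show ?case by (simp add: iterate_op_def comp_op_def)
next
  case (Suc k)
  have "iterate_op f (Suc (Suc k)) b = Option.bind (iterate_op f (Suc k) b) f"
    by (simp add: iterate_op_def comp_op_def)
  also have "\<dots> = Option.bind (Option.bind (f b) (iterate_op f k)) f" by (simp only: Suc.IH)
  also have "\<dots> = Option.bind (f b) (iterate_op f (Suc k))"
    by (cases "f b") (simp_all add: iterate_op_def comp_op_def)
  finally show ?case .
qed

definition e_closure :: "nat \<Rightarrow> (bool \<times> nat) list set \<Rightarrow> (bool \<times> nat) list set \<Rightarrow> (bool \<times> nat) list set" where
  "e_closure i S X = {m \<in> S. \<exists>t. \<exists>m'\<in>X. iterate_op (on_shapes e_shape i) t m = Some m'}"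

lemma iterate_e_op_enc_fact:
  assumes "strict_mono I"
  shows "iterate_op (e_op i) t (enc_fact I g m) =
    map_option (enc_fact I g) (iterate_op (on_shapes e_shape i) t m)"
proof (induction t arbitrary: m)
  case 0
  show ?case by (simp add: iterate_op_0)
next
  case (Suc t)
  show ?case
    unfolding iterate_op_Suc e_op_enc_fact[OF assms]
    by (cases "on_shapes e_shape i m") (simp_all add: Suc.IH)
qed

lemma on_shapes_split:
  "length m1 = i - 1 \<Longrightarrow> 1 \<le> i \<Longrightarrow>
   on_shapes h i (m1 @ x # y # m2) = map_option (\<lambda>(x, y). m1 @ x # y # m2) (h x y)"
  by (cases i) (auto simp: on_shapes_def nth_append list_update_append split: prod.splits
    intro!: option.map_cong)

lemma ups_from_split:
  assumes "length m1 = i - 1" "1 \<le> i"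
  shows "t < i \<Longrightarrow> ups_from (m1 @ x # y # m2) t =
      ups_from m1 t + of_bool (fst x) + of_bool (fst y) + ups_from m2 0"
    and "ups_from (m1 @ x # y # m2) i = of_bool (fst y) + ups_from m2 0"
    and "t > i \<Longrightarrow> ups_from (m1 @ x # y # m2) t = ups_from m2 (t - Suc i)"
  using assms by (auto simp: ups_from_def drop_Cons' split: nat.splits)

lemma nth_split:
  assumes "length m1 = i - 1" "1 \<le> i"
  shows "t < i - 1 \<Longrightarrow> (m1 @ x # y # m2) ! t = m1 ! t"
    and "(m1 @ x # y # m2) ! (i - 1) = x" and "(m1 @ x # y # m2) ! i = y"
    and "t > i \<Longrightarrow> (m1 @ x # y # m2) ! t = m2 ! (t - Suc i)"
  using assms by (auto simp: nth_append nth_Cons')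

lemma iterate_e_shape:
  assumes "length m1 = i - 1" "1 \<le> i" "(e, d) \<noteq> (False, 0) \<or> \<not> e'"
  shows "iterate_op (on_shapes e_shape i) d' (m1 @ (e, d) # (e', d') # m2) =
    Some (m1 @ (e, d + d') # (e', 0) # m2)"
  using assms(3)
proof (induction d' arbitrary: d)
  case 0
  show ?case by (simp add: iterate_op_0)
next
  case (Suc d')
  then have "on_shapes e_shape i (m1 @ (e, d) # (e', Suc d') # m2) =
      Some (m1 @ (e, Suc d) # (e', d') # m2)"
    by (auto simp: on_shapes_split[OF assms(1,2)] e_shape_def)
  then show ?case using Suc.IH[of "Suc d"] by (simp add: iterate_op_Suc)
qed

text \<open>Used to show that a count equal to k leaves nothing for the factor on the left.\<close>

lemma all_ups_later:
  assumes "m1 @ x # y # m2 \<in> shapes n k" "length m1 = i - 1" "1 \<le> i"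
    and "ups_from (m1 @ x # y # m2) i = k"
  shows "x = (False, 0)"
proof -
  let ?m = "x # y # m2"
  have "k = length (steps (m1 @ ?m))" using assms(1) by (simp add: shapes_def)
  also have "\<dots> = length (steps m1) + of_bool (fst x) + snd x + of_bool (fst y) + snd y + length (steps m2)"
    by (simp add: length_factor_steps)
  finally have "k = \<dots>" .
  moreover have "ups_from m2 0 \<le> length (steps m2)"
    using length_ups_downs[of "steps m2"] ups_steps[of m2] by (simp add: ups_from_def)
  ultimately have "of_bool (fst x) + snd x = 0"
    using assms(4) ups_from_split(2)[OF assms(2,3), of x y m2] by linarith
  then show ?thesis by (cases x) auto
qed

lemma card_above_simple:
  assumes "finite A" "i \<in> A" "i + 1 \<notin> A"
  shows "card {j \<in> simple i ` A. c < j} = card {j \<in> A. c < j} + (if c = i then 1 else 0)"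
proof -
  have B: "simple i ` A = insert (i + 1) (A - {i})"
    using assms by (auto simp: simple_apply image_iff)
  show ?thesis
  proof (cases "c = i")
    case True
    have "{j \<in> simple i ` A. c < j} = insert (i + 1) {j \<in> A. c < j}" unfolding B using True by auto
    then show ?thesis using True assms by simp
  next
    case False
    show ?thesis
    proof (cases "c < i")
      case True
      have "{j \<in> simple i ` A. c < j} = insert (i + 1) ({j \<in> A. c < j} - {i})"
        unfolding B using True by auto
      then have "card {j \<in> simple i ` A. c < j} = Suc (card ({j \<in> A. c < j} - {i}))"
        using assms by simp
      also have "\<dots> = card {j \<in> A. c < j}"
        using assms True by (intro card_Suc_Diff1) auto
      finally show ?thesis using False by simp
    next
      case False
      then have "{j \<in> simple i ` A. c < j} = {j \<in> A. c < j}" unfolding B using \<open>c \<noteq> i\<close> by auto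
      then show ?thesis using \<open>c \<noteq> i\<close> by simp
    qed
  qed
qed

lemma Min_simple:
  assumes "finite A" "i \<in> A" "i + 1 \<notin> A"
  shows "Min (simple i ` A) = (if Min A = i then i + 1 else Min A)"
proof -
  have B: "simple i ` A = insert (i + 1) (A - {i})"
    using assms by (auto simp: simple_apply image_iff)
  have le: "Min A \<le> j" if "j \<in> A" for j using assms(1) that by simp
  have "Min A \<in> A" using assms by (intro Min_in) auto
  show ?thesis
  proof (cases "Min A = i")
    case True
    have "i + 1 \<le> j" if "j \<in> simple i ` A" for j
      using that le[of j] True unfolding B by auto
    then have "Min (simple i ` A) = i + 1" unfolding B[symmetric]
      using assms(1) B by (intro Min_eqI) auto
    then show ?thesis using True by simp
  next
    case False
    have "Min A \<le> i + 1" using le[of i] assms(2) by linarith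
    then have "Min (simple i ` A) = Min A"
      using assms le[of i] le \<open>Min A \<in> A\<close> False unfolding B by (intro Min_eqI) auto
    then show ?thesis using False by simp
  qed
qed

lemma bounded_shapesI:
  assumes "m \<in> shapes n k"
    and "\<And>t. Min A \<le> int t \<Longrightarrow> t < n \<Longrightarrow> snd (m ! t) = 0"
    and "\<And>t. Min A \<le> int t \<Longrightarrow> ups_from m t \<le> card {i \<in> A. int t < i}"
  shows "m \<in> bounded_shapes n k A"
  using assms by (simp add: bounded_shapes_def)

lemma bounded_shapesD:
  assumes "m \<in> bounded_shapes n k A"
  shows "m \<in> shapes n k"
    and "Min A \<le> int t \<Longrightarrow> t < n \<Longrightarrow> snd (m ! t) = 0"
    and "Min A \<le> int t \<Longrightarrow> ups_from m t \<le> card {i \<in> A. int t < i}"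
  using assms by (simp_all add: bounded_shapes_def)

text \<open>Only the count at \<open>t = i\<close> can change. If the minimum of \<open>A\<close> is
  \<open>i\<close>, the conditions start at \<open>i + 1\<close> and do not see the change.
  Otherwise the two factors of \<open>m'\<close> have no steps \<open>False\<close>, so a step
  \<open>True\<close> was moved; as \<open>i\<close> is not in the new set, the bounds at
  \<open>i - 1\<close> and \<open>i\<close> agree, and the first one, for \<open>m'\<close>, implies
  the second one for \<open>m\<close>.\<close>

lemma e_shape_into_bounded:
  assumes A: "finite A" "int i \<in> A" "int i + 1 \<notin> A"
    and e: "on_shapes e_shape i m = Some m'" and m: "m \<in> shapes n k"
    and m': "m' \<in> bounded_shapes n k (simple (int i) ` A)"
  shows "m \<in> bounded_shapes n k (simple (int i) ` A)"
proof -
  let ?B = "simple (int i) ` A"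
  have i: "1 \<le> i" "i < n" using e m by (auto simp: on_shapes_def shapes_def split: if_splits)
  have "i < length m" using i(2) m by (simp add: shapes_def)
  then obtain m1 x y m2 where s: "m = m1 @ x # y # m2" and l: "length m1 = i - 1"
    using nth_pair_split[OF i(1)] by metis
  obtain x' y' where xy': "e_shape x y = Some (x', y')" and s': "m' = m1 @ x' # y' # m2"
    using e on_shapes_split[OF l i(1)] s by auto
  have c: "of_bool (fst x') + of_bool (fst y') = (of_bool (fst x) + of_bool (fst y) :: nat)"
    using conserves_e_shape xy' unfolding conserves_def by blast
  have ups: "ups_from m t = ups_from m' t" if "t \<noteq> i" for t
    using that c unfolding s s' by (cases "t < i") (simp_all add: ups_from_split[OF l i(1)])
  have nth: "m ! t = m' ! t" if "t \<noteq> i" "t \<noteq> i - 1" for t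
    using that unfolding s s' by (cases "t < i - 1") (auto simp: nth_split[OF l i(1)])
  show ?thesis
  proof (cases "Min A = int i")
    case True
    then have "Min ?B = int i + 1" using Min_simple[OF A] by simp
    then have "t \<noteq> i" "t \<noteq> i - 1" if "Min ?B \<le> int t" for t using that by auto
    then show ?thesis using bounded_shapesD[OF m'] m ups nth by (intro bounded_shapesI) auto
  next
    case False
    then have Min: "Min ?B = Min A" using Min_simple[OF A] by simp
    have "Min A < int i" using A False by (metis Min_le order_le_less)
    then have lt: "Min ?B \<le> int (i - 1)" "Min ?B \<le> int i" using i Min by auto
    have "snd x' = 0" "snd y' = 0"
      using bounded_shapesD(2)[OF m' lt(1)] bounded_shapesD(2)[OF m' lt(2)] i
      unfolding s' by (simp_all add: nth_split[OF l i(1)] del: One_nat_def)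
    then have xy: "x = (False, 0)" "fst y" "snd y = 0" "x' = (True, 0)" "y' = (False, 0)"
      using xy' by (auto simp: e_shape_def split: if_splits)
    show ?thesis
    proof (rule bounded_shapesI[OF m])
      show "snd (m ! t) = 0" if "Min ?B \<le> int t" "t < n" for t
        using bounded_shapesD(2)[OF m' that] nth[of t] xy nth_split(2,3)[OF l i(1), of x y m2]
        unfolding s by (metis snd_conv)
      show "ups_from m t \<le> card {j \<in> ?B. int t < j}" if "Min ?B \<le> int t" for t
      proof (cases "t = i")
        case True
        have "ups_from m' (i - 1) = ups_from m1 (i - 1) + ups_from m i"
          unfolding s s' using i ups_from_split(1)[OF l i(1), of "i - 1"] xy
          by (simp add: ups_from_split(2)[OF l i(1)])
        moreover have "{j \<in> ?B. int (i - 1) < j} = {j \<in> ?B. int i < j}"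
        proof -
          have "int i \<notin> ?B" using A by (auto simp: simple_apply split: if_splits)
          then have "int (i - 1) < j \<longleftrightarrow> int i < j" if "j \<in> ?B" for j
            using that i by (cases "j = int i") auto
          then show ?thesis by blast
        qed
        ultimately show ?thesis using bounded_shapesD(3)[OF m' lt(1)] True by simp
      next
        case False
        then show ?thesis using bounded_shapesD(3)[OF m' that] ups by simp
      qed
    qed
  qed
qed

lemma e_closure_bounded_shapes:
  assumes A: "finite A" "int i \<in> A" "int i + 1 \<notin> A" "card A = k" and i: "1 \<le> i" "i < n"
  shows "e_closure i (shapes n k) (bounded_shapes n k A) = bounded_shapes n k (simple (int i) ` A)"
proof (intro set_eqI iffI)
  let ?B = "simple (int i) ` A"
  have card: "card {j \<in> ?B. int t < j} = card {j \<in> A. int t < j} + (if t = i then 1 else 0)" for t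
    using card_above_simple[OF A(1-3), of "int t"] by simp
  have sub: "bounded_shapes n k A \<subseteq> bounded_shapes n k ?B"
  proof
    fix m assume m: "m \<in> bounded_shapes n k A"
    have "Min A \<le> Min ?B" using Min_simple[OF A(1-3)] by simp
    then have le: "Min A \<le> int t" if "Min ?B \<le> int t" for t using that by linarith
    show "m \<in> bounded_shapes n k ?B"
    proof (rule bounded_shapesI[OF bounded_shapesD(1)[OF m]])
      show "ups_from m t \<le> card {j \<in> ?B. int t < j}" if "Min ?B \<le> int t" for t
        unfolding card using bounded_shapesD(3)[OF m le[OF that]] by simp
    qed (use bounded_shapesD(2)[OF m] le in blast)
  qed
  {
    fix m assume "m \<in> e_closure i (shapes n k) (bounded_shapes n k A)"
    then obtain t m' where "m \<in> shapes n k" "m' \<in> bounded_shapes n k A"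
      "iterate_op (on_shapes e_shape i) t m = Some m'" by (auto simp: e_closure_def)
    then show "m \<in> bounded_shapes n k ?B"
    proof (induction t arbitrary: m)
      case 0
      then show ?case using sub by (auto simp: iterate_op_0)
    next
      case (Suc t)
      then obtain m1 where m1: "on_shapes e_shape i m = Some m1"
        "iterate_op (on_shapes e_shape i) t m1 = Some m'"
        by (auto simp: iterate_op_Suc bind_eq_Some_conv)
      then have "m1 \<in> bounded_shapes n k ?B"
        using Suc on_shapes_in_shapes[OF conserves_e_shape] by blast
      then show ?case using e_shape_into_bounded[OF A(1-3) m1(1)] Suc.prems by blast
    qed
  }
  fix m assume mB: "m \<in> bounded_shapes n k ?B"
  note B = bounded_shapesD[OF mB]
  have len: "length m = n" using B(1) by (simp add: shapes_def)
  obtain m1 x y m2 where s: "m = m1 @ x # y # m2" and l: "length m1 = i - 1"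
    using nth_pair_split[of i m] i len by metis
  have ups: "ups_from (m1 @ x' # y' # m2) t = ups_from m t"
    if "t \<noteq> i" "of_bool (fst x') + of_bool (fst y') = (of_bool (fst x) + of_bool (fst y) :: nat)" for t x' y'
    using that unfolding s by (cases "t < i") (simp_all add: ups_from_split[OF l i(1)])
  have shape: "m1 @ x' # y' # m2 \<in> shapes n k"
    if "of_bool (fst x') + of_bool (fst y') = (of_bool (fst x) + of_bool (fst y) :: nat)"
      "snd x' + snd y' = snd x + snd y" for x' y'
    using that B(1) unfolding s by (simp add: shapes_def length_factor_steps)
  have nth: "(m1 @ x' # y' # m2) ! t = m ! t" if "t \<noteq> i" "t \<noteq> i - 1" for t x' y'
    using that unfolding s by (cases "t < i - 1") (auto simp: nth_split[OF l i(1)])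
  have next_iff: "int (Suc i) < j \<longleftrightarrow> int i < j" if "j \<in> A" for j
  proof -
    have "j \<noteq> int i + 1" using that A(3) by blast
    then show ?thesis by linarith
  qed
  have "\<exists>t. \<exists>m'\<in>bounded_shapes n k A. iterate_op (on_shapes e_shape i) t m = Some m'"
  proof (cases "Min A = int i")
    case False
    then have Min: "Min ?B = Min A" using Min_simple[OF A(1-3)] by simp
    have "Min A < int i" using A False by (metis Min_le order_le_less)
    then have lt: "Min A \<le> int (i - 1)" "Min A \<le> int i" "Min A \<le> int (Suc i)" using i by auto
    show ?thesis
    proof (cases "m \<in> bounded_shapes n k A")
      case True
      then show ?thesis by (intro exI[of _ 0] bexI[of _ m] iterate_op_0)
    next
      case not_A: False
      have "ups_from m t \<le> card {j \<in> A. int t < j}" if "Min A \<le> int t" "t \<noteq> i" for t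
        using B(3)[of t] that by (simp add: Min card)
      note other = this
      have "\<not> ups_from m i \<le> card {j \<in> A. int i < j}"
      proof
        assume at_i: "ups_from m i \<le> card {j \<in> A. int i < j}"
        have "m \<in> bounded_shapes n k A"
        proof (rule bounded_shapesI[OF B(1)])
          show "snd (m ! t) = 0" if "Min A \<le> int t" "t < n" for t using B(2)[of t] that Min by simp
          show "ups_from m t \<le> card {j \<in> A. int t < j}" if "Min A \<le> int t" for t
            using other[OF that] at_i by (cases "t = i") simp_all
        qed
        then show False using not_A by blast
      qed
      \<comment> \<open>The bound for \<open>A\<close> fails only at \<open>i\<close>, and there by
        one. As \<open>i + 1\<close> is not in \<open>A\<close>, the bound at \<open>i + 1\<close>
        is one less than this count, so the excess step lies in the factor at list position
        \<open>i\<close>.\<close>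
      then have upsi: "ups_from m i = card {j \<in> A. int i < j} + 1"
        using B(3)[of i] lt(2) by (simp add: Min card)
      have "{j \<in> A. int (Suc i) < j} = {j \<in> A. int i < j}"
        using next_iff by blast
      then have "ups_from m (Suc i) < ups_from m i"
        using B(3)[of "Suc i", unfolded card Min, OF lt(3)] upsi by simp
      then have y: "fst y"
        unfolding s using ups_from_split[OF l i(1)] by (cases "fst y") auto
      \<comment> \<open>The bound at \<open>i - 1\<close> equals the one at \<open>i\<close>, which
        is attained; so there is no step \<open>True\<close> at position
        \<open>i - 1\<close>.\<close>
      have "int i \<notin> ?B" using A by (auto simp: simple_apply split: if_splits)
      then have "int (i - 1) < j \<longleftrightarrow> int i < j" if "j \<in> ?B" for j
        using that i by (cases "j = int i") auto
      then have "{j \<in> ?B. int (i - 1) < j} = {j \<in> ?B. int i < j}" by blast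
      then have "ups_from m (i - 1) \<le> ups_from m i"
        using B(3)[of "i - 1"] lt(1) upsi card[of i] by (simp add: Min)
      then have x: "\<not> fst x"
        unfolding s using ups_from_split[OF l i(1)] i by (cases "fst x") auto
      have d: "snd x = 0" "snd y = 0"
        using B(2)[of "i - 1"] B(2)[of i] lt i Min unfolding s by (simp_all add: nth_split[OF l i(1)] del: One_nat_def)
      let ?m' = "m1 @ (True, 0) # (False, 0) # m2"
      have "x = (False, 0)" using x d by (cases x) simp
      then have "on_shapes e_shape i m = Some ?m'"
        unfolding s using y d by (simp add: on_shapes_split[OF l i(1)] e_shape_def)
      then have "iterate_op (on_shapes e_shape i) (Suc 0) m = Some ?m'"
        by (simp add: iterate_op_Suc iterate_op_0)
      moreover have "?m' \<in> bounded_shapes n k A"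
      proof (rule bounded_shapesI)
        show "?m' \<in> shapes n k" by (rule shape) (use x y d in auto)
        show "snd (?m' ! t) = 0" if "Min A \<le> int t" "t < n" for t
          using nth[of t] B(2)[of t] that Min nth_split(2,3)[OF l i(1)] by (metis snd_conv)
        show "ups_from ?m' t \<le> card {j \<in> A. int t < j}" if "Min A \<le> int t" for t
        proof (cases "t = i")
          case True
          have "Suc (ups_from ?m' i) = ups_from m i"
            unfolding s using y by (simp add: ups_from_split(2)[OF l i(1)])
          then show ?thesis using upsi True by simp
        next
          case False
          then show ?thesis using ups[of t "(True, 0)" "(False, 0)"] B(3)[of t] that x y by (simp add: Min card)
        qed
      qed
      ultimately show ?thesis by blast
    qed
  next
    case True
    then have Min: "Min ?B = int i + 1" using Min_simple[OF A(1-3)] by simp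
    have Ai: "card {j \<in> A. int i < j} = k - 1"
    proof -
      have "int i \<le> j" if "j \<in> A" for j using Min_le[OF A(1) that] True by simp
      then have "{j \<in> A. int i < j} = A - {int i}" by (auto simp: order_less_le)
      then show ?thesis using A by simp
    qed
    have "{j \<in> A. int (Suc i) < j} = {j \<in> A. int i < j}"
      using next_iff by blast
    then have upsSi: "ups_from m (Suc i) \<le> k - 1"
      using B(3)[of "Suc i", unfolded card Min] Ai by simp
    have kpos: "k \<ge> 1" using A by (metis card_gt_0_iff empty_iff Suc_leI One_nat_def)
    have final: "m1 @ x' # (e', 0) # m2 \<in> bounded_shapes n k A"
      if "of_bool (fst x') + of_bool e' = (of_bool (fst x) + of_bool (fst y) :: nat)"
        "snd x' = snd x + snd y" "ups_from (m1 @ x' # (e', 0) # m2) i \<le> k - 1" for x' e'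
    proof (rule bounded_shapesI)
      show "m1 @ x' # (e', 0) # m2 \<in> shapes n k" by (rule shape) (use that in auto)
      show "snd ((m1 @ x' # (e', 0) # m2) ! t) = 0" if "Min A \<le> int t" "t < n" for t
      proof (cases "t = i")
        case False
        then show ?thesis using nth[of t] B(2)[of t] that Min True i by simp
      qed (simp add: nth_split(3)[OF l i(1)])
      show "ups_from (m1 @ x' # (e', 0) # m2) t \<le> card {j \<in> A. int t < j}" if t: "Min A \<le> int t" for t
      proof (cases "t = i")
        case False
        then show ?thesis using ups[of t x' "(e', 0)"] that B(3)[of t] t Min True
          \<open>of_bool (fst x') + of_bool e' = _\<close> by (simp add: card)
      qed (use \<open>ups_from (m1 @ x' # (e', 0) # m2) i \<le> k - 1\<close> Ai in simp)
    qed
    obtain e d e' d' where xy: "x = (e, d)" "y = (e', d')" by (cases x; cases y)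
    \<comment> \<open>All steps \<open>False\<close> of the second factor are moved to the left. If
      the first factor is empty and the second has a step \<open>True\<close>, that step is moved
      before them.\<close>
    show ?thesis
    proof (cases "x = (False, 0) \<and> e'")
      case True
      then have "on_shapes e_shape i m = Some (m1 @ (True, 0) # (False, d') # m2)"
        unfolding s xy by (simp add: on_shapes_split[OF l i(1)] e_shape_def)
      then have "iterate_op (on_shapes e_shape i) (Suc d') m = Some (m1 @ (True, d') # (False, 0) # m2)"
        using iterate_e_shape[OF l i(1), of True 0 False d' m2] by (simp add: iterate_op_Suc)
      moreover have "ups_from (m1 @ (True, d') # (False, 0) # m2) i = ups_from m (Suc i)"
        unfolding s by (simp add: ups_from_split[OF l i(1)])
      then have "m1 @ (True, d') # (False, 0) # m2 \<in> bounded_shapes n k A"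
        using upsSi xy True by (intro final) auto
      ultimately show ?thesis by blast
    next
      case False
      then have "iterate_op (on_shapes e_shape i) d' m = Some (m1 @ (e, d + d') # (e', 0) # m2)"
        unfolding s xy by (intro iterate_e_shape[OF l i(1)]) (auto simp: xy)
      moreover have "m1 @ (e, d + d') # (e', 0) # m2 \<in> bounded_shapes n k A"
      proof (rule final)
        have eq: "ups_from (m1 @ (e, d + d') # (e', 0) # m2) i = ups_from m i"
          unfolding s xy by (simp add: ups_from_split(2)[OF l i(1)])
        have le: "ups_from m i \<le> Suc (ups_from m (Suc i))"
          unfolding s by (simp add: ups_from_split[OF l i(1)])
        show "ups_from (m1 @ (e, d + d') # (e', 0) # m2) i \<le> k - 1"
        proof (rule ccontr)
          assume "\<not> ?thesis"
          \<comment> \<open>A count of k leaves only steps \<open>True\<close>, all from position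
            \<open>i\<close> on, so the left factor is empty. By the case distinction there is then
            no \<open>True\<close> at \<open>i\<close>, and the bound at \<open>i + 1\<close> is
            violated.\<close>
          then have k: "ups_from m i = k" using eq le upsSi kpos by linarith
          then have "x = (False, 0)" using all_ups_later[OF _ l i(1)] B(1) unfolding s by blast
          then have "\<not> e'" using False by simp
          then have "ups_from m i = ups_from m (Suc i)"
            unfolding s xy by (simp add: ups_from_split[OF l i(1)])
          then show False using k upsSi kpos by linarith
        qed
      qed (simp_all add: xy)
      ultimately show ?thesis by blast
    qed
  qed
  then show "m \<in> e_closure i (shapes n k) (bounded_shapes n k A)"
    using B(1) by (auto simp: e_closure_def)
qed

lemma demazure_op_enc_fact:
  assumes I: "strict_mono I" and "X \<subseteq> shapes n k"
  shows "demazure_op (enc_fact I g ` shapes n k) i (enc_fact I g ` X) =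
    enc_fact I g ` e_closure i (shapes n k) X"
proof (intro set_eqI iffI)
  fix a assume "a \<in> demazure_op (enc_fact I g ` shapes n k) i (enc_fact I g ` X)"
  then obtain m t m' where m: "m \<in> shapes n k" "a = enc_fact I g m" "m' \<in> X"
    "iterate_op (e_op i) t (enc_fact I g m) = Some (enc_fact I g m')"
    by (auto simp: demazure_op_def)
  then have "iterate_op (on_shapes e_shape i) t m = Some m'"
    unfolding iterate_e_op_enc_fact[OF I] using inj_enc_fact[OF I] by auto
  then show "a \<in> enc_fact I g ` e_closure i (shapes n k) X"
    using m by (auto simp: e_closure_def)
next
  fix a assume "a \<in> enc_fact I g ` e_closure i (shapes n k) X"
  then obtain m t m' where m: "m \<in> shapes n k" "a = enc_fact I g m" "m' \<in> X"
    "iterate_op (on_shapes e_shape i) t m = Some m'"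
    by (auto simp: e_closure_def)
  then have "iterate_op (e_op i) t a = Some (enc_fact I g m')"
    by (simp add: iterate_e_op_enc_fact[OF I])
  then show "a \<in> demazure_op (enc_fact I g ` shapes n k) i (enc_fact I g ` X)"
    using m by (auto simp: demazure_op_def)
qed


subsection \<open>Hook compositions\<close>

definition hook :: "nat \<Rightarrow> int set \<Rightarrow> weak_comp" where
  "hook k A p = (if p \<in> A then if p = Min A then k else 1 else 0)"

lemma hook_nonzero: "k \<ge> 1 \<Longrightarrow> {p. hook k A p \<noteq> 0} = A"
  by (auto simp: hook_def)

lemma sum_list_unit_comp:
  assumes "distinct xs"
  shows "(\<Sum>i\<leftarrow>xs. unit_comp i p) = (if p \<in> set xs then 1 else 0)"
  using assms by (induction xs) (auto simp: unit_comp_def)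

lemma alpha_O_eq_hook:
  assumes "distinct (map base T)" "T \<noteq> []"
  shows "alpha_O T = hook (length T) (base ` set T)"
proof
  fix p
  let ?xs = "sort (map base T)"
  have "?xs \<noteq> []" using assms(2) by (metis length_0_conv length_map length_sort)
  then obtain x xs where x: "?xs = x # xs" by (cases ?xs) auto
  have "distinct (x # xs)" "sorted (x # xs)" "set (x # xs) = base ` set T"
    using assms(1) x[symmetric] by simp_all
  moreover from this have "Min (base ` set T) = x"
    by (intro Min_eqI) auto
  moreover from calculation have "(\<Sum>i\<leftarrow>xs. unit_comp i p) = (if p \<in> set xs then 1 else 0)"
    by (intro sum_list_unit_comp) simp
  ultimately show "alpha_O T p = hook (length T) (base ` set T) p"
    unfolding alpha_O_def Let_def x list.sel by (auto simp: hook_def unit_comp_def)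
qed

lemma sorted_partition_hook:
  assumes "finite A" "card A = k" "k \<ge> 1"
  shows "sorted_partition (hook k A) = hook k {1..int k}"
proof -
  let ?xs = "replicate (k - 1) 1 @ [k]"
  have ne: "A \<noteq> {}" using assms by auto
  then have MinA: "Min A \<in> A" using assms(1) by simp
  have "image_mset (hook k A) (mset_set A) =
      image_mset (hook k A) (add_mset (Min A) (mset_set (A - {Min A})))"
    using mset_set.remove[OF assms(1) MinA] by simp
  also have "\<dots> = add_mset k (image_mset (\<lambda>_. 1) (mset_set (A - {Min A})))"
    using MinA assms(1) by (auto simp: hook_def intro!: image_mset_cong)
  also have "\<dots> = mset ?xs" using assms MinA by (simp add: image_mset_const_eq)
  finally have "sorted_list_of_multiset (image_mset (hook k A) (mset_set A)) = sort ?xs"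
    by (simp only: sorted_list_of_multiset_mset)
  also have "\<dots> = ?xs" using assms(3) by (intro sorted_sort_id) (auto simp: sorted_append)
  finally have rev: "rev (sorted_list_of_multiset (image_mset (hook k A) (mset_set A))) =
      k # replicate (k - 1) 1" by simp
  have Min: "Min {1..int k} = 1" using assms(3) by (intro Min_eqI) auto
  have nth: "(k # replicate (k - 1) 1) ! nat (i - 1) = (if i = 1 then k else 1)"
    if "1 \<le> i" "i \<le> int k" for i
    using that by (auto simp: nth_Cons')
  show ?thesis
  proof
    fix i
    have "sorted_partition (hook k A) i =
        (if 1 \<le> i \<and> i \<le> int k then (k # replicate (k - 1) 1) ! nat (i - 1) else 0)"
      unfolding sorted_partition_def hook_nonzero[OF assms(3)] rev Let_def using assms(3) by simp
    then show "sorted_partition (hook k A) i = hook k {1..int k} i"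
      using nth[of i] by (simp add: hook_def Min)
  qed
qed

text \<open>At the first difference, a smaller value \<open>w i\<close> would stand further right in
  \<open>w'\<close>, which puts \<open>(i, w i)\<close> into \<open>rothe w'\<close>; but this cell
  is never in \<open>rothe w\<close>.\<close>

lemma rothe_agree:
  assumes w: "permutation w" and w': "permutation w'" and eq: "rothe w = rothe w'"
    and below: "\<And>j. j < i \<Longrightarrow> w j = w' j"
  shows "w' i \<le> w i"
proof (rule ccontr)
  assume less: "\<not> w' i \<le> w i"
  obtain j where j: "w' j = w i" using w' by (metis bij_pointE permutation_bijective)
  then have "j \<noteq> i" using less by auto
  moreover have "\<not> j < i" using below[of j] j perm_eq_iff[OF w, of j i] by auto
  ultimately have "(i, w i) \<in> rothe w'" using j less by (auto simp: rothe_def not_less intro!: exI[of _ j])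
  then have "(i, w i) \<in> rothe w" using eq by simp
  then show False by (auto simp: rothe_def perm_eq_iff[OF w])
qed

lemma rothe_inj:
  assumes w: "w \<in> S_inf" and w': "w' \<in> S_inf" and eq: "rothe w = rothe w'"
  shows "w = w'"
proof -
  have perm: "permutation w" "permutation w'" and fixed: "\<And>p. p \<le> 0 \<Longrightarrow> w p = w' p"
    using w w' by (auto simp: S_inf_iff)
  have "\<forall>i\<le>int N. w i = w' i" for N :: nat
  proof (induction N)
    case (Suc N)
    then have "w j = w' j" if "j < int (Suc N)" for j using that by simp
    then have "w (int (Suc N)) = w' (int (Suc N))"
      using rothe_agree[OF perm eq, of "int (Suc N)"] rothe_agree[OF perm(2,1) eq[symmetric], of "int (Suc N)"]
      by force
    with Suc show ?case by (metis le_less int_Suc zle_add1_eq_le add.commute of_nat_Suc order_le_less)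
  qed (use fixed in auto)
  then show ?thesis
    by (intro ext) (metis nat_le_iff order_refl)
qed

lemma dominant_perm_hook:
  assumes "k \<ge> 1"
  shows "dominant_perm (hook k {1..int k}) = transpose 1 (int k + 1)"
  unfolding dominant_perm_def
proof (rule the_equality)
  let ?w = "transpose 1 (int k + 1)"
  have S: "?w \<in> S_inf" unfolding S_inf_iff using permutation_swap_id by (auto simp: transpose_def)
  have Min: "Min {1..int k} = 1" using assms by (intro Min_eqI) auto
  have "rothe ?w = {(i, j). 1 \<le> i \<and> 1 \<le> j \<and> j \<le> int (hook k {1..int k} i)}" (is "_ = ?R")
  proof (intro set_eqI iffI)
    fix x assume "x \<in> rothe ?w"
    then show "x \<in> ?R"
      unfolding rothe_def hook_def Min by (auto simp: transpose_def split: if_splits)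
  next
    fix x assume "x \<in> ?R"
    then obtain i j where x: "x = (i, j)" "1 \<le> i" "1 \<le> j" "j \<le> int (hook k {1..int k} i)" by auto
    then have "i = 1 \<and> j \<le> int k \<or> 1 < i \<and> i \<le> int k \<and> j = 1"
      unfolding hook_def Min by (auto split: if_splits)
    then show "x \<in> rothe ?w"
    proof
      assume "i = 1 \<and> j \<le> int k"
      \<comment> \<open>In the first row, column 1 comes from position \<open>k + 1\<close> and
        every other column \<open>j\<close> from position \<open>j\<close>.\<close>
      then show ?thesis
        unfolding rothe_def using x by (cases "j = 1")
          (auto simp: transpose_def intro: exI[of _ "int k + 1"] exI[of _ j])
    next
      assume "1 < i \<and> i \<le> int k \<and> j = 1"
      then show ?thesis
        unfolding rothe_def using x by (auto simp: transpose_def intro!: exI[of _ "int k + 1"])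
    qed
  qed
  with S show "?w \<in> S_inf \<and> rothe ?w = ?R" by blast
  then show "w = ?w" if "w \<in> S_inf \<and> rothe w = ?R" for w
    using that rothe_inj[of w ?w] by simp
qed


subsection \<open>Words raising a set of positions\<close>

lemma sum_simple_image:
  assumes "finite S"
  shows "\<Sum>(simple i ` S) =
    \<Sum>S + (if i \<in> S \<and> i + 1 \<notin> S then 1 else if i + 1 \<in> S \<and> i \<notin> S then - 1 else 0)"
proof -
  have "\<Sum>(simple i ` S) = (\<Sum>p\<in>S. simple i p)"
    using sum.reindex[OF inj_on_subset[OF inj_simple[of i] subset_UNIV, of S], of "\<lambda>p. p"]
    by (simp add: comp_def)
  also have "\<dots> = (\<Sum>p\<in>S. p + (if p = i then 1 else 0) - (if p = i + 1 then 1 else 0))"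
    by (rule sum.cong) (auto simp: simple_apply)
  also have "\<dots> = \<Sum>S + (if i \<in> S then 1 else 0) - (if i + 1 \<in> S then 1 else 0)"
    using assms by (simp add: sum.distrib sum_subtractf)
  finally show ?thesis by auto
qed

lemma sum_word_perm_image_le:
  assumes "finite S" shows "\<Sum>(word_perm xs ` S) \<le> \<Sum>S + int (length xs)"
proof (induction xs)
  case (Cons i xs)
  have "word_perm (i # xs) ` S = simple i ` word_perm xs ` S" by (simp add: image_comp)
  then show ?case using Cons sum_simple_image[of "word_perm xs ` S" i] assms by (auto split: if_splits)
qed simp

text \<open>Equality in \<open>sum_word_perm_image_le\<close>: each letter, read from the right,
  moves one element of the set up by one.\<close>

definition raises :: "int list \<Rightarrow> int set \<Rightarrow> bool" where
  "raises xs S \<longleftrightarrow> \<Sum>(word_perm xs ` S) = \<Sum>S + int (length xs)"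

lemma raises_Cons:
  assumes "finite S" "raises (i # xs) S"
  shows "raises xs S" "i \<in> word_perm xs ` S" "i + 1 \<notin> word_perm xs ` S"
proof -
  have "word_perm (i # xs) ` S = simple i ` word_perm xs ` S" by (simp add: image_comp)
  then have "\<Sum>(simple i ` word_perm xs ` S) = \<Sum>S + int (length xs) + 1"
    using assms(2) by (simp add: raises_def)
  then have "raises xs S \<and> i \<in> word_perm xs ` S \<and> i + 1 \<notin> word_perm xs ` S"
    using sum_simple_image[of "word_perm xs ` S" i] sum_word_perm_image_le[OF assms(1), of xs] assms(1)
    unfolding raises_def by (auto split: if_splits)
  then show "raises xs S" "i \<in> word_perm xs ` S" "i + 1 \<notin> word_perm xs ` S" by auto
qed

text \<open>Each letter exchanges the image of an element of \<open>S\<close> with that of an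
  element outside, so no two elements on the same side ever change their order.\<close>

lemma raises_strict_mono_on:
  assumes "finite S" "raises xs S"
  shows "strict_mono_on S (word_perm xs)" "strict_mono_on (- S) (word_perm xs)"
proof -
  have "p < q \<Longrightarrow> (p \<in> S \<longleftrightarrow> q \<in> S) \<Longrightarrow> word_perm xs p < word_perm xs q" for p q
    using assms(2)
  proof (induction xs)
    case (Cons i xs)
    note r = raises_Cons[OF assms(1) Cons.prems(3)]
    have lt: "word_perm xs p < word_perm xs q" using Cons r(1) by blast
    have "word_perm xs p \<in> word_perm xs ` S \<longleftrightarrow> p \<in> S" for p
      by (rule inj_image_mem_iff[OF bij_is_inj[OF bij_word_perm]])
    then have "\<not> (word_perm xs p = i \<and> word_perm xs q = i + 1)"
      using Cons.prems(2) r(2,3) by metis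
    then show ?case using lt by (auto simp: simple_apply)
  qed simp
  then show "strict_mono_on S (word_perm xs)" "strict_mono_on (- S) (word_perm xs)"
    by (auto simp: strict_mono_on_def)
qed

lemma permutation_strict_mono_fixed:
  fixes f :: "int \<Rightarrow> int"
  assumes f: "permutation f" and mono: "strict_mono_on X f" and X: "\<And>p. f p \<in> X \<longleftrightarrow> p \<in> X"
    and "p \<in> X"
  shows "f p = p"
proof (rule ccontr)
  assume "f p \<noteq> p"
  let ?M = "{x \<in> X. f x \<noteq> x}"
  have "finite {x. f x \<noteq> x}" using f by (simp add: permutation)
  then have fin: "finite ?M" by (rule rev_finite_subset) auto
  have ne: "?M \<noteq> {}" using \<open>p \<in> X\<close> \<open>f p \<noteq> p\<close> by blast
  define x where "x = Max ?M"
  have x: "x \<in> X" "f x \<noteq> x" using Max_in[OF fin ne] unfolding x_def by auto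
  have larger: "f y = y" if "y \<in> X" "y > x" for y
    using Max_ge[OF fin, of y] that unfolding x_def by force
  obtain y where y: "f y = x" using f by (metis bij_pointE permutation_bijective)
  have yX: "y \<in> X" using X[of y] y x(1) by simp
  show False
  proof (cases "f x > x")
    case True
    then have "f (f x) = f x" using larger X x(1) by blast
    then show False using perm_eq_iff[OF f] x(2) by blast
  next
    case False
    then have "f x < f y" using x(2) y by simp
    then have "x < y" using mono x(1) yX y x(2)
      by (metis linorder_neqE_linordered_idom not_less_iff_gr_or_eq strict_mono_onD)
    then have "f y = y" using larger yX by blast
    then show False using y \<open>x < y\<close> by simp
  qed
qed

text \<open>One product followed by the inverse of the other maps \<open>S\<close> to itself and is
  increasing on \<open>S\<close> and on its complement, so it is the identity.\<close>

lemma raises_unique: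
  assumes S: "finite S" and xs: "raises xs S" and ys: "raises ys S"
    and eq: "word_perm xs ` S = word_perm ys ` S"
  shows "word_perm xs = word_perm ys"
proof -
  define f where "f = word_perm (rev ys) \<circ> word_perm xs"
  have f: "permutation f" unfolding f_def by (intro permutation_compose permutation_word_perm)
  have vf: "word_perm ys (f p) = word_perm xs p" for p
    using word_perm_rev_comp[of "rev ys"] by (simp add: f_def fun_eq_iff)
  have mem: "word_perm zs p \<in> word_perm zs ` S \<longleftrightarrow> p \<in> S" for zs p
    by (rule inj_image_mem_iff[OF bij_is_inj[OF bij_word_perm]])
  have fS: "f p \<in> S \<longleftrightarrow> p \<in> S" for p
    using mem[of ys "f p"] mem[of xs p] vf[of p] eq by simp
  have mono: "strict_mono_on X f"
    if "strict_mono_on X (word_perm xs)" "strict_mono_on X (word_perm ys)" "\<And>p. p \<in> X \<Longrightarrow> f p \<in> X" for X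
  proof (rule strict_mono_onI)
    fix p q assume pq: "p \<in> X" "q \<in> X" "p < q"
    then have "word_perm ys (f p) < word_perm ys (f q)"
      using that(1) vf by (simp add: strict_mono_onD)
    then show "f p < f q"
      using that(2) that(3)[OF pq(1)] that(3)[OF pq(2)]
      by (metis linorder_neqE not_less_iff_gr_or_eq strict_mono_onD)
  qed
  have "f p = p" for p
  proof (cases "p \<in> S")
    case True
    show ?thesis
      by (rule permutation_strict_mono_fixed[OF f _ fS True])
         (intro mono raises_strict_mono_on S xs ys, simp add: fS)
  next
    case False
    have "f p \<in> - S \<longleftrightarrow> p \<in> - S" for p using fS by simp
    from permutation_strict_mono_fixed[OF f _ this] show ?thesis
      using False mono[OF raises_strict_mono_on(2)[OF S xs] raises_strict_mono_on(2)[OF S ys]] fS by simp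
  qed
  then show ?thesis using vf by (metis ext)
qed

lemma act_compose: "bij u \<Longrightarrow> bij v \<Longrightarrow> act (u \<circ> v) \<alpha> = act u (act v \<alpha>)"
  by (simp add: act_def o_inv_distrib comp_assoc)

lemma act_nonzero:
  assumes "bij u" shows "{p. act u \<alpha> p \<noteq> 0} = u ` {p. \<alpha> p \<noteq> 0}"
proof -
  have "inv u (u q) = q" "u (inv u q) = q" for q
    using assms by (simp_all add: bij_is_inj bij_is_surj surj_f_inv_f)
  then show ?thesis unfolding act_def by (auto simp: image_iff) metis
qed

text \<open>\<open>simple i\<close> keeps the order of the elements of \<open>A\<close>, as
  \<open>i + 1\<close> is not among them; so the position of the entry \<open>k\<close> remains the
  smallest.\<close>

lemma act_simple_hook:
  assumes "finite A" "i \<in> A" "i + 1 \<notin> A"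
  shows "act (simple i) (hook k A) = hook k (simple i ` A)"
proof
  fix p
  have inv: "inv (simple i) = simple i" by (rule inv_unique_comp) simp_all
  have "Min A \<in> A" using assms by (intro Min_in) auto
  then have "Min A \<noteq> i + 1" using assms(3) by metis
  then have "simple i p = Min A \<longleftrightarrow> p = Min (simple i ` A)"
    unfolding Min_simple[OF assms] by (auto simp: simple_apply)
  moreover have "simple i p \<in> A \<longleftrightarrow> p \<in> simple i ` A" by (metis image_iff simple_invol)
  ultimately show "act (simple i) (hook k A) p = hook k (simple i ` A) p"
    by (simp add: act_def inv hook_def)
qed

lemma initial_segment:
  assumes "finite A" "A \<subseteq> {1..}" "card A = k" "\<And>i. 1 \<le> i \<Longrightarrow> i + 1 \<in> A \<Longrightarrow> i \<in> A"
  shows "A = {1..int k}"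
proof (cases "A = {}")
  case False
  have down: "1 \<le> i \<Longrightarrow> i \<in> A" if "i \<le> j" "j \<in> A" for i j :: int
    using that(1)
  proof (induction i rule: int_le_induct)
    case base
    show ?case by (rule that(2))
  next
    case (step i)
    then show ?case using assms(4)[of "i - 1"] by simp
  qed
  define M where "M = Max A"
  have "M \<in> A" using False assms(1) by (simp add: M_def)
  then have M: "M \<in> A" "M \<ge> 1" using assms(2) by auto
  have A: "A = {1..M}"
    using assms(1,2) down[OF _ M(1)] by (auto simp: M_def intro: Max_ge)
  have "k = nat M" using assms(3) unfolding A by simp
  then show ?thesis using A M(2) by simp
qed (use assms(3) in simp)

text \<open>Built from the end: a set other than the initial segment has some \<open>i + 1\<close>
  in it with \<open>i\<close> outside, and lowering this element reduces the sum by one.\<close>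

lemma raising_word_exists:
  assumes "finite A" "A \<subseteq> {1..}" "card A = k"
  shows "\<exists>xs. act (word_perm xs) (hook k {1..int k}) = hook k A \<and> set xs \<subseteq> {1..} \<and>
    \<Sum>A = \<Sum>{1..int k} + int (length xs)"
  using assms
proof (induction "nat (\<Sum>A)" arbitrary: A rule: less_induct)
  case less
  show ?case
  proof (cases "A = {1..int k}")
    case True
    then show ?thesis by (intro exI[of _ "[]"]) (simp add: act_def)
  next
    case False
    then obtain i where i: "1 \<le> i" "i + 1 \<in> A" "i \<notin> A"
      using initial_segment[OF less.prems] by blast
    define A' where "A' = simple i ` A"
    have A: "A = simple i ` A'" by (simp add: A'_def image_image)
    have A': "i \<in> A'" "i + 1 \<notin> A'" "finite A'" "A' \<subseteq> {1..}"
      using i less.prems by (auto simp: A'_def simple_apply image_iff split: if_splits)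
    have card: "card A' = k"
      using card_image[OF inj_on_subset[OF inj_simple[of i] subset_UNIV], of A] less.prems(3)
      by (simp add: A'_def)
    have sum: "\<Sum>A' = \<Sum>A - 1"
      using sum_simple_image[OF less.prems(1), of i] i by (simp add: A'_def)
    have "\<Sum>A' \<ge> 0" using A'(4) by (intro sum_nonneg) auto
    then have "nat (\<Sum>A') < nat (\<Sum>A)" using sum by simp
    from less.hyps[OF this A'(3,4) card] obtain xs where
      xs: "act (word_perm xs) (hook k {1..int k}) = hook k A'" "set xs \<subseteq> {1..}"
        "\<Sum>A' = \<Sum>{1..int k} + int (length xs)" by blast
    have "act (word_perm (i # xs)) (hook k {1..int k}) = hook k A"
      unfolding word_perm_Cons act_compose[OF bij_simple bij_word_perm] xs(1)
      using act_simple_hook[OF A'(3,1,2)] A by simp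
    then show ?thesis using xs sum i by (intro exI[of _ "i # xs"]) simp
  qed
qed

text \<open>A word that carries one hook to the other carries \<open>{1..int k}\<close> to
  \<open>A\<close>, so its length is at least the difference of the sums. A raising word attains
  this bound; hence minimal words are raising, and their common product makes the description by
  \<open>THE\<close> unique.\<close>

lemma comp_perm_word_raises:
  assumes A: "finite A" "A \<subseteq> {1..}" "card A = k" and k: "k \<ge> 1"
    and ws: "ws \<in> reduced_words (comp_perm (hook k A))"
  shows "raises ws {1..int k}" "word_perm ws ` {1..int k} = A"
proof -
  let ?h = "hook k {1..int k}"
  define P where "P u \<longleftrightarrow> u \<in> S_inf \<and> hook k A = act u ?h \<and>
    (\<forall>v\<in>S_inf. hook k A = act v ?h \<longrightarrow> perm_length u \<le> perm_length v)" for u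
  have cp: "comp_perm (hook k A) = (THE u. P u)"
    unfolding comp_perm_def sorted_partition_hook[OF A(1,3) k] P_def ..
  obtain xs where xs: "act (word_perm xs) ?h = hook k A" "set xs \<subseteq> {1..}"
    "\<Sum>A = \<Sum>{1..int k} + int (length xs)"
    using raising_word_exists[OF A] by blast
  have image: "word_perm ys ` {1..int k} = A" if "act (word_perm ys) ?h = hook k A" for ys
    using act_nonzero[OF bij_word_perm, of ys ?h] hook_nonzero[OF k] that by simp
  have raises: "raises ys {1..int k}"
    if "act (word_perm ys) ?h = hook k A" "length ys \<le> length xs" for ys
    using sum_word_perm_image_le[of "{1..int k}" ys] image[OF that(1)] xs(3) that(2)
    unfolding raises_def by simp
  have len: "length xs \<le> perm_length v" if v: "v \<in> S_inf" "hook k A = act v ?h" for v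
  proof -
    obtain ys where ys: "ys \<in> reduced_words v"
      using reduced_words_nonempty[of v] v(1) by (auto simp: S_inf_iff)
    then have "word_perm ys = v" "length ys = perm_length v" by (auto simp: reduced_words_def)
    then show ?thesis
      using sum_word_perm_image_le[of "{1..int k}" ys] image[of ys] xs(3) v(2) by simp
  qed
  have xsS: "word_perm xs \<in> S_inf" using xs(2) by (auto simp: S_inf_def)
  then have lxs: "perm_length (word_perm xs) = length xs"
    using len[of "word_perm xs"] perm_length_le[of xs] xs(1) by simp
  have P_word: "act (word_perm ys) ?h = hook k A \<and> length ys \<le> length xs"
    if "P u" "ys \<in> reduced_words u" for u ys
    using that xsS xs(1) lxs unfolding P_def reduced_words_def by auto
  have P: "P (word_perm xs)" unfolding P_def using xsS xs(1) lxs len by simp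
  moreover have "u = word_perm xs" if Pu: "P u" for u
  proof -
    have "permutation u" using Pu by (auto simp: S_inf_iff P_def)
    then obtain ys where ys: "ys \<in> reduced_words u" using reduced_words_nonempty by blast
    have "word_perm ys = word_perm xs"
      by (rule raises_unique[of "{1..int k}"])
         (use raises[of ys] raises[of xs] image[of ys] image[of xs] P_word[OF Pu ys] xs(1) in simp_all)
    then show ?thesis using ys by (simp add: reduced_words_def)
  qed
  ultimately have "P (comp_perm (hook k A))" unfolding cp by (metis theI)
  from P_word[OF this ws] show "raises ws {1..int k}" "word_perm ws ` {1..int k} = A"
    using raises image by blast+
qed

section \<open>The chain of Demazure operators of a hook composition\<close>

lemma BRF_O_transposition:
  assumes "k \<ge> 1"
  shows "BRF_O n (transpose 1 (int k + 1)) =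
    enc_fact (\<lambda>i. i) (\<lambda>_. False) ` bounded_shapes n k {1..int k}"
proof -
  have I: "strict_mono (\<lambda>i :: int. i)" by (simp add: strict_mono_def)
  show ?thesis
    unfolding BRF_O_def RF_O_transposition[OF assms]
    using bounded_enc_fact_iff[OF I _ assms, of _ n "\<lambda>_. False"] bounded_shapesD(1) by auto
qed

text \<open>Elements only move up, so all sets on the way lie between 1 and n. Thus every letter
  satisfies \<open>1 \<le> i < n\<close>, and \<open>nat i\<close> loses nothing.\<close>

lemma foldr_demazure_op:
  assumes k: "k \<ge> 1" and "raises xs {1..int k}" "word_perm xs ` {1..int k} \<subseteq> {..int n}"
  shows "word_perm xs ` {1..int k} \<subseteq> {1..} \<and>
    foldr (\<lambda>i. demazure_op (RF_O n (transpose 1 (int k + 1))) (nat i)) xs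
       (BRF_O n (transpose 1 (int k + 1))) =
     enc_fact (\<lambda>i. i) (\<lambda>_. False) ` bounded_shapes n k (word_perm xs ` {1..int k})"
  using assms(2,3)
proof (induction xs)
  case Nil
  then show ?case using BRF_O_transposition[OF k, of n] by simp
next
  case (Cons i xs)
  have I: "strict_mono (\<lambda>i :: int. i)" by (simp add: strict_mono_def)
  let ?A = "word_perm xs ` {1..int k}"
  note r = raises_Cons[OF finite_atLeastAtMost_int Cons.prems(1)]
  have img: "word_perm (i # xs) ` {1..int k} = simple i ` ?A" by (simp add: image_comp)
  have B: "simple i ` ?A = insert (i + 1) (?A - {i})"
    using r(2,3) by (auto simp: simple_apply image_iff)
  have i1: "i + 1 \<le> int n" using Cons.prems(2) unfolding img B by simp
  have An: "?A \<subseteq> {..int n}"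
  proof
    fix p assume "p \<in> ?A"
    then show "p \<in> {..int n}" using Cons.prems(2) i1 unfolding img B by (cases "p = i") auto
  qed
  note IH = Cons.IH[OF r(1) An]
  have i: "1 \<le> i" using IH r(2) by auto
  have card: "card ?A = k"
    using card_image[OF inj_on_subset[OF bij_is_inj[OF bij_word_perm[of xs]] subset_UNIV, of "{1..int k}"]]
    by simp
  have "demazure_op (RF_O n (transpose 1 (int k + 1))) (nat i)
      (enc_fact (\<lambda>i. i) (\<lambda>_. False) ` bounded_shapes n k ?A) =
    enc_fact (\<lambda>i. i) (\<lambda>_. False) ` e_closure (nat i) (shapes n k) (bounded_shapes n k ?A)"
    unfolding RF_O_transposition[OF k]
    by (rule demazure_op_enc_fact[OF I]) (auto dest: bounded_shapesD(1))
  also have "e_closure (nat i) (shapes n k) (bounded_shapes n k ?A) = bounded_shapes n k (simple i ` ?A)"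
    using e_closure_bounded_shapes[of ?A "nat i" k n] r(2,3) i i1 card by simp
  finally show ?case using IH i unfolding img by (auto simp: B)
qed

lemma BRF_O_comp_hook:
  assumes A: "finite A" "A \<subseteq> {1..int n}" "card A = k" and k: "k \<ge> 1"
    and ws: "ws \<in> reduced_words (comp_perm (hook k A))"
  shows "BRF_O_comp n (hook k A) ws = enc_fact (\<lambda>i. i) (\<lambda>_. False) ` bounded_shapes n k A"
proof -
  have A1: "A \<subseteq> {1..}" using A(2) by auto
  note r = comp_perm_word_raises[OF A(1) A1 A(3) k ws]
  have "word_perm ws ` {1..int k} \<subseteq> {..int n}" using r(2) A(2) by auto
  from foldr_demazure_op[OF k r(1) this] show ?thesis
    unfolding BRF_O_comp_def sorted_partition_hook[OF A(1,3) k] dominant_perm_hook[OF k] r(2) by simp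
qed


subsection \<open>One-row tableaux\<close>

text \<open>\<open>enc\<close> reads a sequence on all integers; beyond the given values it
  continues with slope 1.\<close>

lemma strict_mono_extension:
  fixes bs :: "int list"
  assumes "sorted_wrt (<) bs" "bs \<noteq> []"
  obtains I where "strict_mono I" "\<And>j. j < length bs \<Longrightarrow> I (int j + 1) = bs ! j"
proof -
  define k where "k = length bs"
  define I where "I i = (if i < 1 then bs ! 0 + i - 1 else if i > int k then bs ! (k - 1) + i - int k
    else bs ! nat (i - 1))" for i
  have k: "k \<ge> 1" using assms(2) by (simp add: k_def Suc_le_eq)
  have "I i < I (i + 1)" for i
  proof -
    consider "i < 0" | "i = 0" | "1 \<le> i" "i < int k" | "i = int k" | "i > int k" by linarith
    then show ?thesis
    proof cases
      case 3
      have "bs ! nat (i - 1) < bs ! nat i"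
        by (rule sorted_wrt_nth_less[OF assms(1)]) (use 3 in \<open>auto simp: k_def\<close>)
      then show ?thesis using 3 by (simp add: I_def)
    next
      case 4
      then show ?thesis using k by (simp add: I_def nat_diff_distrib)
    qed (use k in \<open>simp_all add: I_def\<close>)
  qed
  then have "strict_mono I" by (rule strict_mono_int)
  moreover have "I (int j + 1) = bs ! j" if "j < length bs" for j
    using that by (simp add: I_def k_def)
  ultimately show ?thesis by (rule that)
qed

lemma enc_replicate_True:
  "l < r \<Longrightarrow> enc I g l r (replicate m True) =
     map (\<lambda>j. Letter (I (r + int j)) (g (r + int j - 1))) [0..<m]"
  by (induction m arbitrary: r) (simp_all add: map_upt_Suc algebra_simps del: upt_Suc)

lemma enc_replicate_False:
  "l < r \<Longrightarrow> enc I g l r (replicate m False) =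
     map (\<lambda>j. Letter (I (l - 1 - int j)) (g (l - 1 - int j))) [0..<m]"
  by (induction m arbitrary: l) (simp_all add: map_upt_Suc algebra_simps del: upt_Suc)

lemma sorted_not_distinct:
  fixes xs :: "int list"
  assumes "sorted xs" "\<not> distinct xs"
  shows "\<exists>us a vs. xs = us @ [a, a] @ vs"
  using assms
proof (induction xs)
  case (Cons x xs)
  show ?case
  proof (cases "distinct xs")
    case True
    then obtain y ys where xs: "xs = y # ys" using Cons.prems by (cases xs) auto
    then have "x = y" using Cons.prems True by fastforce
    then have "x # xs = [] @ [x, x] @ ys" using xs by simp
    then show ?thesis by blast
  next
    case False
    then obtain us a vs where "xs = us @ [a, a] @ vs" using Cons by auto
    then have "x # xs = (x # us) @ [a, a] @ vs" by simp
    then show ?thesis by blast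
  qed
qed simp

lemma less_imp_base_le: "x < y \<Longrightarrow> base x \<le> base y"
  by (cases "primed x"; cases "primed y") (auto simp: less_letter_def)

text \<open>The row is monotone as a primed word; equal bases would be adjacent and give a square in
  a reduced word.\<close>

lemma one_row_tableau_base:
  assumes "one_row_tableau z T"
  shows "sorted_wrt (<) (map base T) \<or> sorted_wrt (<) (rev (map base T))"
    and "distinct (map base T)"
proof -
  have "T \<in> R_O z" using assms by (simp add: one_row_tableau_def)
  then obtain w where "map base T \<in> reduced_words w" by (auto simp: R_O_def)
  then have no: "map base T \<noteq> us @ [a, a] @ vs" for us a vs
    using reduced_words_no_square by metis
  consider "sorted_wrt (<) T" | "sorted_wrt (>) T" using assms by (auto simp: one_row_tableau_def)
  then have "sorted_wrt (<) (map base T) \<or> sorted_wrt (<) (rev (map base T))"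
  proof cases
    case 1
    then have s: "sorted (map base T)"
      unfolding sorted_map by (rule sorted_wrt_mono_rel[rotated]) (auto dest: less_imp_base_le)
    then have "distinct (map base T)" using sorted_not_distinct no by blast
    with s show ?thesis by (simp add: strict_sorted_iff)
  next
    case 2
    then have s: "sorted (rev (map base T))"
      unfolding sorted_wrt_rev sorted_wrt_map by (rule sorted_wrt_mono_rel[rotated]) (auto dest: less_imp_base_le)
    have "distinct (rev (map base T))"
    proof (rule ccontr)
      assume "\<not> ?thesis"
      then obtain us a vs where "rev (map base T) = us @ [a, a] @ vs" using sorted_not_distinct[OF s] by blast
      then have "map base T = rev (us @ [a, a] @ vs)" by (metis rev_rev_ident)
      then show False using no[of "rev vs" a "rev us"] by simp
    qed
    with s show ?thesis by (simp add: strict_sorted_iff)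
  qed
  then show "sorted_wrt (<) (map base T) \<or> sorted_wrt (<) (rev (map base T))" .
  then show "distinct (map base T)" by (metis distinct_rev strict_sorted_iff)
qed

text \<open>An increasing row is a \<open>False\<close> followed by steps \<open>True\<close>, a
  decreasing row consists of steps \<open>False\<close>; both start with \<open>False\<close>
  because the first letter is unprimed. The primes of the row define \<open>g\<close>, and
  \<open>marks_ok\<close> makes the gaps wide enough.\<close>

lemma one_row_tableau_enc0:
  assumes "one_row_tableau z T"
  obtains I g v where "strict_mono I" "\<And>j. g j \<Longrightarrow> I j + 2 \<le> I (j + 1)" "T = enc0 I g v"
proof -
  have T: "T \<noteq> []" "\<not> primed (hd T)" "T \<in> R_O z" using assms by (auto simp: one_row_tableau_def)
  define k where "k = length T"
  have k: "k \<ge> 1" using T(1) by (simp add: k_def Suc_le_eq)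
  note d = one_row_tableau_base(2)[OF assms]
  have "marks_ok T"
    using R_O_inv_word[OF d, of T] R_O_distinct[OF T(3) d] T(3) by simp
  then have marks: "base (T ! Suc j) \<noteq> base (T ! j) + 1 \<and> base (T ! Suc j) \<noteq> base (T ! j) - 1"
    if "Suc j < k" "primed (T ! Suc j)" for j
  proof -
    have "T = take (Suc j) T @ T ! Suc j # drop (Suc (Suc j)) T"
      using that(1) by (intro id_take_nth_drop) (simp add: k_def)
    then have "base (T ! Suc j) - 1 \<notin> base ` set (take (Suc j) T)"
      "base (T ! Suc j) + 1 \<notin> base ` set (take (Suc j) T)"
      using \<open>marks_ok T\<close> that(2) unfolding marks_ok_def by blast+
    moreover have "T ! j \<in> set (take (Suc j) T)"
      using that(1) by (simp add: k_def take_Suc_conv_app_nth)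
    ultimately show ?thesis by force
  qed
  from one_row_tableau_base(1)[OF assms] show ?thesis
  proof
    assume s: "sorted_wrt (<) (map base T)"
    obtain I where I: "strict_mono I" "\<And>j. j < k \<Longrightarrow> I (int j + 1) = base (T ! j)"
      using strict_mono_extension[OF s] T(1) by (auto simp: k_def)
    \<comment> \<open>The gap after \<open>I j\<close> is crossed by \<open>I (j + 1)\<close>, the
      letter at list position \<open>j\<close>.\<close>
    define g where "g j \<longleftrightarrow> 1 \<le> j \<and> j < int k \<and> primed (T ! nat j)" for j
    have "I j + 2 \<le> I (j + 1)" if g: "g j" for j
    proof -
      obtain i where i: "j = int (Suc i)" using g by (metis g_def nonneg_int_cases not0_implies_Suc of_nat_0 not_one_le_zero zero_le_one order_trans)
      then have "Suc i < k" "primed (T ! Suc i)" using g by (auto simp: g_def nat_add_distrib)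
      moreover have "I (int i + 1) < I (int (Suc i) + 1)" using I(1) by (simp add: strict_mono_less)
      ultimately show ?thesis using marks[of i] I(2)[of i] I(2)[of "Suc i"] i by (simp add: add.commute)
    qed
    moreover have "T = enc0 I g (False # replicate (k - 1) True)"
    proof (rule nth_equalityI)
      show "length T = length (enc0 I g (False # replicate (k - 1) True))"
        using k by (simp add: enc0_def k_def)
      fix j assume j: "j < length T"
      have e: "enc0 I g (False # replicate (k - 1) True) =
          Letter (I 1) False # map (\<lambda>j. Letter (I (2 + int j)) (g (1 + int j))) [0..<k - 1]"
        by (simp add: enc0_def count_list_replicate enc_replicate_True)
      show "T ! j = enc0 I g (False # replicate (k - 1) True) ! j"
      proof (cases j)
        case 0
        then show ?thesis unfolding e using I(2)[of 0] k T(1,2) by (simp add: hd_conv_nth letter.expand)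
      next
        case (Suc i)
        then have "g (1 + int i) = primed (T ! j)" using j by (simp add: g_def k_def nat_add_distrib)
        then show ?thesis unfolding e using Suc I(2)[of j] j by (simp add: k_def letter.expand add.commute)
      qed
    qed
    ultimately show ?thesis using that I(1) by blast
  next
    assume s: "sorted_wrt (<) (rev (map base T))"
    obtain I where I: "strict_mono I" "\<And>j. j < k \<Longrightarrow> I (int j + 1) = rev (map base T) ! j"
      using strict_mono_extension[OF s] T(1) by (auto simp: k_def)
    have I': "I (int k - int j) = base (T ! j)" if "j < k" for j
    proof -
      have "I (int (k - Suc j) + 1) = rev (map base T) ! (k - Suc j)" using that by (intro I(2)) simp
      moreover have "int (k - Suc j) + 1 = int k - int j" using that by simp
      moreover have "rev (map base T) ! (k - Suc j) = base (T ! j)"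
        using that by (simp add: rev_nth k_def)
      ultimately show ?thesis by simp
    qed
    \<comment> \<open>Now the gap after \<open>I j\<close> is crossed downwards by
      \<open>I j\<close>, the letter at list position \<open>k - j\<close>.\<close>
    define g where "g j \<longleftrightarrow> 1 \<le> j \<and> j < int k \<and> primed (T ! nat (int k - j))" for j
    have "I j + 2 \<le> I (j + 1)" if g: "g j" for j
    proof -
      define i where "i = nat (int k - j - 1)"
      have j: "j = int k - int (Suc i)" and "Suc i < k" and "nat (int k - j) = Suc i"
        using g by (auto simp: g_def i_def)
      moreover from this have "primed (T ! Suc i)" using g by (simp add: g_def)
      moreover have "I j < I (j + 1)" using I(1) by (simp add: strict_mono_less)
      moreover have "j + 1 = int k - int i" using j by simp
      moreover have "I j = base (T ! Suc i)" using I'[of "Suc i"] \<open>Suc i < k\<close> j by simp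
      ultimately show ?thesis using marks[of i] I'[of i] by simp
    qed
    moreover have "T = enc0 I g (replicate k False)"
    proof (rule nth_equalityI)
      show "length T = length (enc0 I g (replicate k False))" by (simp add: enc0_def k_def)
      fix j assume j: "j < length T"
      have "replicate k False = False # replicate (k - 1) False" using k by (cases k) auto
      then have e: "enc0 I g (replicate k False) =
          Letter (I (int k)) False # map (\<lambda>j. Letter (I (int k - 1 - int j)) (g (int k - 1 - int j))) [0..<k - 1]"
        using k by (simp add: enc0_def count_list_replicate enc_replicate_False)
      show "T ! j = enc0 I g (replicate k False) ! j"
      proof (cases j)
        case 0
        then show ?thesis unfolding e using I'[of 0] k T(1,2) by (simp add: hd_conv_nth letter.expand)
      next
        case (Suc i)
        have jk: "int k - 1 - int i = int k - int j" using Suc by simp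
        have "nat (int k - (int k - int j)) = j" by simp
        then have "g (int k - int j) = primed (T ! j)" unfolding g_def using j Suc k_def by auto
        moreover have "i < k - 1" using Suc j by (simp add: k_def)
        then have "enc0 I g (replicate k False) ! j = Letter (I (int k - int j)) (g (int k - int j))"
          unfolding e jk[symmetric] by (simp add: Suc)
        ultimately show ?thesis using I'[of j] j by (simp add: k_def letter.expand)
      qed
    qed
    ultimately show ?thesis using that I(1) by blast
  qed
qed

section \<open>The letters of the tableau lie between 1 and n\<close>

lemma inv_word_descent:
  assumes "b \<notin> set xs" "b + 1 \<notin> set xs"
  shows "inv_word (xs @ [b]) (b + 1) < inv_word (xs @ [b]) b"
proof -
  let ?z = "inv_word xs"
  have s: "supported ?z (set xs)" by (rule supported_inv_word) simp
  have z: "?z b \<le> b" "?z (b + 1) = b + 1"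
    using supportedD[OF s assms(1), of b] supportedD[OF s assms(1), of "b + 1"]
      supportedD[OF s assms(2), of "b + 1"] by auto
  then show ?thesis unfolding inv_word_snoc by (auto simp: inv_step_def simple_apply)
qed

lemma supported_S_inf:
  assumes "z \<in> S_inf" shows "supported z {1..}"
  unfolding supported_def
proof (intro allI impI)
  fix c p :: int assume "c \<notin> {1..}"
  then have c: "c \<le> 0" by simp
  have perm: "permutation z" and fixed: "\<And>q. q \<le> 0 \<Longrightarrow> z q = q" using assms by (auto simp: S_inf_iff)
  show "z p \<le> c \<longleftrightarrow> p \<le> c"
  proof
    assume "z p \<le> c"
    then have "z (z p) = z p" using c fixed by simp
    then show "p \<le> c" using perm_eq_iff[OF perm] \<open>z p \<le> c\<close> by simp
  qed (use c fixed in simp)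
qed

lemma base_enc0:
  "base ` set (enc0 I g v) = I ` {1..int (length v)}"
proof -
  have "{1 + downs v - downs v..<1 + downs v} \<union> {1 + downs v..<1 + downs v + ups v} = {1..int (length v)}"
    using length_ups_downs[of v] by auto
  then show ?thesis unfolding enc0_def base_enc[OF order_refl] by simp
qed

text \<open>The word with steps \<open>True\<close> only has the same involution and ends with its
  largest letter, which is therefore a descent of \<open>z\<close>. Positivity holds since
  \<open>z\<close> preserves every half-line \<open>{..c}\<close> with
  \<open>c \<le> 0\<close>.\<close>

lemma enc0_letters_bounded:
  assumes I: "strict_mono I" and T: "enc0 I g v \<in> R_O z" and z: "z \<in> S_inf"
    and desc: "\<And>i. i > int n \<Longrightarrow> z i < z (i + 1)"
  shows "I ` {1..int (length v)} \<subseteq> {1..int n}"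
proof (cases "v = []")
  case False
  let ?k = "length v"
  have d: "distinct (map base (enc0 I g w))" for w unfolding enc0_def by (rule distinct_enc[OF I order_refl])
  have eq: "z = inv_word (map base (enc0 I g v))" by (rule R_O_distinct[OF T d])
  have "supported (inv_word (map base (enc0 I g v))) {1..}" using supported_S_inf[OF z] eq by simp
  from supported_distinct_inv_word[OF d this]
  have pos: "I ` {1..int ?k} \<subseteq> {1..}" using base_enc0[of I g v] by simp
  obtain m where m: "?k = Suc m" using False by (cases v) auto
  let ?u = "enc0 I g (replicate m True)"
  have "enc0 I g (replicate ?k True) = ?u @ enc I g 1 (1 + int m) [True]"
  proof -
    have "replicate ?k True = replicate m True @ [True]" by (simp add: m replicate_append_same)
    then show ?thesis by (simp add: enc0_def enc_append count_list_replicate)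
  qed
  then have snoc: "map base (enc0 I g (replicate ?k True)) = map base ?u @ [I (int ?k)]"
    by (simp add: m add.commute)
  have "set (map base ?u) = I ` {1..int m}" using base_enc0[of I g "replicate m True"] by simp
  then have "I (int ?k) \<notin> set (map base ?u)" "I (int ?k) + 1 \<notin> set (map base ?u)"
  proof -
    have "x < I (int ?k)" if "x \<in> set (map base ?u)" for x
      using that \<open>set (map base ?u) = _\<close> I by (auto simp: m strict_mono_less)
    from this[of "I (int ?k)"] this[of "I (int ?k) + 1"]
    show "I (int ?k) \<notin> set (map base ?u)" "I (int ?k) + 1 \<notin> set (map base ?u)" by auto
  qed
  from inv_word_descent[OF this] have "z (I (int ?k) + 1) < z (I (int ?k))"
    using similar_enc0[OF I, of v "replicate ?k True" g] snoc by (simp add: similar_def eq)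
  then have "I (int ?k) \<le> int n" using desc[of "I (int ?k)"] by force
  then have "I i \<le> int n" if "i \<le> int ?k" for i
    using that I by (meson order_trans strict_mono_less_eq)
  then show ?thesis using pos by auto
qed simp

theorem theorem5p37:
  fixes n :: nat and z :: "int \<Rightarrow> int" and T :: "letter list"
  assumes "n \<ge> 2"
    and "z \<in> I_inf"
    and "\<And>i. i > int n \<Longrightarrow> z i < z (i + 1)"
    and "one_row_tableau z T"
    and "is \<in> reduced_words (comp_perm (alpha_O T))"
  shows "crystal_isomorphic n (BRF_O_tab n z T) (BRF_O_comp n (alpha_O T) is)"
proof -
  obtain I g v where I: "strict_mono I" and gap: "\<And>j. g j \<Longrightarrow> I j + 2 \<le> I (j + 1)"
    and T: "T = enc0 I g v"
    using one_row_tableau_enc0[OF assms(4)] by metis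
  define k where "k = length v"
  let ?A = "I ` {1..int k}"
  have R: "enc0 I g v \<in> R_O z" "T \<noteq> []" using assms(4) T by (auto simp: one_row_tableau_def)
  have k: "k \<ge> 1" "length T = k" using R(2) by (auto simp: T k_def enc0_def Suc_le_eq)
  have "z \<in> S_inf" using assms(2) by (simp add: I_inf_def)
  then have A: "?A \<subseteq> {1..int n}" unfolding k_def by (rule enc0_letters_bounded[OF I R(1) _ assms(3)])
  have card: "card ?A = k"
    using card_image[of I "{1..int k}"] I by (simp add: strict_mono_imp_inj_on inj_on_subset)
  have alpha: "alpha_O T = hook k ?A"
    using alpha_O_eq_hook[OF one_row_tableau_base(2)[OF assms(4)] R(2)] k(2) base_enc0[of I g v]
    by (simp add: T k_def)
  have "BRF_O_tab n z T = {a \<in> RF_O_tab n z T. bounded_fact a}"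
    by (auto simp: BRF_O_tab_def BRF_O_def RF_O_tab_def)
  also have "RF_O_tab n z T = enc_fact I g ` shapes n k"
    unfolding T k_def by (rule RF_O_tab_eq[OF I _ R(1)]) (rule gap)
  also have "{a \<in> enc_fact I g ` shapes n k. bounded_fact a} = enc_fact I g ` bounded_shapes n k ?A"
    using bounded_enc_fact_iff[OF I _ k(1), of _ n g] bounded_shapesD(1) by auto
  finally have tab: "BRF_O_tab n z T = enc_fact I g ` bounded_shapes n k ?A" .
  have comp: "BRF_O_comp n (alpha_O T) is = enc_fact (\<lambda>i. i) (\<lambda>_. False) ` bounded_shapes n k ?A"
    using BRF_O_comp_hook[OF _ A card k(1)] assms(5) by (simp add: alpha)
  show ?thesis
    unfolding tab comp
    by (rule crystal_isomorphic_shapes[OF I]) (auto simp: strict_mono_def dest: bounded_shapesD(1))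
qed

end
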